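(* Let $h\in(0,1)$, $K\in C^h([0,T])$, and let $K_n(t)=\sum_{k=0}^n\kappa_{n,k}t^k$ be its Bernstein polynomial approximation of order $n$. Let $\mathbb H=L^2(\mathbb R)$, $\mathcal A$ the shift $(\mathcal Af)(x)=f(x+1)$, $\nu=\mathbb 1_{[0,1]}$, $g_n=\sum_{k=0}^nk!\,\kappa_{n,k}\mathbb 1_{[-k,-k+1]}$, $\bar{\mathcal A}_n:=\mathcal A-\beta\langle g_n,\cdot\rangle\nu$, and $$\hat u_n(t)=\frac{\alpha a_2}{2a_1}\langle g_n,e^{(T-t)\bar{\mathcal A}_n}\nu\rangle,\quad t\in[0,T].$$ For $u\in L^2_a$ let $J(u)$ and $J_n(u)$ be as in the context. Then there exists $C>0$ such that $$\Big|J_n(\hat u_n)-\sup_{u\in L^2_a}J(u)\Big|\le Cn^{-h/2},$$ and moreover there exists $C>0$ such that $$\Big|J(\hat u_n)-\sup_{u\in L^2_a}J(u)\Big|\le Cn^{-h/2}.$$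
   Context: Fix $T>0$ and constants $\alpha,\beta,\sigma>0$, $a_1,a_2>0$, $X(0)\in\mathbb R$. $W$ is a standard one-dimensional Brownian motion; $L^2_a$ is the space of real-valued square-integrable processes on $\Omega\times[0,T]$ adapted to the filtration generated by $W$. $C^h([0,T])$ is the set of $h$-Hölder continuous functions on $[0,T]$. The Bernstein polynomial approximation is $K_n(t)=\frac{1}{T^n}\sum_{k=0}^nK\big(\frac{Tk}{n}\big)\binom nk t^k(T-t)^{n-k}=\sum_{k=0}^n\kappa_{n,k}t^k$ with $\kappa_{n,k}=\frac{1}{T^k}\sum_{i=0}^k(-1)^{k-i}K\big(\frac{iT}{n}\big)\binom ni\binom{n-i}{k-i}$. $J(u)=\mathbb E[-\int_0^Ta_1u^2(s)ds+a_2X^u(T)]$ and $J_n(u)=\mathbb E[-\int_0^Ta_1u^2(s)ds+a_2X^u_n(T)]$, where $X^u(t)=X(0)+\int_0^tK(t-s)(\alpha u(s)-\beta X^u(s))ds+\sigma\int_0^tK(t-s)dW(s)$ and $X^u_n$ solves the same equation with $K$ replaced by $K_n$. *)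

theory Defs
  imports "HOL-Probability.Probability"
begin

definition holder_on :: "real \<Rightarrow> real set \<Rightarrow> (real \<Rightarrow> real) \<Rightarrow> bool" where
  "holder_on h S f \<longleftrightarrow> (\<exists>L. \<forall>s\<in>S. \<forall>t\<in>S. \<bar>f s - f t\<bar> \<le> L * \<bar>s - t\<bar> powr h)"

definition bernstein :: "real \<Rightarrow> (real \<Rightarrow> real) \<Rightarrow> nat \<Rightarrow> real \<Rightarrow> real" where
  "bernstein T K n t = (1 / T ^ n) *
     (\<Sum>k\<le>n. K (T * real k / real n) * real (n choose k) * t ^ k * (T - t) ^ (n - k))"

text \<open>Monomial coefficients kappa_{n,k}.\<close>
definition kappa :: "real \<Rightarrow> (real \<Rightarrow> real) \<Rightarrow> nat \<Rightarrow> nat \<Rightarrow> real" where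
  "kappa T K n k = (1 / T ^ k) *
     (\<Sum>i\<le>k. (-1) ^ (k - i) * K (real i * T / real n) * real (n choose i) * real ((n - i) choose (k - i)))"

text \<open>Elements of H = L^2(R) are represented by functions real => real; the inner product.\<close>
definition l2_inner :: "(real \<Rightarrow> real) \<Rightarrow> (real \<Rightarrow> real) \<Rightarrow> real" where
  "l2_inner f g = (\<integral>x. f x * g x \<partial>lborel)"

definition nu :: "real \<Rightarrow> real" where
  "nu = indicator {0..1}"

definition g_fun :: "real \<Rightarrow> (real \<Rightarrow> real) \<Rightarrow> nat \<Rightarrow> real \<Rightarrow> real" where
  "g_fun T K n = (\<lambda>x. \<Sum>k\<le>n. fact k * kappa T K n k * indicator {- real k .. - real k + 1} x)"

definition shiftA :: "(real \<Rightarrow> real) \<Rightarrow> real \<Rightarrow> real" where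
  "shiftA f = (\<lambda>x. f (x + 1))"

definition Abar :: "real \<Rightarrow> real \<Rightarrow> (real \<Rightarrow> real) \<Rightarrow> nat \<Rightarrow> (real \<Rightarrow> real) \<Rightarrow> real \<Rightarrow> real" where
  "Abar \<beta> T K n f = (\<lambda>x. shiftA f x - \<beta> * l2_inner (g_fun T K n) f * nu x)"

definition exp_Abar_nu :: "real \<Rightarrow> real \<Rightarrow> (real \<Rightarrow> real) \<Rightarrow> nat \<Rightarrow> real \<Rightarrow> real \<Rightarrow> real" where
  "exp_Abar_nu \<beta> T K n s = (SOME F. F \<in> borel_measurable lborel \<and>
     (\<lambda>N. \<integral>\<^sup>+x. ennreal ((F x - (\<Sum>m<N. s ^ m / fact m * ((Abar \<beta> T K n ^^ m) nu) x))\<^sup>2) \<partial>lborel)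
       \<longlonglongrightarrow> 0)"

definition hat_u :: "real \<Rightarrow> real \<Rightarrow> real \<Rightarrow> real \<Rightarrow> real \<Rightarrow> (real \<Rightarrow> real) \<Rightarrow> nat \<Rightarrow> real \<Rightarrow> real" where
  "hat_u \<alpha> \<beta> a1 a2 T K n t =
     \<alpha> * a2 / (2 * a1) * l2_inner (g_fun T K n) (exp_Abar_nu \<beta> T K n (T - t))"

definition brownian_motion :: "'a measure \<Rightarrow> (real \<Rightarrow> 'a \<Rightarrow> real) \<Rightarrow> bool" where
  "brownian_motion M W \<longleftrightarrow> prob_space M \<and>
     (\<forall>t. W t \<in> borel_measurable M) \<and>
     (\<forall>\<omega>\<in>space M. W 0 \<omega> = 0) \<and>
     (\<forall>\<omega>\<in>space M. continuous_on {0..} (\<lambda>t. W t \<omega>)) \<and>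
     (\<forall>s t. 0 \<le> s \<and> s < t \<longrightarrow>
        distributed M lborel (\<lambda>\<omega>. W t \<omega> - W s \<omega>) (normal_density 0 (sqrt (t - s)))) \<and>
     (\<forall>ts::real list. sorted ts \<and> ts \<noteq> [] \<and> 0 \<le> hd ts \<longrightarrow>
        prob_space.indep_vars M (\<lambda>_. borel) (\<lambda>i \<omega>. W (ts ! Suc i) \<omega> - W (ts ! i) \<omega>) {..<length ts - 1})"

definition nat_filt :: "'a measure \<Rightarrow> (real \<Rightarrow> 'a \<Rightarrow> real) \<Rightarrow> real \<Rightarrow> 'a measure" where
  "nat_filt M W t = sigma (space M) {W s -` B \<inter> space M | s B. s \<in> {0..t} \<and> B \<in> sets (borel :: real measure)}"

definition PM :: "real \<Rightarrow> 'a measure \<Rightarrow> (real \<times> 'a) measure" where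
  "PM T M = restrict_space lborel {0..T} \<Otimes>\<^sub>M M"

definition L2a :: "'a measure \<Rightarrow> (real \<Rightarrow> 'a \<Rightarrow> real) \<Rightarrow> real \<Rightarrow> (real \<Rightarrow> 'a \<Rightarrow> real) \<Rightarrow> bool" where
  "L2a M W T u \<longleftrightarrow> (\<lambda>(t, \<omega>). u t \<omega>) \<in> borel_measurable (PM T M) \<and>
     (\<forall>t\<in>{0..T}. u t \<in> borel_measurable (nat_filt M W t)) \<and>
     integrable (PM T M) (\<lambda>(t, \<omega>). (u t \<omega>)\<^sup>2)"

text \<open>Wiener integral int_0^t f(s) dW(s) of a continuous deterministic integrand,
  as the L^2(P)-limit of Riemann sums over uniform partitions.\<close>
definition wiener_int :: "'a measure \<Rightarrow> (real \<Rightarrow> 'a \<Rightarrow> real) \<Rightarrow> (real \<Rightarrow> real) \<Rightarrow> real \<Rightarrow> 'a \<Rightarrow> real" where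
  "wiener_int M W f t = (SOME Z. Z \<in> borel_measurable M \<and>
     (\<lambda>N. \<integral>\<^sup>+\<omega>. ennreal ((Z \<omega> - (\<Sum>i<N. f (t * real i / real N) *
          (W (t * real (Suc i) / real N) \<omega> - W (t * real i / real N) \<omega>)))\<^sup>2) \<partial>M) \<longlonglongrightarrow> 0)"

definition sve_sol :: "'a measure \<Rightarrow> (real \<Rightarrow> 'a \<Rightarrow> real) \<Rightarrow> (real \<Rightarrow> real) \<Rightarrow> real \<Rightarrow> real \<Rightarrow> real \<Rightarrow> real \<Rightarrow> real
     \<Rightarrow> (real \<Rightarrow> 'a \<Rightarrow> real) \<Rightarrow> (real \<Rightarrow> 'a \<Rightarrow> real) \<Rightarrow> bool" where
  "sve_sol M W K T \<alpha> \<beta> \<sigma> X0 u X \<longleftrightarrow>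
     (\<lambda>(t, \<omega>). X t \<omega>) \<in> borel_measurable (PM T M) \<and>
     integrable (PM T M) (\<lambda>(t, \<omega>). (X t \<omega>)\<^sup>2) \<and>
     (\<forall>t\<in>{0..T}. AE \<omega> in M. X t \<omega> = X0 +
        (LINT s:{0..t}|lborel. K (t - s) * (\<alpha> * u s \<omega> - \<beta> * X s \<omega>)) +
        \<sigma> * wiener_int M W (\<lambda>s. K (t - s)) t \<omega>)"

text \<open>Performance functional J(u) (with kernel K); J_n is Jfun with K replaced by K_n.\<close>
definition Jfun :: "'a measure \<Rightarrow> (real \<Rightarrow> 'a \<Rightarrow> real) \<Rightarrow> (real \<Rightarrow> real) \<Rightarrow> real \<Rightarrow> real \<Rightarrow> real \<Rightarrow> real \<Rightarrow> real
     \<Rightarrow> real \<Rightarrow> real \<Rightarrow> (real \<Rightarrow> 'a \<Rightarrow> real) \<Rightarrow> real" where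
  "Jfun M W K T \<alpha> \<beta> \<sigma> X0 a1 a2 u =
     (let X = (SOME X. sve_sol M W K T \<alpha> \<beta> \<sigma> X0 u X) in
       (\<integral>\<omega>. - (LINT s:{0..T}|lborel. a1 * (u s \<omega>)\<^sup>2) + a2 * X T \<omega> \<partial>M))"

end

theory Submission
  imports Defs
begin

text \<open>
  Let \<open>r\<close> be the resolvent of the kernel, the solution of \<open>r = K - \<beta> (K * r)\<close>. Taking expectations in the
  Volterra equation removes the Wiener integral, and solving the resulting deterministic equation with \<open>r\<close>
  gives \<open>E X(T) = X0 (1 - \<beta> \<integral> r) + \<alpha> \<integral> r(T - s) E u(s) ds\<close>. Completing the square, \<open>J(u)\<close> equals its
  supremum minus \<open>a1 E \<integral> (u - u*)\<^sup>2\<close> with the deterministic optimal control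
  \<open>u*(s) = \<alpha> a2 / (2 a1) r(T - s)\<close>. The same holds for the Bernstein polynomial \<open>K_n\<close> of \<open>K\<close> and its
  resolvent \<open>r_n\<close>; expanding the operator exponential shows that \<open>\<langle>g_n, exp (t A_n) \<nu>\<rangle>\<close> is the power
  series of \<open>r_n\<close>, so \<open>hat_u\<close> is the optimal control for \<open>K_n\<close>. A Gronwall argument bounds \<open>|r_n - r|\<close>
  by \<open>|K_n - K|\<close>, which is of order \<open>n powr (- h / 2)\<close> for Hoelder continuous \<open>K\<close>.
\<close>

section \<open>Volterra convolutions and resolvents\<close>

text \<open>The Wiener integral at each t, the state in \<open>Jfun\<close> and the operator
  exponential are all Hilbert choices. Nothing is known about them before a witness exists, and
  afterwards only what all witnesses share may be used: the a.e. class of the Wiener integral, the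
  mean of X(T), the inner product with \<open>g_fun\<close>. The delicate witness is the state: the
  Wiener integrals are chosen separately for each t, so a version measurable jointly in time and
  chance must be built first.

  The resolvent of a merely continuous kernel is not obtained by a fixed point argument but as the
  uniform limit of the resolvents of the Bernstein polynomials. One stability estimate, whose
  constant depends only on T, \<beta> and a common bound of the kernels, therefore gives both
  existence and rate. The exponent h/2 reflects the variance x (1 - x) / n of the Bernstein weights:
  they concentrate within about n^(-1/2) of x. Optimal values of the two problems differ to first
  order in r_n - r, whereas using \<open>hat_u\<close> in the original problem costs only the square
  of that difference.\<close>

definition vconv :: "(real \<Rightarrow> real) \<Rightarrow> (real \<Rightarrow> real) \<Rightarrow> real \<Rightarrow> real" where
  "vconv k f t = (LINT s:{0..t}|lborel. k (t - s) * f s)"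

lemma continuous_on_Icc_bounded:
  fixes f :: "real \<Rightarrow> real"
  assumes "continuous_on {a..b} f"
  obtains B where "0 < B" "\<And>x. x \<in> {a..b} \<Longrightarrow> \<bar>f x\<bar> \<le> B"
  using compact_imp_bounded[OF compact_continuous_image[OF assms compact_Icc]]
  unfolding bounded_pos by (auto simp: image_iff)

lemma vconv_cong:
  assumes "\<And>x. 0 \<le> x \<Longrightarrow> x \<le> t \<Longrightarrow> k x = k' x" "\<And>x. 0 \<le> x \<Longrightarrow> x \<le> t \<Longrightarrow> f x = f' x"
  shows "vconv k f t = vconv k' f' t"
  unfolding vconv_def by (rule set_lebesgue_integral_cong) (use assms in auto)

lemma vconv_set_integrable:
  fixes k f :: "real \<Rightarrow> real" and t T :: real
  assumes "continuous_on {0..T} k" "continuous_on {0..T} f" "t \<in> {0..T}"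
  shows "set_integrable lborel {0..t} (\<lambda>s. k (t - s) * f s)"
proof -
  have 1: "continuous_on {0..t} (\<lambda>s. k (t - s))"
    by (rule continuous_on_compose2[OF assms(1)]) (use assms(3) in \<open>auto intro!: continuous_intros\<close>)
  have 2: "continuous_on {0..t} f"
    using assms(2) by (rule continuous_on_subset) (use assms(3) in auto)
  show ?thesis
    by (intro borel_integrable_atLeastAtMost' continuous_on_mult 1 2)
qed

lemma vconv_abs_le:
  assumes "continuous_on {0..T} k" "continuous_on {0..T} f" "t \<in> {0..T}"
    and "\<And>x. x \<in> {0..T} \<Longrightarrow> \<bar>k x\<bar> \<le> B"
  shows "\<bar>vconv k f t\<bar> \<le> B * (LINT s:{0..t}|lborel. \<bar>f s\<bar>)"
proof -
  have i: "set_integrable lborel {0..t} (\<lambda>s. \<bar>f s\<bar>)"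
    by (rule borel_integrable_atLeastAtMost', intro continuous_intros continuous_on_subset[OF assms(2)])
       (use assms(3) in auto)
  have "\<bar>vconv k f t\<bar> \<le> (LINT s:{0..t}|lborel. \<bar>k (t - s) * f s\<bar>)"
    unfolding vconv_def using set_integral_norm_bound[OF vconv_set_integrable[OF assms(1-3)]] by simp
  also have "\<dots> \<le> (LINT s:{0..t}|lborel. B * \<bar>f s\<bar>)"
    using vconv_set_integrable[OF assms(1-3)] i assms(3,4)
    by (intro set_integral_mono set_integrable_abs set_integrable_mult_right i)
       (auto simp: abs_mult intro!: mult_right_mono)
  finally show ?thesis by simp
qed

lemma vconv_diff_right:
  assumes "continuous_on {0..T} k" "continuous_on {0..T} f" "continuous_on {0..T} g" "t \<in> {0..T}"
  shows "vconv k (\<lambda>s. f s - g s) t = vconv k f t - vconv k g t"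
  unfolding vconv_def
  using set_integral_diff(2)[OF vconv_set_integrable[OF assms(1,2,4)] vconv_set_integrable[OF assms(1,3,4)]]
  by (simp add: algebra_simps)

lemma vconv_diff_left:
  assumes "continuous_on {0..T} k" "continuous_on {0..T} l" "continuous_on {0..T} f" "t \<in> {0..T}"
  shows "vconv (\<lambda>s. k s - l s) f t = vconv k f t - vconv l f t"
  unfolding vconv_def
  using set_integral_diff(2)[OF vconv_set_integrable[OF assms(1,3,4)] vconv_set_integrable[OF assms(2,3,4)]]
  by (simp add: algebra_simps)

text \<open>The reflection s -> t - s exchanges the two arguments. Affine substitution in
  \<open>lborel\<close> holds for every real function, hence so does this identity.\<close>

lemma vconv_commute: "vconv k f t = vconv f k t"
proof -
  have "vconv k f t = (\<integral>s. indicator {0..t} s * (k (t - s) * f s) \<partial>lborel)"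
    by (simp add: vconv_def set_lebesgue_integral_def)
  also have "\<dots> = (\<integral>s. indicator {0..t} (t + (-1) * s) * (k (t - (t + (-1) * s)) * f (t + (-1) * s)) \<partial>lborel)"
    using lborel_integral_real_affine[of "-1" "\<lambda>s. indicator {0..t} s * (k (t - s) * f s)" t] by simp
  also have "\<dots> = vconv f k t"
    unfolding vconv_def set_lebesgue_integral_def
    by (rule Bochner_Integration.integral_cong) (auto simp: indicator_def)
  finally show ?thesis .
qed

text \<open>The maximum of the weighted function \<open>exp (- 2 c t) |d t|\<close> absorbs half of itself.\<close>
lemma gronwall_volterra:
  fixes d :: "real \<Rightarrow> real"
  assumes T: "0 \<le> T" and d: "continuous_on {0..T} d" and c: "0 < c" and e: "0 \<le> \<epsilon>"
    and le: "\<And>t. t \<in> {0..T} \<Longrightarrow> \<bar>d t\<bar> \<le> \<epsilon> + c * (LINT s:{0..t}|lborel. \<bar>d s\<bar>)"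
    and t: "t \<in> {0..T}"
  shows "\<bar>d t\<bar> \<le> 2 * \<epsilon> * exp (2 * c * T)"
proof -
  define w where "w t = exp (- 2 * c * t) * \<bar>d t\<bar>" for t
  have "continuous_on {0..T} w" unfolding w_def by (intro continuous_intros d)
  then obtain t0 where t0: "t0 \<in> {0..T}" and mx: "\<And>x. x \<in> {0..T} \<Longrightarrow> w x \<le> w t0"
    using continuous_attains_sup[of "{0..T}" w] T by auto
  have dw: "\<bar>d x\<bar> = w x * exp (2 * c * x)" for x
    by (simp add: w_def mult.assoc flip: exp_add)
  have w0: "0 \<le> w t0" by (simp add: w_def)
  have cs: "continuous_on {0..t0} (\<lambda>s. \<bar>d s\<bar>)"
    by (intro continuous_intros continuous_on_subset[OF d]) (use t0 in auto)
  have "(LINT s:{0..t0}|lborel. \<bar>d s\<bar>) \<le> (LINT s:{0..t0}|lborel. w t0 * exp (2 * c * s))"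
    by (intro set_integral_mono borel_integrable_atLeastAtMost' cs continuous_intros)
       (use t0 in \<open>auto simp: dw intro!: mx\<close>)
  also have "\<dots> = w t0 * (LINT s:{0..t0}|lborel. exp (2 * c * s))" by simp
  also have "(LINT s:{0..t0}|lborel. exp (2 * c * s)) = exp (2*c*t0) / (2*c) - exp (2*c*0) / (2*c)"
    unfolding set_lebesgue_integral_def
    by (rule integral_FTC_atLeastAtMost)
       (use t0 c in \<open>auto intro!: derivative_eq_intros continuous_intros simp: has_real_derivative_iff_has_vector_derivative[symmetric]\<close>)
  also have "w t0 * (exp (2*c*t0) / (2*c) - exp (2*c*0) / (2*c)) \<le> w t0 * (exp (2*c*t0) / (2*c))"
    using c w0 by (intro mult_left_mono) auto
  \<comment> \<open>The weight decays at rate 2c rather than c exactly so that c / (2c) is one half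
    and the integral term can be absorbed on the left.\<close>
  finally have "c * (LINT s:{0..t0}|lborel. \<bar>d s\<bar>) \<le> c * (w t0 * (exp (2*c*t0) / (2*c)))"
    using c by (intro mult_left_mono) auto
  also have "\<dots> = w t0 * exp (2*c*t0) / 2" using c by simp
  finally have "w t0 * exp (2 * c * t0) \<le> \<epsilon> + w t0 * exp (2*c*t0) / 2"
    using le[OF t0] dw[of t0] by linarith
  then have "w t0 * exp (2 * c * t0) \<le> 2 * \<epsilon>" by simp
  moreover have "w t0 * 1 \<le> w t0 * exp (2 * c * t0)"
    using w0 t0 c by (intro mult_left_mono) auto
  ultimately have w2: "w t0 \<le> 2 * \<epsilon>" by simp
  have "\<bar>d t\<bar> \<le> 2 * \<epsilon> * exp (2 * c * t)"
    using mx[OF t] w2 by (simp add: dw)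
  also have "\<dots> \<le> 2 * \<epsilon> * exp (2 * c * T)"
    using t c e by (intro mult_left_mono) auto
  finally show ?thesis .
qed

lemma set_integral_abs_le_const:
  assumes "continuous_on {0..T} f" "t \<in> {0..T}" "\<And>x. x \<in> {0..T} \<Longrightarrow> \<bar>f x\<bar> \<le> (C::real)"
  shows "(LINT s:{0..t}|lborel. \<bar>f s\<bar>) \<le> T * C"
proof -
  have "(LINT s:{0..t}|lborel. \<bar>f s\<bar>) \<le> (LINT s:{0..t}|lborel. C)"
    by (intro set_integral_mono borel_integrable_atLeastAtMost' continuous_intros continuous_on_subset[OF assms(1)])
       (use assms in auto)
  also have "\<dots> = t * C" using assms(2) by (simp add: set_lebesgue_integral_def)
  also have "\<dots> \<le> T * C" using assms(2) assms(3)[OF assms(2)] by (intro mult_right_mono) auto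
  finally show ?thesis .
qed

text \<open>With this sign, subtracting \<beta> times the convolution with r inverts adding \<beta>
  times the convolution with K, which is how r solves the state equation. Continuity is built in so
  that the convolutions are integrable wherever the equation is used.\<close>

definition resolvent_on :: "real \<Rightarrow> real \<Rightarrow> (real \<Rightarrow> real) \<Rightarrow> (real \<Rightarrow> real) \<Rightarrow> bool" where
  "resolvent_on T \<beta> K r \<longleftrightarrow> continuous_on {0..T} K \<and> continuous_on {0..T} r \<and>
     (\<forall>t\<in>{0..T}. r t = K t - \<beta> * vconv K r t)"

text \<open>The equation makes |r| at most B plus \<beta> B times the integral of |r|, and Gronwall
  applies. K enters only through B, so one bound serves a whole sequence of kernels.\<close>

lemma resolvent_on_bound:
  assumes T: "0 \<le> T" and b: "0 < \<beta>" and B: "0 < B"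
    and r: "resolvent_on T \<beta> K r"
    and K: "\<And>x. x \<in> {0..T} \<Longrightarrow> \<bar>K x\<bar> \<le> B" and t: "t \<in> {0..T}"
  shows "\<bar>r t\<bar> \<le> 2 * B * exp (2 * (\<beta> * B) * T)"
proof (rule gronwall_volterra[OF T _ _ _ _ t])
  show "continuous_on {0..T} r" using r by (simp add: resolvent_on_def)
  show "0 < \<beta> * B" "0 \<le> B" using b B by auto
  fix t assume t: "t \<in> {0..T}"
  have "\<bar>vconv K r t\<bar> \<le> B * (LINT s:{0..t}|lborel. \<bar>r s\<bar>)"
    by (rule vconv_abs_le) (use r t K in \<open>auto simp: resolvent_on_def\<close>)
  then have "\<bar>\<beta> * vconv K r t\<bar> \<le> \<beta> * (B * (LINT s:{0..t}|lborel. \<bar>r s\<bar>))"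
    using b by (simp add: abs_mult)
  moreover have "r t = K t - \<beta> * vconv K r t" using r t by (auto simp: resolvent_on_def)
  ultimately show "\<bar>r t\<bar> \<le> B + \<beta> * B * (LINT s:{0..t}|lborel. \<bar>r s\<bar>)"
    using K[OF t] by (simp add: mult.assoc)
qed

text \<open>Two Gronwall bounds combined: the inner
  \<open>2 * B * exp (2 * (\<beta> * B) * T)\<close> bounds a resolvent, and T times it bounds its
  integral; the outer factor 2 and the outer exponential come from Gronwall for the difference of
  two resolvents.\<close>

definition stab_const :: "real \<Rightarrow> real \<Rightarrow> real \<Rightarrow> real" where
  "stab_const T \<beta> B = 2 * (1 + \<beta> * (T * (2 * B * exp (2 * (\<beta> * B) * T)))) * exp (2 * (\<beta> * B) * T)"

lemma stab_const_pos: "0 \<le> T \<Longrightarrow> 0 < \<beta> \<Longrightarrow> 0 < B \<Longrightarrow> 0 < stab_const T \<beta> B"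
  by (auto simp: stab_const_def intro!: mult_pos_pos add_pos_nonneg)

text \<open>Writing conv for convolution, r - q = (K - L) - \<beta> ((K - L) conv r) - \<beta> (L
  conv (r - q)). The first two terms are of order \<epsilon> because r is bounded, and the last one
  is what Gronwall handles.\<close>

lemma resolvent_on_stability:
  assumes T: "0 \<le> T" and b: "0 < \<beta>" and B: "0 < B" and e: "0 \<le> \<epsilon>"
    and r: "resolvent_on T \<beta> K r" and q: "resolvent_on T \<beta> L q"
    and K: "\<And>x. x \<in> {0..T} \<Longrightarrow> \<bar>K x\<bar> \<le> B" and L: "\<And>x. x \<in> {0..T} \<Longrightarrow> \<bar>L x\<bar> \<le> B"
    and KL: "\<And>x. x \<in> {0..T} \<Longrightarrow> \<bar>K x - L x\<bar> \<le> \<epsilon>" and t: "t \<in> {0..T}"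
  shows "\<bar>r t - q t\<bar> \<le> stab_const T \<beta> B * \<epsilon>"
proof -
  define Y where "Y = 2 * B * exp (2 * (\<beta> * B) * T)"
  have Y: "0 \<le> Y" using B by (simp add: Y_def)
  have cont: "continuous_on {0..T} K" "continuous_on {0..T} L" "continuous_on {0..T} r" "continuous_on {0..T} q"
    using r q by (auto simp: resolvent_on_def)
  have "\<bar>r t - q t\<bar> \<le> 2 * (\<epsilon> * (1 + \<beta> * (T * Y))) * exp (2 * (\<beta> * B) * T)"
  proof (rule gronwall_volterra[OF T _ _ _ _ t, of "\<lambda>t. r t - q t"])
    show "continuous_on {0..T} (\<lambda>t. r t - q t)" by (intro continuous_intros cont)
    show "0 < \<beta> * B" using b B by auto
    show "0 \<le> \<epsilon> * (1 + \<beta> * (T * Y))" using b T Y e by simp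
    fix t assume t: "t \<in> {0..T}"
    have "\<bar>vconv (\<lambda>s. K s - L s) r t\<bar> \<le> \<epsilon> * (LINT s:{0..t}|lborel. \<bar>r s\<bar>)"
      by (rule vconv_abs_le) (use cont t KL in \<open>auto intro!: continuous_intros\<close>)
    also have "\<dots> \<le> \<epsilon> * (T * Y)"
      by (intro mult_left_mono set_integral_abs_le_const e cont t)
         (unfold Y_def, rule resolvent_on_bound[OF T b B r K])
    finally have 1: "\<bar>\<beta> * vconv (\<lambda>s. K s - L s) r t\<bar> \<le> \<beta> * (\<epsilon> * (T * Y))"
      using b by (simp add: abs_mult)
    have "\<bar>vconv L (\<lambda>s. r s - q s) t\<bar> \<le> B * (LINT s:{0..t}|lborel. \<bar>r s - q s\<bar>)"
      by (rule vconv_abs_le) (use cont t L in \<open>auto intro!: continuous_intros\<close>)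
    then have 2: "\<bar>\<beta> * vconv L (\<lambda>s. r s - q s) t\<bar> \<le> \<beta> * (B * (LINT s:{0..t}|lborel. \<bar>r s - q s\<bar>))"
      using b by (simp add: abs_mult)
    have "r t = K t - \<beta> * vconv K r t" "q t = L t - \<beta> * vconv L q t"
      using r q t by (auto simp: resolvent_on_def)
    then have "r t - q t = (K t - L t) - \<beta> * vconv (\<lambda>s. K s - L s) r t - \<beta> * vconv L (\<lambda>s. r s - q s) t"
      using cont t by (simp add: vconv_diff_left vconv_diff_right algebra_simps)
    then have "\<bar>r t - q t\<bar> \<le> \<epsilon> + \<beta> * (\<epsilon> * (T * Y)) + \<beta> * (B * (LINT s:{0..t}|lborel. \<bar>r s - q s\<bar>))"
      using 1 2 KL[OF t] by linarith
    then show "\<bar>r t - q t\<bar> \<le> \<epsilon> * (1 + \<beta> * (T * Y)) + \<beta> * B * (LINT s:{0..t}|lborel. \<bar>r s - q s\<bar>)"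
      by (simp add: algebra_simps)
  qed
  then show ?thesis by (simp add: stab_const_def Y_def mult_ac)
qed

text \<open>Existence of the resolvent by approximation: stability turns uniform convergence of the
  kernels into a uniform Cauchy property of the resolvents, and the equation passes to the limit by
  dominated convergence.\<close>

lemma resolvent_on_limit:
  assumes T: "0 \<le> T" and b: "0 < \<beta>" and B: "0 < B"
    and r: "\<And>n. resolvent_on T \<beta> (Kn n) (rn n)" and cK: "continuous_on {0..T} K"
    and Kn: "\<And>n x. x \<in> {0..T} \<Longrightarrow> \<bar>Kn n x\<bar> \<le> B"
    and lim: "uniform_limit {0..T} Kn K sequentially"
  obtains r where "resolvent_on T \<beta> K r"
proof -
  define S where "S = stab_const T \<beta> B"
  have S: "0 < S" unfolding S_def by (rule stab_const_pos[OF T b B])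
  have "uniformly_Cauchy_on {0..T} rn"
  proof (rule uniformly_Cauchy_onI)
    fix e :: real assume e: "e > 0"
    have "uniformly_Cauchy_on {0..T} Kn"
      using lim by (auto simp: uniformly_convergent_eq_Cauchy[symmetric] uniformly_convergent_on_def)
    \<comment> \<open>Stability yields a weak inequality with factor S; the extra 1/2 leaves room
      for the strict one.\<close>
    then obtain M where M: "\<And>x m n. x \<in> {0..T} \<Longrightarrow> m \<ge> M \<Longrightarrow> n \<ge> M \<Longrightarrow> dist (Kn m x) (Kn n x) < e / (2*S)"
      unfolding uniformly_Cauchy_on_def using e S by (metis divide_pos_pos mult_pos_pos zero_less_numeral)
    show "\<exists>M. \<forall>x\<in>{0..T}. \<forall>m\<ge>M. \<forall>n\<ge>M. dist (rn m x) (rn n x) < e"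
    proof (intro exI[of _ M] ballI allI impI)
      fix x m n assume x: "x \<in> {0..T}" and mn: "M \<le> m" "M \<le> n"
      have "\<bar>rn m x - rn n x\<bar> \<le> S * (e / (2*S))"
        unfolding S_def
        by (rule resolvent_on_stability[OF T b B _ r r Kn Kn _ x])
           (use e M mn S in \<open>auto simp: dist_real_def S_def less_imp_le\<close>)
      also have "\<dots> < e" using e S by simp
      finally show "dist (rn m x) (rn n x) < e" by (simp add: dist_real_def)
    qed
  qed
  then obtain r0 where r0: "uniform_limit {0..T} rn r0 sequentially"
    by (auto simp: uniformly_convergent_eq_Cauchy[symmetric] uniformly_convergent_on_def)
  have c0: "continuous_on {0..T} r0"
    by (rule uniform_limit_theorem[OF _ r0]) (use r in \<open>auto simp: resolvent_on_def\<close>)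
  have "resolvent_on T \<beta> K r0"
    unfolding resolvent_on_def
  proof (intro conjI ballI cK c0)
    fix t assume t: "t \<in> {0..T}"
    have "(\<lambda>n. vconv (Kn n) (rn n) t) \<longlonglongrightarrow> vconv K r0 t"
      unfolding vconv_def set_lebesgue_integral_def
    \<comment> \<open>The majorant is the kernel bound times the bound of
      \<open>resolvent_on_bound\<close>; neither depends on n.\<close>
    proof (rule integral_dominated_convergence[where w="\<lambda>s. indicator {0..t} s * (B * (2 * B * exp (2 * (\<beta> * B) * T)))"])
      show "(\<lambda>s. indicator {0..t} s *\<^sub>R (K (t - s) * r0 s)) \<in> borel_measurable lborel"
        using vconv_set_integrable[OF cK c0 t] by (auto simp: set_integrable_def)
      show "(\<lambda>s. indicator {0..t} s *\<^sub>R (Kn n (t - s) * rn n s)) \<in> borel_measurable lborel" for n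
        using vconv_set_integrable[OF _ _ t, of "Kn n" "rn n"] r[of n] by (auto simp: set_integrable_def resolvent_on_def)
      show "integrable lborel (\<lambda>s. indicator {0..t} s * (B * (2 * B * exp (2 * (\<beta> * B) * T))))"
        by (intro integrable_mult_left integrable_real_indicator) (auto simp: emeasure_lborel_Icc_eq)
      have pk: "(\<lambda>n. Kn n x) \<longlonglongrightarrow> K x" "(\<lambda>n. rn n x) \<longlonglongrightarrow> r0 x" if "x \<in> {0..T}" for x
        using tendsto_uniform_limitI[OF lim that] tendsto_uniform_limitI[OF r0 that] by auto
      have "(\<lambda>n. indicator {0..t} s *\<^sub>R (Kn n (t - s) * rn n s))
            \<longlonglongrightarrow> indicator {0..t} s *\<^sub>R (K (t - s) * r0 s)" for s
        by (cases "s \<in> {0..t}") (use t in \<open>auto intro!: tendsto_intros pk\<close>)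
      then show "AE s in lborel. (\<lambda>n. indicator {0..t} s *\<^sub>R (Kn n (t - s) * rn n s))
            \<longlonglongrightarrow> indicator {0..t} s *\<^sub>R (K (t - s) * r0 s)" by simp
      show "AE s in lborel. norm (indicator {0..t} s *\<^sub>R (Kn n (t - s) * rn n s))
           \<le> indicator {0..t} s * (B * (2 * B * exp (2 * (\<beta> * B) * T)))" for n
      proof (rule AE_I2)
        fix s show "norm (indicator {0..t} s *\<^sub>R (Kn n (t - s) * rn n s))
           \<le> indicator {0..t} s * (B * (2 * B * exp (2 * (\<beta> * B) * T)))"
        proof (cases "s \<in> {0..t}")
          case True
          then have "\<bar>Kn n (t - s)\<bar> * \<bar>rn n s\<bar> \<le> B * (2 * B * exp (2 * (\<beta> * B) * T))"
            using t B by (intro mult_mono Kn resolvent_on_bound[OF T b B r Kn]) auto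
          then show ?thesis using True by (simp add: abs_mult)
        qed simp
      qed
    qed
    then have "(\<lambda>n. Kn n t - \<beta> * vconv (Kn n) (rn n) t) \<longlonglongrightarrow> K t - \<beta> * vconv K r0 t"
      by (intro tendsto_intros tendsto_uniform_limitI[OF lim t])
    moreover have "(\<lambda>n. Kn n t - \<beta> * vconv (Kn n) (rn n) t) = (\<lambda>n. rn n t)"
      using r t by (auto simp: resolvent_on_def fun_eq_iff)
    ultimately show "r0 t = K t - \<beta> * vconv K r0 t"
      using tendsto_uniform_limitI[OF r0 t] LIMSEQ_unique by auto
  qed
  then show ?thesis by (rule that)
qed

section \<open>Resolvents of polynomial kernels\<close>

lemma DERIV_power_fact:
  "((\<lambda>s. s ^ Suc j / fact (Suc j)) has_real_derivative s ^ j / fact j) (at s within A)"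
proof -
  have "((\<lambda>s. s ^ Suc j / fact (Suc j)) has_real_derivative real (Suc j) * s ^ j / fact (Suc j)) (at s within A)"
    using DERIV_cdivide[OF DERIV_pow[of "Suc j" s A], of "fact (Suc j)"]
    by (simp only: diff_Suc_1 One_nat_def[symmetric])
  moreover have "real (Suc j) * s ^ j / fact (Suc j) = s ^ j / fact j"
    by (simp add: fact_Suc del: of_nat_Suc)
  ultimately show ?thesis by (simp only:)
qed

text \<open>The Beta integral. Integration by parts moves one power from t - s to s; the boundary
  terms vanish because both factors then carry a positive exponent. Since this raises m, the
  induction keeps m arbitrary. Normalised by factorials, monomials convolve without numerical
  factors, which is why all later series are written in t^k / k!.\<close>

lemma power_fact_conv:
  fixes t :: real
  assumes "0 \<le> t"
  shows "(LINT s:{0..t}|lborel. (t - s) ^ k / fact k * (s ^ m / fact m)) = t ^ (k + m + 1) / fact (k + m + 1)"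
proof (induction k arbitrary: m)
  case 0
  have "(LINT s:{0..t}|lborel. s ^ m / fact m) = t ^ Suc m / fact (Suc m) - 0 ^ Suc m / fact (Suc m)"
    unfolding set_lebesgue_integral_def
  proof (rule integral_FTC_atLeastAtMost[OF assms])
    show "((\<lambda>s. s ^ Suc m / fact (Suc m)) has_vector_derivative s ^ m / fact m) (at s within {0..t})" for s
      unfolding has_real_derivative_iff_has_vector_derivative[symmetric] by (rule DERIV_power_fact)
    show "continuous_on {0..t} (\<lambda>s. s ^ m / fact m)" by (intro continuous_intros) auto
  qed
  then show ?case by simp
next
  case (Suc k)
  let ?F = "\<lambda>s. (t - s) ^ Suc k / fact (Suc k) * (s ^ Suc m / fact (Suc m))"
  have i: "set_integrable lborel {0..t} (\<lambda>s. (t - s) ^ a / fact a * (s ^ b / fact b))" for a b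
    by (intro borel_integrable_atLeastAtMost' continuous_intros) auto
  have "(LINT s:{0..t}|lborel. (t - s) ^ Suc k / fact (Suc k) * (s ^ m / fact m) - (t - s) ^ k / fact k * (s ^ Suc m / fact (Suc m)))
     = ?F t - ?F 0"
    unfolding set_lebesgue_integral_def
  proof (rule integral_FTC_atLeastAtMost[OF assms])
    show "continuous_on {0..t} (\<lambda>s. (t - s) ^ Suc k / fact (Suc k) * (s ^ m / fact m) - (t - s) ^ k / fact k * (s ^ Suc m / fact (Suc m)))"
      by (intro continuous_intros) auto
    fix s
    from DERIV_chain2[OF DERIV_power_fact, of "\<lambda>s. t - s" "-1" s "{0..t}" k]
    have 2: "((\<lambda>s. (t - s) ^ Suc k / fact (Suc k)) has_real_derivative (t - s) ^ k / fact k * (-1)) (at s within {0..t})"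
      by (rule meta_mp) (auto intro!: derivative_eq_intros)
    show "(?F has_vector_derivative (t - s) ^ Suc k / fact (Suc k) * (s ^ m / fact m) - (t - s) ^ k / fact k * (s ^ Suc m / fact (Suc m))) (at s within {0..t})"
      unfolding has_real_derivative_iff_has_vector_derivative[symmetric]
      using DERIV_mult[OF 2 DERIV_power_fact] by (rule DERIV_cong) (simp add: algebra_simps)
  qed
  then have "(LINT s:{0..t}|lborel. (t - s) ^ Suc k / fact (Suc k) * (s ^ m / fact m)) =
       (LINT s:{0..t}|lborel. (t - s) ^ k / fact k * (s ^ Suc m / fact (Suc m)))"
    using set_integral_diff(2)[OF i[of "Suc k" m] i[of k "Suc m"]] by simp
  then show ?case using Suc.IH[of "Suc m"] by simp
qed

text \<open>Taylor coefficients of the resolvent of the kernel with Taylor coefficients \<open>\<gamma>\<close>.\<close>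
fun res_coeff :: "real \<Rightarrow> (nat \<Rightarrow> real) \<Rightarrow> nat \<Rightarrow> real" where
  "res_coeff \<beta> \<gamma> m = \<gamma> m - \<beta> * (\<Sum>i<m. res_coeff \<beta> \<gamma> i * \<gamma> (m - 1 - i))"

declare res_coeff.simps [simp del]

text \<open>Absolute values in the recursion lead to the majorant x_m = G + \<beta> G (x_0 + ... +
  x_{m-1}), whose solution is this geometric sequence.\<close>

lemma res_coeff_bound:
  assumes g: "\<And>k. \<bar>\<gamma> k\<bar> \<le> G" and b: "0 < \<beta>"
  shows "\<bar>res_coeff \<beta> \<gamma> m\<bar> \<le> G * (1 + \<beta> * G) ^ m"
proof (induction m rule: less_induct)
  case (less m)
  have G: "0 \<le> G" using g[of 0] by linarith
  have gs: "\<beta> * G * (\<Sum>i<m. (1 + \<beta> * G) ^ i) = (1 + \<beta> * G) ^ m - 1"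
    using power_diff_1_eq[of "1 + \<beta> * G" m] by simp
  have "\<bar>\<Sum>i<m. res_coeff \<beta> \<gamma> i * \<gamma> (m - 1 - i)\<bar> \<le> (\<Sum>i<m. G * (1 + \<beta> * G) ^ i * G)"
    by (rule order_trans[OF sum_abs]) (use less G b g in \<open>auto simp: abs_mult intro!: sum_mono mult_mono\<close>)
  also have "\<dots> = G * (G * (\<Sum>i<m. (1 + \<beta> * G) ^ i))"
    by (simp add: sum_distrib_left mult_ac)
  finally have "\<beta> * \<bar>\<Sum>i<m. res_coeff \<beta> \<gamma> i * \<gamma> (m - 1 - i)\<bar> \<le> \<beta> * (G * (G * (\<Sum>i<m. (1 + \<beta> * G) ^ i)))"
    using b by (intro mult_left_mono) auto
  also have "\<dots> = G * ((1 + \<beta> * G) ^ m - 1)" unfolding gs[symmetric] by (simp only: mult_ac)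
  finally have 1: "\<bar>\<beta> * (\<Sum>i<m. res_coeff \<beta> \<gamma> i * \<gamma> (m - 1 - i))\<bar> \<le> G * ((1 + \<beta> * G) ^ m - 1)"
    using b by (simp add: abs_mult)
  have "\<bar>res_coeff \<beta> \<gamma> m\<bar> \<le> \<bar>\<gamma> m\<bar> + \<bar>\<beta> * (\<Sum>i<m. res_coeff \<beta> \<gamma> i * \<gamma> (m - 1 - i))\<bar>"
    by (subst res_coeff.simps) linarith
  also have "\<dots> \<le> G + G * ((1 + \<beta> * G) ^ m - 1)" using 1 g[of m] by linarith
  finally show ?case by (simp add: algebra_simps)
qed

definition res_series :: "real \<Rightarrow> (nat \<Rightarrow> real) \<Rightarrow> real \<Rightarrow> real" where
  "res_series \<beta> \<gamma> t = (\<Sum>m. res_coeff \<beta> \<gamma> m * (t ^ m / fact m))"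

text \<open>Geometric growth of the coefficients loses against the factorial: the series is
  dominated by that of G exp ((1 + \<beta> G) |t|).\<close>

lemma res_series_abs_summable:
  assumes g: "\<And>k. \<bar>\<gamma> k\<bar> \<le> G" and b: "0 < \<beta>"
  shows "summable (\<lambda>m. \<bar>res_coeff \<beta> \<gamma> m * (t ^ m / fact m)\<bar>)"
proof (rule summable_comparison_test', rule summable_mult[of _ G])
  show "summable (\<lambda>m. ((1 + \<beta> * G) * \<bar>t\<bar>) ^ m / fact m)"
    using summable_exp[of "(1 + \<beta> * G) * \<bar>t\<bar>"] by (simp add: divide_inverse mult.commute)
  fix m :: nat
  have "\<bar>res_coeff \<beta> \<gamma> m\<bar> * (\<bar>t\<bar> ^ m / fact m) \<le> G * (1 + \<beta> * G) ^ m * (\<bar>t\<bar> ^ m / fact m)"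
    by (intro mult_right_mono res_coeff_bound g b) auto
  then show "norm \<bar>res_coeff \<beta> \<gamma> m * (t ^ m / fact m)\<bar> \<le> G * (((1 + \<beta> * G) * \<bar>t\<bar>) ^ m / fact m)"
    by (simp add: abs_mult power_mult_distrib power_abs mult_ac)
qed

text \<open>Convolving term by term produces \<gamma>_k b_m t^(k+m+1) / (k+m+1)!. Collecting equal M
  = k + m + 1 gives exactly the sum in the recursion of \<open>res_coeff\<close>, so the Volterra
  equation holds coefficientwise. As the kernel is a polynomial, only the sum over m has to be
  interchanged with the integral.\<close>

lemma resolvent_on_res_series:
  assumes b: "0 < \<beta>" and T: "0 \<le> T" and z: "\<And>k. n < k \<Longrightarrow> \<gamma> k = 0"
  shows "resolvent_on T \<beta> (\<lambda>t. \<Sum>k\<le>n. \<gamma> k * (t ^ k / fact k)) (res_series \<beta> \<gamma>)"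
proof -
  define G where "G = (\<Sum>k\<le>n. \<bar>\<gamma> k\<bar>)"
  have g: "\<bar>\<gamma> k\<bar> \<le> G" for k
  proof (cases "k \<le> n")
    case True
    then show ?thesis unfolding G_def by (intro member_le_sum) auto
  next
    case False
    then show ?thesis by (simp add: z G_def sum_nonneg)
  qed
  let ?b = "res_coeff \<beta> \<gamma>"
  let ?P = "\<lambda>t. \<Sum>k\<le>n. \<gamma> k * (t ^ k / fact k)"
  have sm: "summable (\<lambda>m. \<bar>?b m * (t ^ m / fact m)\<bar>)" for t
    by (rule res_series_abs_summable[OF g b])
  have sm': "summable (\<lambda>m. ?b m * (t ^ m / fact m))" for t
    using sm[of t] summable_norm_cancel[of "\<lambda>m. ?b m * (t ^ m / fact m)"] by simp
  have sm2: "summable (\<lambda>m. ?b m / fact m * t ^ m)" for t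
    using sm'[of t] by simp
  have "isCont (res_series \<beta> \<gamma>) t" for t
    using isCont_powser[OF sm2, of t "\<bar>t\<bar> + 1"]
    by (simp add: res_series_def[abs_def])
  then have cr: "continuous_on {0..T} (res_series \<beta> \<gamma>)"
    by (simp add: continuous_at_imp_continuous_on)
  have cP: "continuous_on {0..T} ?P" by (intro continuous_intros) auto
  have "res_series \<beta> \<gamma> t = ?P t - \<beta> * vconv ?P (res_series \<beta> \<gamma>) t" if t: "t \<in> {0..T}" for t
  proof -
    let ?f = "\<lambda>m s. indicator {0..t} s *\<^sub>R (?P (t - s) * (?b m * (s ^ m / fact m)))"
    obtain B where B0: "0 < B" and B: "\<And>x. x \<in> {0..T} \<Longrightarrow> \<bar>?P x\<bar> \<le> B"
      using continuous_on_Icc_bounded[OF cP] by blast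
    have int: "integrable lborel (?f m)" for m
      unfolding set_integrable_def[symmetric]
      by (intro borel_integrable_atLeastAtMost' continuous_intros) auto
    have val: "(\<integral>s. ?f m s \<partial>lborel) = (\<Sum>k\<le>n. \<gamma> k * (?b m * (t ^ (k + m + 1) / fact (k + m + 1))))" for m
    proof -
      have "(\<integral>s. ?f m s \<partial>lborel) = (\<integral>s. (\<Sum>k\<le>n. \<gamma> k * (?b m * (indicator {0..t} s *\<^sub>R ((t - s) ^ k / fact k * (s ^ m / fact m))))) \<partial>lborel)"
        by (rule Bochner_Integration.integral_cong) (auto simp: sum_distrib_left sum_distrib_right mult_ac)
      also have "\<dots> = (\<Sum>k\<le>n. \<gamma> k * (?b m * (\<integral>s. indicator {0..t} s *\<^sub>R ((t - s) ^ k / fact k * (s ^ m / fact m)) \<partial>lborel)))"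
      proof (subst Bochner_Integration.integral_sum)
        fix k
        have "set_integrable lborel {0..t} (\<lambda>s. (t - s) ^ k / fact k * (s ^ m / fact m))"
          by (intro borel_integrable_atLeastAtMost' continuous_intros) auto
        then show "integrable lborel (\<lambda>s. \<gamma> k * (?b m * (indicator {0..t} s *\<^sub>R ((t - s) ^ k / fact k * (s ^ m / fact m)))))"
          unfolding set_integrable_def by (intro integrable_mult_right)
      qed simp
      also have "\<dots> = (\<Sum>k\<le>n. \<gamma> k * (?b m * (t ^ (k + m + 1) / fact (k + m + 1))))"
        using power_fact_conv[of t] t by (simp add: set_lebesgue_integral_def)
      finally show ?thesis .
    qed
    have bd: "norm (?f m s) \<le> indicator {0..t} s * (B * \<bar>?b m * (t ^ m / fact m)\<bar>)" for m s
    proof (cases "s \<in> {0..t}")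
      case True
      have "\<bar>?P (t - s)\<bar> * (\<bar>?b m\<bar> * (s ^ m / fact m)) \<le> B * (\<bar>?b m\<bar> * (t ^ m / fact m))"
        using True t B0 by (intro mult_mono B divide_right_mono power_mono) auto
      then show ?thesis using True t by (simp add: abs_mult)
    qed simp
    \<comment> \<open>Interchange of sum and integral: on [0, t] the m-th term is at most the kernel
      bound times the m-th term of the series at the endpoint t, which is summable.\<close>
    have "(\<lambda>m. \<integral>s. ?f m s \<partial>lborel) sums (\<integral>s. (\<Sum>m. ?f m s) \<partial>lborel)"
    proof (rule sums_integral[OF int])
      show "AE s in lborel. summable (\<lambda>m. norm (?f m s))"
        by (rule AE_I2, rule summable_comparison_test', rule summable_mult, rule summable_mult, rule sm[of t])
           (use bd in simp)
      show "summable (\<lambda>m. \<integral>s. norm (?f m s) \<partial>lborel)"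
      proof (rule summable_comparison_test')
        show "summable (\<lambda>m. t * (B * \<bar>?b m * (t ^ m / fact m)\<bar>))"
          by (intro summable_mult sm)
        fix m :: nat
        have "(\<integral>s. norm (?f m s) \<partial>lborel) \<le> (\<integral>s. indicator {0..t} s * (B * \<bar>?b m * (t ^ m / fact m)\<bar>) \<partial>lborel)"
          by (intro integral_mono int integrable_norm bd integrable_mult_left integrable_real_indicator)
             (auto simp: emeasure_lborel_Icc_eq)
        also have "\<dots> = t * (B * \<bar>?b m * (t ^ m / fact m)\<bar>)" using t by simp
        finally show "norm (\<integral>s. norm (?f m s) \<partial>lborel) \<le> t * (B * \<bar>?b m * (t ^ m / fact m)\<bar>)"
          by simp
      qed
    qed
    also have "(\<integral>s. (\<Sum>m. ?f m s) \<partial>lborel) = vconv ?P (res_series \<beta> \<gamma>) t"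
      unfolding vconv_def set_lebesgue_integral_def
      by (rule Bochner_Integration.integral_cong)
         (auto simp: res_series_def suminf_mult[OF sm'] indicator_def simp del: times_divide_eq_right)
    finally have s1: "(\<lambda>m. \<Sum>k\<le>n. \<gamma> k * (?b m * (t ^ (k + m + 1) / fact (k + m + 1)))) sums vconv ?P (res_series \<beta> \<gamma>) t"
      unfolding val .
    \<comment> \<open>The series for fixed k, moved so that its m-th term sits at position M = k + m
      + 1; the positions M <= k are filled with zeros.\<close>
    let ?h = "\<lambda>k M. if k < M then \<gamma> k * (?b (M - Suc k) * (t ^ M / fact M)) else 0"
    have sk: "summable (\<lambda>m. \<gamma> k * (?b m * (t ^ (k + m + 1) / fact (k + m + 1))))" for k
    proof (rule summable_comparison_test', rule summable_mult, rule summable_mult, rule sm[of t])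
      fix m :: nat
      have "t ^ (k + m + 1) / fact (k + m + 1) \<le> t ^ (k+1) * (t ^ m / fact m)"
      proof -
        have "t ^ (k + m + 1) / fact (k + m + 1) \<le> t ^ (k + m + 1) / fact m"
          using t by (intro divide_left_mono fact_mono) auto
        then show ?thesis by (simp add: power_add mult_ac)
      qed
      then have "\<bar>\<gamma> k\<bar> * (\<bar>?b m\<bar> * (t ^ (k + m + 1) / fact (k + m + 1))) \<le> \<bar>\<gamma> k\<bar> * (\<bar>?b m\<bar> * (t ^ (k+1) * (t ^ m / fact m)))"
        by (intro mult_left_mono) auto
      then show "norm (\<gamma> k * (?b m * (t ^ (k + m + 1) / fact (k + m + 1)))) \<le> \<bar>\<gamma> k\<bar> * (t ^ (k+1) * \<bar>?b m * (t ^ m / fact m)\<bar>)"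
        using t by (simp add: abs_mult mult_ac)
    qed
    have hk: "?h k sums (\<Sum>m. \<gamma> k * (?b m * (t ^ (k + m + 1) / fact (k + m + 1))))" for k
    proof -
      have "(\<lambda>M. ?h k (M + Suc k)) = (\<lambda>m. \<gamma> k * (?b m * (t ^ (k + m + 1) / fact (k + m + 1))))"
        by (auto simp: fun_eq_iff add_ac)
      then have "(\<lambda>M. ?h k (M + Suc k)) sums (\<Sum>m. \<gamma> k * (?b m * (t ^ (k + m + 1) / fact (k + m + 1))))"
        using summable_sums[OF sk[of k]] by simp
      then show ?thesis by (subst (asm) sums_iff_shift) simp
    qed
    have "(\<lambda>M. \<Sum>k\<le>n. ?h k M) sums (\<Sum>k\<le>n. \<Sum>m. \<gamma> k * (?b m * (t ^ (k + m + 1) / fact (k + m + 1))))"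
      by (rule sums_sum[OF hk])
    also have "(\<Sum>k\<le>n. \<Sum>m. \<gamma> k * (?b m * (t ^ (k + m + 1) / fact (k + m + 1)))) = vconv ?P (res_series \<beta> \<gamma>) t"
      using s1 by (subst suminf_sum[OF sk, symmetric]) (rule sums_unique[symmetric])
    also have "(\<lambda>M. \<Sum>k\<le>n. ?h k M) = (\<lambda>M. (\<Sum>i<M. ?b i * \<gamma> (M - 1 - i)) * (t ^ M / fact M))"
    proof
      fix M
      have "(\<Sum>k\<le>n. ?h k M) = (\<Sum>k\<in>{k. k \<le> n \<and> k < M}. \<gamma> k * (?b (M - Suc k) * (t ^ M / fact M)))"
        by (rule sum.mono_neutral_cong_right) auto
      \<comment> \<open>Indices above n may be added because \<gamma> vanishes there. This removes n
        from the range, and reversing the order then gives the sum of the recursion.\<close>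
      also have "\<dots> = (\<Sum>k<M. \<gamma> k * (?b (M - Suc k) * (t ^ M / fact M)))"
        by (rule sum.mono_neutral_left) (auto, metis z not_le)
      also have "\<dots> = (\<Sum>i<M. \<gamma> (M - Suc i) * (?b i * (t ^ M / fact M)))"
        by (subst sum.nat_diff_reindex[symmetric]) (auto intro!: sum.cong simp: Suc_diff_Suc)
      also have "\<dots> = (\<Sum>i<M. ?b i * \<gamma> (M - 1 - i)) * (t ^ M / fact M)"
        unfolding sum_distrib_right by (rule sum.cong) simp_all
      finally show "(\<Sum>k\<le>n. ?h k M) = (\<Sum>i<M. ?b i * \<gamma> (M - 1 - i)) * (t ^ M / fact M)" .
    qed
    finally have s2: "(\<lambda>M. (\<Sum>i<M. ?b i * \<gamma> (M - 1 - i)) * (t ^ M / fact M)) sums vconv ?P (res_series \<beta> \<gamma>) t" .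
    have s3: "(\<lambda>M. \<gamma> M * (t ^ M / fact M)) sums ?P t"
      by (rule sums_finite) (use z in auto)
    have "(\<lambda>M. \<gamma> M * (t ^ M / fact M) - \<beta> * ((\<Sum>i<M. ?b i * \<gamma> (M - 1 - i)) * (t ^ M / fact M)))
       sums (?P t - \<beta> * vconv ?P (res_series \<beta> \<gamma>) t)"
      by (intro sums_diff sums_mult s2 s3)
    also have "(\<lambda>M. \<gamma> M * (t ^ M / fact M) - \<beta> * ((\<Sum>i<M. ?b i * \<gamma> (M - 1 - i)) * (t ^ M / fact M)))
       = (\<lambda>M. ?b M * (t ^ M / fact M))"
    proof
      fix M
      show "\<gamma> M * (t ^ M / fact M) - \<beta> * ((\<Sum>i<M. ?b i * \<gamma> (M - 1 - i)) * (t ^ M / fact M)) = ?b M * (t ^ M / fact M)"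
        unfolding res_coeff.simps[of \<beta> \<gamma> M] by (simp only: left_diff_distrib mult.assoc)
    qed
    finally show ?thesis unfolding res_series_def by (rule sums_unique[symmetric])
  qed
  with cr cP show ?thesis by (auto simp: resolvent_on_def)
qed

section \<open>Bernstein approximation\<close>

lemma grid_point_mem:
  fixes T :: real
  assumes "0 \<le> T" "1 \<le> n" "k \<le> n"
  shows "T * real k / real n \<in> {0..T}"
proof -
  have "real k / real n \<le> 1" using assms by simp
  then have "T * (real k / real n) \<le> T" using assms(1) by (intro mult_left_le)
  then show ?thesis using assms by simp
qed

text \<open>Rescaling to the unit interval makes the moment identities of the basis polynomials
  \<open>Bernstein\<close> available.\<close>

lemma bernstein_eq_Bernstein:
  assumes "0 < T"
  shows "bernstein T K n t = (\<Sum>k\<le>n. K (T * real k / real n) * Bernstein n k (t / T))"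
proof -
  have *: "1 / T ^ n * (real (n choose k) * t ^ k * (T - t) ^ (n - k)) = Bernstein n k (t / T)" if "k \<le> n" for k
  proof -
    have "T ^ n = T ^ k * T ^ (n - k)" using that by (simp flip: power_add)
    moreover have "1 - t / T = (T - t) / T" using assms by (simp add: field_simps)
    ultimately show ?thesis by (simp add: Bernstein_def power_divide)
  qed
  show ?thesis
    unfolding bernstein_def sum_distrib_left
  proof (intro sum.cong refl)
    fix k assume "k \<in> {..n}"
    have "1 / T ^ n * (K (T * real k / real n) * real (n choose k) * t ^ k * (T - t) ^ (n - k)) =
      K (T * real k / real n) * (1 / T ^ n * (real (n choose k) * t ^ k * (T - t) ^ (n - k)))"
      by (simp only: mult_ac)
    also have "\<dots> = K (T * real k / real n) * Bernstein n k (t / T)"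
      by (subst *) (use \<open>k \<in> {..n}\<close> in auto)
    finally show "1 / T ^ n * (K (T * real k / real n) * real (n choose k) * t ^ k * (T - t) ^ (n - k)) =
      K (T * real k / real n) * Bernstein n k (t / T)" .
  qed
qed

text \<open>The variance of a binomial proportion: the square is expanded into k (k - 1), k and 1,
  whose weighted sums are known.\<close>

lemma Bernstein_variance:
  assumes "1 \<le> n"
  shows "(\<Sum>k\<le>n. (real k / real n - x)\<^sup>2 * Bernstein n k x) = x * (1 - x) / real n"
proof -
  have "(\<Sum>k\<le>n. (real k / real n - x)\<^sup>2 * Bernstein n k x) =
     (\<Sum>k\<le>n. 1 / (real n)\<^sup>2 * (real k * (real k - 1) * Bernstein n k x)
        + (1 / (real n)\<^sup>2 - 2 * x / real n) * (real k * Bernstein n k x) + x\<^sup>2 * Bernstein n k x)"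
    by (rule sum.cong) (use assms in \<open>auto simp: power2_eq_square field_simps\<close>)
  also have "\<dots> = 1 / (real n)\<^sup>2 * (real n * (real n - 1) * x\<^sup>2) + (1 / (real n)\<^sup>2 - 2 * x / real n) * (real n * x) + x\<^sup>2"
    by (simp only: sum.distrib sum_distrib_left[symmetric] sum_k_Bernstein sum_kk_Bernstein sum_Bernstein mult_1_right)
  also have "\<dots> = x * (1 - x) / real n"
    using assms by (simp add: power2_eq_square field_simps)
  finally show ?thesis .
qed

text \<open>Up to size d the power is monotone; beyond it, |x| / d exceeds one and its h-th power is
  below its square. This trades the Hoelder modulus for a quadratic one that the variance
  controls.\<close>

lemma abs_powr_le:
  fixes x d :: real
  assumes "0 < d" "0 < h" "h < 1"
  shows "\<bar>x\<bar> powr h \<le> d powr h * (1 + x\<^sup>2 / d\<^sup>2)"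
proof (cases "\<bar>x\<bar> \<le> d")
  case True
  then have "\<bar>x\<bar> powr h \<le> d powr h" using assms by (intro powr_mono2) auto
  also have "\<dots> \<le> d powr h * (1 + x\<^sup>2 / d\<^sup>2)" using mult_left_mono[of 1 "1 + x\<^sup>2 / d\<^sup>2" "d powr h"] by simp
  finally show ?thesis .
next
  case False
  have "\<bar>x\<bar> powr h = d powr h * (\<bar>x\<bar> / d) powr h" using assms by (simp flip: powr_mult)
  also have "\<dots> \<le> d powr h * (\<bar>x\<bar> / d) powr 2"
    using False assms by (intro mult_left_mono powr_mono) auto
  also have "\<dots> = d powr h * (x\<^sup>2 / d\<^sup>2)"
    using False assms by (simp add: powr_numeral power_divide)
  also have "\<dots> \<le> d powr h * (1 + x\<^sup>2 / d\<^sup>2)" by (intro mult_left_mono) auto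
  finally show ?thesis .
qed

text \<open>With d = n^(-1/2), averaging the quadratic modulus over the Bernstein weights leaves d^h
  times a constant, because the variance is at most of order d^2. The T^2 in the constant comes from
  the rescaling t = T x.\<close>

lemma bernstein_holder_rate:
  assumes T: "0 < T" and h: "0 < h" "h < 1" and K: "holder_on h {0..T} K"
  obtains C where "0 < C"
    "\<And>n t. 1 \<le> n \<Longrightarrow> t \<in> {0..T} \<Longrightarrow> \<bar>bernstein T K n t - K t\<bar> \<le> C * real n powr (- h / 2)"
proof -
  obtain L0 where L0: "\<And>s t. s \<in> {0..T} \<Longrightarrow> t \<in> {0..T} \<Longrightarrow> \<bar>K s - K t\<bar> \<le> L0 * \<bar>s - t\<bar> powr h"
    using K unfolding holder_on_def by blast
  \<comment> \<open>The constant in \<open>holder_on\<close> may be negative or zero; a positive one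
    is needed to preserve inequalities.\<close>
  define L where "L = \<bar>L0\<bar> + 1"
  have L: "0 < L" by (simp add: L_def)
  have hol: "\<bar>K s - K t\<bar> \<le> L * \<bar>s - t\<bar> powr h" if "s \<in> {0..T}" "t \<in> {0..T}" for s t
  proof -
    have "L0 * \<bar>s - t\<bar> powr h \<le> L * \<bar>s - t\<bar> powr h"
      by (intro mult_right_mono) (auto simp: L_def)
    then show ?thesis using L0[OF that] by linarith
  qed
  show thesis
  proof (rule that[of "L * (1 + T\<^sup>2)"])
    show "0 < L * (1 + T\<^sup>2)" using L by (intro mult_pos_pos add_pos_nonneg) auto
    fix n :: nat and t assume n: "1 \<le> n" and t: "t \<in> {0..T}"
    define x where "x = t / T"
    have x: "0 \<le> x" "x \<le> 1" "t = T * x" using t T by (auto simp: x_def)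
    \<comment> \<open>The order of the standard deviation of the Bernstein weights, so that the
      quadratic term becomes bounded.\<close>
    define d where "d = real n powr (- 1 / 2)"
    have d: "0 < d" using n by (simp add: d_def)
    have d2: "d\<^sup>2 = 1 / real n"
      using n by (simp add: d_def powr_minus_divide power_divide powr_half_sqrt)
    have dh: "d powr h = real n powr (- h / 2)" by (simp add: d_def powr_powr)
    have "bernstein T K n t - K t = (\<Sum>k\<le>n. (K (T * real k / real n) - K t) * Bernstein n k x)"
      unfolding bernstein_eq_Bernstein[OF T] x_def[symmetric]
      by (simp add: left_diff_distrib sum_subtractf flip: sum_distrib_left)
    also have "\<bar>\<dots>\<bar> \<le> (\<Sum>k\<le>n. L * (d powr h * (1 + T\<^sup>2 * real n * (real k / real n - x)\<^sup>2)) * Bernstein n k x)"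
    proof (rule order_trans[OF sum_abs], rule sum_mono)
      fix k assume k: "k \<in> {..n}"
      have kT: "T * real k / real n \<in> {0..T}" using k n T by (intro grid_point_mem) auto
      have "\<bar>K (T * real k / real n) - K t\<bar> \<le> L * \<bar>T * real k / real n - t\<bar> powr h"
        by (rule hol[OF kT t])
      also have "\<dots> \<le> L * (d powr h * (1 + (T * real k / real n - t)\<^sup>2 / d\<^sup>2))"
        using L by (intro mult_left_mono abs_powr_le d h) auto
      also have "(T * real k / real n - t)\<^sup>2 / d\<^sup>2 = T\<^sup>2 * real n * (real k / real n - x)\<^sup>2"
      proof -
        have "T * real k / real n - t = T * (real k / real n - x)" using x(3) by (simp add: right_diff_distrib)
        then show ?thesis by (simp add: d2 power_mult_distrib)
      qed
      finally show "\<bar>(K (T * real k / real n) - K t) * Bernstein n k x\<bar>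
           \<le> L * (d powr h * (1 + T\<^sup>2 * real n * (real k / real n - x)\<^sup>2)) * Bernstein n k x"
        using Bernstein_nonneg[OF x(1,2), of n k] by (simp add: abs_mult mult_right_mono)
    qed
    also have "\<dots> = L * d powr h * ((\<Sum>k\<le>n. Bernstein n k x) + T\<^sup>2 * real n * (\<Sum>k\<le>n. (real k / real n - x)\<^sup>2 * Bernstein n k x))"
      unfolding sum_distrib_left sum.distrib[symmetric]
      by (rule sum.cong) (auto simp: algebra_simps)
    also have "\<dots> = L * d powr h * (1 + T\<^sup>2 * (x * (1 - x)))"
      using n by (simp add: Bernstein_variance[OF n])
    also have "\<dots> \<le> L * d powr h * (1 + T\<^sup>2 * 1)"
      using L x by (intro mult_left_mono add_left_mono) (auto intro!: mult_le_one)
    finally show "\<bar>bernstein T K n t - K t\<bar> \<le> L * (1 + T\<^sup>2) * real n powr (- h / 2)"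
      by (simp add: dh mult_ac)
  qed
qed

text \<open>A weighted average of values of K, with nonnegative weights of sum one. The stability
  constant is therefore the same for all degrees.\<close>

lemma bernstein_bound:
  assumes T: "0 < T" and n: "1 \<le> n" and K: "\<And>x. x \<in> {0..T} \<Longrightarrow> \<bar>K x\<bar> \<le> B" and t: "t \<in> {0..T}"
  shows "\<bar>bernstein T K n t\<bar> \<le> B"
proof -
  have x: "0 \<le> t / T" "t / T \<le> 1" using t T by auto
  have "\<bar>bernstein T K n t\<bar> \<le> (\<Sum>k\<le>n. B * Bernstein n k (t / T))"
    unfolding bernstein_eq_Bernstein[OF T]
  proof (rule order_trans[OF sum_abs], rule sum_mono)
    fix k assume k: "k \<in> {..n}"
    have "T * real k / real n \<in> {0..T}" using k n T by (intro grid_point_mem) auto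
    from K[OF this] show "\<bar>K (T * real k / real n) * Bernstein n k (t / T)\<bar> \<le> B * Bernstein n k (t / T)"
      using Bernstein_nonneg[OF x, of n k] by (simp add: abs_mult mult_right_mono)
  qed
  then show ?thesis by (simp flip: sum_distrib_left)
qed

text \<open>The binomial theorem for (T - t)^(n - i), followed by exchanging the sums over the
  triangle i <= k <= n.\<close>

lemma bernstein_eq_kappa:
  assumes T: "0 < T"
  shows "bernstein T K n t = (\<Sum>k\<le>n. kappa T K n k * t ^ k)"
proof -
  let ?c = "\<lambda>i k. (-1) ^ (k - i) * K (real i * T / real n) * real (n choose i) * real ((n - i) choose (k - i))"
  have *: "t ^ i * (T - t) ^ (n - i) = (\<Sum>k\<in>{i..n}. T ^ (n - k) * ((-1) ^ (k - i) * real ((n - i) choose (k - i))) * t ^ k)"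
    if "i \<le> n" for i
  proof -
    have "(T - t) ^ (n - i) = (- t + T) ^ (n - i)" by simp
    also have "\<dots> = (\<Sum>j\<le>n - i. real ((n - i) choose j) * (- t) ^ j * T ^ (n - i - j))"
      by (rule binomial_ring)
    finally have "t ^ i * (T - t) ^ (n - i) = (\<Sum>j\<le>n - i. T ^ (n - (j + i)) * ((-1) ^ j * real ((n - i) choose j)) * t ^ (j + i))"
      by (simp add: sum_distrib_left power_add power_minus[of t] mult_ac add.commute)
    also have "\<dots> = (\<Sum>k\<in>{0 + i..(n - i) + i}. T ^ (n - k) * ((-1) ^ (k - i) * real ((n - i) choose (k - i))) * t ^ k)"
      unfolding sum.shift_bounds_cl_nat_ivl by (simp add: atLeast0AtMost)
    finally show ?thesis using that by simp
  qed
  have Tk: "1 / T ^ n * T ^ (n - k) = 1 / T ^ k" if "k \<le> n" for k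
    using that T by (simp add: power_diff)
  have "bernstein T K n t = (\<Sum>i\<le>n. \<Sum>k\<in>{i..n}. 1 / T ^ k * ?c i k * t ^ k)"
    unfolding bernstein_def sum_distrib_left
  proof (rule sum.cong)
    fix i assume "i \<in> {..n}"
    then have i: "i \<le> n" by simp
    have "1 / T ^ n * (K (T * real i / real n) * real (n choose i) * t ^ i * (T - t) ^ (n - i))
       = 1 / T ^ n * K (real i * T / real n) * real (n choose i) * (t ^ i * (T - t) ^ (n - i))"
      by (simp add: mult_ac)
    also have "\<dots> = (\<Sum>k\<in>{i..n}. (1 / T ^ n * T ^ (n - k)) * ?c i k * t ^ k)"
      unfolding *[OF i] sum_distrib_left by (rule sum.cong) (simp_all add: mult_ac)
    also have "\<dots> = (\<Sum>k\<in>{i..n}. 1 / T ^ k * ?c i k * t ^ k)"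
      by (rule sum.cong) (use Tk in simp_all)
    finally show "1 / T ^ n * (K (T * real i / real n) * real (n choose i) * t ^ i * (T - t) ^ (n - i))
        = (\<Sum>k\<in>{i..n}. 1 / T ^ k * ?c i k * t ^ k)" .
  qed simp
  also have "\<dots> = (\<Sum>i\<le>n. \<Sum>k\<le>n. if i \<le> k then 1 / T ^ k * ?c i k * t ^ k else 0)"
    by (intro sum.cong refl sum.mono_neutral_cong_left) auto
  also have "\<dots> = (\<Sum>k\<le>n. \<Sum>i\<le>n. if i \<le> k then 1 / T ^ k * ?c i k * t ^ k else 0)"
    by (rule sum.swap)
  also have "\<dots> = (\<Sum>k\<le>n. \<Sum>i\<le>k. 1 / T ^ k * ?c i k * t ^ k)"
    by (intro sum.cong refl sum.mono_neutral_cong_right) auto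
  also have "\<dots> = (\<Sum>k\<le>n. kappa T K n k * t ^ k)"
    by (simp add: kappa_def sum_distrib_left sum_distrib_right)
  finally show ?thesis .
qed

lemma continuous_on_holder:
  assumes h: "0 < h" and K: "holder_on h {0..T} K"
  shows "continuous_on {0..T} K"
proof -
  obtain L0 where L0: "\<And>s t. s \<in> {0..T} \<Longrightarrow> t \<in> {0..T} \<Longrightarrow> \<bar>K s - K t\<bar> \<le> L0 * \<bar>s - t\<bar> powr h"
    using K unfolding holder_on_def by blast
  show ?thesis
    unfolding continuous_on_def
  proof
    fix t assume t: "t \<in> {0..T}"
    have "((\<lambda>s. L0 * \<bar>s - t\<bar> powr h) \<longlongrightarrow> L0 * \<bar>t - t\<bar> powr h) (at t within {0..T})"
      using h by (intro tendsto_intros tendsto_powr') (auto intro!: eventuallyI tendsto_eq_intros)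
    then have "((\<lambda>s. L0 * \<bar>s - t\<bar> powr h) \<longlongrightarrow> 0) (at t within {0..T})" by simp
    then have "((\<lambda>s. K s - K t) \<longlongrightarrow> 0) (at t within {0..T})"
      by (rule Lim_null_comparison[rotated]) (use L0 t in \<open>auto simp: eventually_at_filter\<close>)
    then show "(K \<longlongrightarrow> K t) (at t within {0..T})"
      by (rule LIM_zero_cancel)
  qed
qed

section \<open>Resolvents of the Bernstein kernels and their convergence rate\<close>

text \<open>Coefficients of the Bernstein polynomial in the basis t^k / k!. The same numbers are the
  weights of \<open>g_fun\<close> on its unit intervals, and this is the link between kernel and
  operator.\<close>

definition taylor_coeff :: "real \<Rightarrow> (real \<Rightarrow> real) \<Rightarrow> nat \<Rightarrow> nat \<Rightarrow> real" where
  "taylor_coeff T K n k = (if k \<le> n then fact k * kappa T K n k else 0)"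

lemma resolvent_on_bernstein:
  assumes T: "0 < T" and b: "0 < \<beta>"
  shows "resolvent_on T \<beta> (bernstein T K n) (res_series \<beta> (taylor_coeff T K n))"
proof -
  have "bernstein T K n = (\<lambda>t. \<Sum>k\<le>n. taylor_coeff T K n k * (t ^ k / fact k))"
    by (auto simp: bernstein_eq_kappa[OF T] taylor_coeff_def fun_eq_iff intro!: sum.cong)
  then show ?thesis
    using resolvent_on_res_series[of \<beta> T n "taylor_coeff T K n"] T b by (simp add: taylor_coeff_def)
qed

text \<open>The stability estimate is used twice: through \<open>resolvent_on_limit\<close> to
  produce the resolvent of K, and directly to compare it with those of the Bernstein
  polynomials.\<close>

lemma resolvent_bernstein_rate:
  assumes T: "0 < T" and b: "0 < \<beta>" and h: "0 < h" "h < 1" and K: "holder_on h {0..T} K"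
  obtains r C where "resolvent_on T \<beta> K r" "0 < C"
    "\<And>n t. 1 \<le> n \<Longrightarrow> t \<in> {0..T} \<Longrightarrow> \<bar>res_series \<beta> (taylor_coeff T K n) t - r t\<bar> \<le> C * real n powr (- h / 2)"
proof -
  obtain C where C: "0 < C"
    "\<And>n t. 1 \<le> n \<Longrightarrow> t \<in> {0..T} \<Longrightarrow> \<bar>bernstein T K n t - K t\<bar> \<le> C * real n powr (- h / 2)"
    using bernstein_holder_rate[OF T h K] by blast
  have cK: "continuous_on {0..T} K" by (rule continuous_on_holder[OF h(1) K])
  obtain B where B: "0 < B" "\<And>x. x \<in> {0..T} \<Longrightarrow> \<bar>K x\<bar> \<le> B"
    using continuous_on_Icc_bounded[OF cK] by blast
  have T0: "0 \<le> T" using T by simp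
  have lim0: "(\<lambda>n. C * real (Suc n) powr (- h / 2)) \<longlonglongrightarrow> 0"
  proof -
    have "(\<lambda>n. real n powr (- h / 2)) \<longlonglongrightarrow> 0"
      using h by (intro tendsto_neg_powr filterlim_real_sequentially) auto
    then have "(\<lambda>n. real (Suc n) powr (- h / 2)) \<longlonglongrightarrow> 0"
      by (rule LIMSEQ_Suc)
    then show ?thesis by (rule tendsto_mult_right_zero)
  qed
  \<comment> \<open>The sequence starts at degree one, since the bounds for \<open>bernstein\<close>
    are available from there on.\<close>
  have lim: "uniform_limit {0..T} (\<lambda>n. bernstein T K (Suc n)) K sequentially"
  proof (rule uniform_limitI)
    fix e :: real assume "0 < e"
    then have "\<forall>\<^sub>F n in sequentially. C * real (Suc n) powr (- h / 2) < e"
      using order_tendstoD(2)[OF lim0] by blast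
    then show "\<forall>\<^sub>F n in sequentially. \<forall>x\<in>{0..T}. dist (bernstein T K (Suc n) x) (K x) < e"
    proof eventually_elim
      case (elim n)
      show ?case
      proof
        fix x assume "x \<in> {0..T}"
        from C(2)[of "Suc n", OF _ this] elim show "dist (bernstein T K (Suc n) x) (K x) < e"
          by (simp add: dist_real_def)
      qed
    qed
  qed
  have bb: "\<bar>bernstein T K (Suc n) x\<bar> \<le> B" if "x \<in> {0..T}" for n x
    by (rule bernstein_bound[OF T _ B(2) that]) auto
  obtain r where r: "resolvent_on T \<beta> K r"
    by (rule resolvent_on_limit[OF T0 b B(1) resolvent_on_bernstein[OF T b] cK bb lim])
  show thesis
  proof (rule that[OF r])
    show "0 < stab_const T \<beta> B * C" using stab_const_pos[OF T0 b B(1)] C by simp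
    fix n :: nat and t assume n: "1 \<le> n" and t: "t \<in> {0..T}"
    show "\<bar>res_series \<beta> (taylor_coeff T K n) t - r t\<bar> \<le> stab_const T \<beta> B * C * real n powr (- h / 2)"
      unfolding mult.assoc
      by (rule resolvent_on_stability[OF T0 b B(1) _ resolvent_on_bernstein[OF T b] r bernstein_bound[OF T n B(2)] B(2) C(2)[OF n] t])
         (use C in auto)
  qed
qed

section \<open>Square-integrable limits\<close>

text \<open>Completeness of \<open>L\<^sup>2\<close> with an explicit rate: by Cauchy-Schwarz with weights \<open>c\<close>,
  \<open>(\<Sum>k. |d k|)\<^sup>2 \<le> (\<Sum>k. c k) * (\<Sum>k. (d k)\<^sup>2 / c k)\<close>.\<close>

lemma weighted_sum_square_le:
  fixes c d :: "nat \<Rightarrow> real"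
  assumes "\<And>k. 0 < c k"
  shows "(\<Sum>k\<in>A. \<bar>d k\<bar>)\<^sup>2 \<le> (\<Sum>k\<in>A. c k) * (\<Sum>k\<in>A. (d k)\<^sup>2 / c k)"
proof -
  have "(\<Sum>k\<in>A. \<bar>d k\<bar>)\<^sup>2 = (\<Sum>k\<in>A. sqrt (c k) * (\<bar>d k\<bar> / sqrt (c k)))\<^sup>2"
    using assms by (simp add: less_imp_neq[symmetric])
  also have "\<dots> \<le> (\<Sum>k\<in>A. (sqrt (c k))\<^sup>2) * (\<Sum>k\<in>A. (\<bar>d k\<bar> / sqrt (c k))\<^sup>2)"
    by (rule Cauchy_Schwarz_ineq_sum)
  also have "\<dots> = (\<Sum>k\<in>A. c k) * (\<Sum>k\<in>A. (d k)\<^sup>2 / c k)"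
    using assms by (simp add: power_divide less_imp_le)
  finally show ?thesis .
qed

text \<open>The limit is the explicit pointwise \<open>lim\<close>, not an existential witness, so
  it inherits measurability in further parameters; the joint measurability of the Wiener integral
  rests on this. Where the sequence diverges \<open>lim\<close> is unspecified, but that happens
  only on a null set.\<close>

lemma L2_telescope_convergence:
  fixes f :: "nat \<Rightarrow> 'a \<Rightarrow> real" and c :: "nat \<Rightarrow> real"
  assumes f[measurable]: "\<And>k. f k \<in> borel_measurable M"
    and c0: "\<And>k. 0 < c k" and c: "summable c"
    and le: "\<And>k. (\<integral>\<^sup>+x. ennreal ((f (Suc k) x - f k x)\<^sup>2) \<partial>M) \<le> ennreal ((c k)\<^sup>2)"
  shows "(\<integral>\<^sup>+x. ennreal ((lim (\<lambda>k. f k x) - f N x)\<^sup>2) \<partial>M) \<le> ennreal ((\<Sum>k. c (k + N))\<^sup>2)"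
proof -
  define d where "d k x = f (Suc k) x - f k x" for k x
  have dm[measurable]: "d k \<in> borel_measurable M" for k unfolding d_def by measurable
  define C where "C N = (\<Sum>k. c (k + N))" for N
  have sc: "summable (\<lambda>k. c (k + N))" for N using c by (simp add: summable_iff_shift)
  have C0: "0 \<le> C N" for N unfolding C_def using c0 by (intro suminf_nonneg sc less_imp_le)
  \<comment> \<open>The second Cauchy-Schwarz factor. Its integral is at most the sum of the c k,
    because each squared increment integrates to at most the square of c k.\<close>
  define E where "E N x = (\<Sum>k. ennreal ((d (k + N) x)\<^sup>2 / c (k + N)))" for N x
  have Em[measurable]: "E N \<in> borel_measurable M" for N unfolding E_def by measurable
  have En: "(\<integral>\<^sup>+x. E N x \<partial>M) \<le> ennreal (C N)" for N
  proof -
    have "(\<integral>\<^sup>+x. E N x \<partial>M) = (\<Sum>k. \<integral>\<^sup>+x. ennreal ((d (k + N) x)\<^sup>2 / c (k + N)) \<partial>M)"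
      unfolding E_def by (rule nn_integral_suminf) measurable
    also have "\<dots> \<le> (\<Sum>k. ennreal (c (k + N)))"
    proof (intro suminf_le allI)
      fix k
      have "(\<integral>\<^sup>+x. ennreal ((d (k + N) x)\<^sup>2 / c (k + N)) \<partial>M) = (\<integral>\<^sup>+x. ennreal (1 / c (k + N)) * ennreal ((d (k + N) x)\<^sup>2) \<partial>M)"
        using c0 by (intro nn_integral_cong) (simp add: less_imp_le flip: ennreal_mult)
      also have "\<dots> = ennreal (1 / c (k + N)) * (\<integral>\<^sup>+x. ennreal ((d (k + N) x)\<^sup>2) \<partial>M)"
        by (rule nn_integral_cmult) measurable
      also have "\<dots> \<le> ennreal (1 / c (k + N)) * ennreal ((c (k + N))\<^sup>2)"
        using le unfolding d_def by (intro mult_left_mono) auto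
      also have "\<dots> = ennreal (c (k + N))"
        using c0[of "k + N"] by (simp add: power2_eq_square flip: ennreal_mult)
      finally show "(\<integral>\<^sup>+x. ennreal ((d (k + N) x)\<^sup>2 / c (k + N)) \<partial>M) \<le> ennreal (c (k + N))" .
    qed auto
    also have "\<dots> = ennreal (C N)"
      unfolding C_def using c0 by (intro suminf_ennreal2 sc) (auto intro: less_imp_le)
    finally show ?thesis .
  qed
  have fin: "AE x in M. E 0 x \<noteq> \<infinity>"
    by (rule nn_integral_PInf_AE) (use En[of 0] in \<open>auto simp: top_unique\<close>)
  have "(\<integral>\<^sup>+x. ennreal ((lim (\<lambda>k. f k x) - f N x)\<^sup>2) \<partial>M) \<le> (\<integral>\<^sup>+x. ennreal (C N) * E N x \<partial>M)"
  proof (rule nn_integral_mono_AE, use fin in eventually_elim)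
    fix x assume "E 0 x \<noteq> \<infinity>"
    have s0: "summable (\<lambda>k. (d k x)\<^sup>2 / c k)"
      using \<open>E 0 x \<noteq> \<infinity>\<close> unfolding E_def
      by (intro summable_suminf_not_top) (use c0 in \<open>auto simp: less_imp_le\<close>)
    then have sN: "summable (\<lambda>k. (d (k + N) x)\<^sup>2 / c (k + N))" for N
      using summable_iff_shift[of "\<lambda>k. (d k x)\<^sup>2 / c k" N] by simp
    define D where "D = (\<Sum>k. (d (k + N) x)\<^sup>2 / c (k + N))"
    have D0: "0 \<le> D" unfolding D_def using c0 by (intro suminf_nonneg sN) (auto simp: less_imp_le)
    have ED: "E N x = ennreal D" unfolding E_def D_def
      using c0 by (intro suminf_ennreal2 sN) (auto simp: less_imp_le)
    have part: "(\<Sum>k<n. \<bar>d (k + N) x\<bar>)\<^sup>2 \<le> C N * D" for n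
    proof -
      have "(\<Sum>k<n. \<bar>d (k + N) x\<bar>)\<^sup>2 \<le> (\<Sum>k<n. c (k + N)) * (\<Sum>k<n. (d (k + N) x)\<^sup>2 / c (k + N))"
        using c0 by (rule weighted_sum_square_le)
      also have "\<dots> \<le> C N * D"
        unfolding C_def D_def using c0
        by (intro mult_mono sum_le_suminf sc sN suminf_nonneg sum_nonneg) (auto simp: less_imp_le)
      finally show ?thesis .
    qed
    have "summable (\<lambda>k. \<bar>d (k + N) x\<bar>)"
    proof (rule summableI_nonneg_bounded)
      show "(\<Sum>k<n. \<bar>d (k + N) x\<bar>) \<le> sqrt (C N * D)" for n
        using part[of n] by (rule real_le_rsqrt)
    qed auto
    then have "summable (\<lambda>k. d (k + N) x)" by (rule summable_rabs_cancel)
    moreover have tele: "(\<Sum>k<n. d (k + N) x) = f (n + N) x - f N x" for n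
      by (induction n) (auto simp: d_def)
    ultimately have "convergent (\<lambda>n. f (n + N) x - f N x)"
      by (simp add: summable_iff_convergent)
    then have "convergent (\<lambda>n. f (n + N) x - f N x + f N x)"
      by (intro convergent_add convergent_const)
    then have "convergent (\<lambda>n. f (n + N) x)" by simp
    then have "convergent (\<lambda>n. f n x)" by (rule convergent_ignore_initial_segment[THEN iffD1])
    then have "(\<lambda>n. f n x) \<longlonglongrightarrow> lim (\<lambda>k. f k x)" by (simp add: convergent_LIMSEQ_iff)
    then have "(\<lambda>n. f (n + N) x) \<longlonglongrightarrow> lim (\<lambda>k. f k x)" by (rule LIMSEQ_ignore_initial_segment)
    then have "(\<lambda>n. (f (n + N) x - f N x)\<^sup>2) \<longlonglongrightarrow> (lim (\<lambda>k. f k x) - f N x)\<^sup>2"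
      by (intro tendsto_intros)
    moreover have "(f (n + N) x - f N x)\<^sup>2 \<le> C N * D" for n
    proof -
      have "(f (n + N) x - f N x)\<^sup>2 \<le> (\<Sum>k<n. \<bar>d (k + N) x\<bar>)\<^sup>2"
        unfolding tele[symmetric] by (rule abs_le_square_iff[THEN iffD1]) (simp add: sum_nonneg)
      with part[of n] show ?thesis by linarith
    qed
    ultimately have "(lim (\<lambda>k. f k x) - f N x)\<^sup>2 \<le> C N * D"
      by (intro LIMSEQ_le_const2) auto
    then show "ennreal ((lim (\<lambda>k. f k x) - f N x)\<^sup>2) \<le> ennreal (C N) * E N x"
      unfolding ED by (simp add: C0 D0 flip: ennreal_mult)
  qed
  also have "\<dots> = ennreal (C N) * (\<integral>\<^sup>+x. E N x \<partial>M)" by (rule nn_integral_cmult) measurable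
  also have "\<dots> \<le> ennreal (C N) * ennreal (C N)" by (intro mult_left_mono En) auto
  also have "\<dots> = ennreal ((C N)\<^sup>2)" by (simp add: C0 power2_eq_square flip: ennreal_mult)
  finally show ?thesis unfolding C_def .
qed

lemma suminf_tail_square_tendsto_0:
  fixes c :: "nat \<Rightarrow> real"
  assumes "summable c"
  shows "(\<lambda>N. ennreal ((\<Sum>k. c (k + N))\<^sup>2)) \<longlonglongrightarrow> 0"
proof -
  have "(\<lambda>N. (\<Sum>k. c (k + N))) \<longlonglongrightarrow> 0" using assms by (rule suminf_exist_split2)
  then have "(\<lambda>N. (\<Sum>k. c (k + N))\<^sup>2) \<longlonglongrightarrow> 0\<^sup>2" by (rule tendsto_power)
  then show ?thesis using tendsto_ennrealI by fastforce
qed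

text \<open>A substitute for the triangle inequality in L^2, stated for nonnegative integrals so
  that it also makes sense when a norm may be infinite. The separate h lets the rule match any way
  of writing the sum.\<close>

lemma nn_integral_square_add_le:
  fixes f g :: "'a \<Rightarrow> real"
  assumes [measurable]: "f \<in> borel_measurable M" "g \<in> borel_measurable M"
    and h: "\<And>x. x \<in> space M \<Longrightarrow> h x = f x + g x"
  shows "(\<integral>\<^sup>+x. ennreal ((h x)\<^sup>2) \<partial>M) \<le> 2 * (\<integral>\<^sup>+x. ennreal ((f x)\<^sup>2) \<partial>M) + 2 * (\<integral>\<^sup>+x. ennreal ((g x)\<^sup>2) \<partial>M)"
proof -
  have "(\<integral>\<^sup>+x. ennreal ((h x)\<^sup>2) \<partial>M) \<le> (\<integral>\<^sup>+x. 2 * ennreal ((f x)\<^sup>2) + 2 * ennreal ((g x)\<^sup>2) \<partial>M)"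
  proof (rule nn_integral_mono)
    fix x assume x: "x \<in> space M"
    have "(h x)\<^sup>2 \<le> 2 * (f x)\<^sup>2 + 2 * (g x)\<^sup>2"
      using sum_squares_bound[of "f x" "g x"] by (simp add: h[OF x] power2_sum)
    then have "ennreal ((h x)\<^sup>2) \<le> ennreal (2 * (f x)\<^sup>2 + 2 * (g x)\<^sup>2)" by (rule ennreal_leI)
    also have "\<dots> = 2 * ennreal ((f x)\<^sup>2) + 2 * ennreal ((g x)\<^sup>2)"
      by (simp add: ennreal_plus ennreal_mult)
    finally show "ennreal ((h x)\<^sup>2) \<le> 2 * ennreal ((f x)\<^sup>2) + 2 * ennreal ((g x)\<^sup>2)" .
  qed
  also have "\<dots> = 2 * (\<integral>\<^sup>+x. ennreal ((f x)\<^sup>2) \<partial>M) + 2 * (\<integral>\<^sup>+x. ennreal ((g x)\<^sup>2) \<partial>M)"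
    by (subst nn_integral_add) (simp_all add: nn_integral_cmult)
  finally show ?thesis .
qed

lemma nn_integral_square_add_less_top:
  fixes f g :: "'a \<Rightarrow> real"
  assumes "f \<in> borel_measurable M" "g \<in> borel_measurable M"
    and "\<And>x. x \<in> space M \<Longrightarrow> h x = f x + g x"
    and "(\<integral>\<^sup>+x. ennreal ((f x)\<^sup>2) \<partial>M) < \<infinity>" "(\<integral>\<^sup>+x. ennreal ((g x)\<^sup>2) \<partial>M) < \<infinity>"
  shows "(\<integral>\<^sup>+x. ennreal ((h x)\<^sup>2) \<partial>M) < \<infinity>"
  using nn_integral_square_add_le[of f M g h] assms
  by (auto simp: ennreal_mult_less_top intro: le_less_trans)

section \<open>The Wiener integral\<close>

locale brownian =
  fixes M :: "'a measure" and W :: "real \<Rightarrow> 'a \<Rightarrow> real"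
  assumes bm: "brownian_motion M W"
begin

sublocale prob_space M using bm by (simp add: brownian_motion_def)

lemma W_measurable[measurable]: "W t \<in> borel_measurable M"
  using bm by (simp add: brownian_motion_def)

lemma W_continuous: "\<omega> \<in> space M \<Longrightarrow> continuous_on {0..} (\<lambda>t. W t \<omega>)"
  using bm by (simp add: brownian_motion_def)

lemma increment_moments:
  assumes "0 \<le> s" "s \<le> t"
  shows "integrable M (\<lambda>\<omega>. W t \<omega> - W s \<omega>)" "integrable M (\<lambda>\<omega>. (W t \<omega> - W s \<omega>)\<^sup>2)"
    "(\<integral>\<omega>. W t \<omega> - W s \<omega> \<partial>M) = 0" "(\<integral>\<omega>. (W t \<omega> - W s \<omega>)\<^sup>2 \<partial>M) = t - s"
proof -
  have "integrable M (\<lambda>\<omega>. W t \<omega> - W s \<omega>) \<and> integrable M (\<lambda>\<omega>. (W t \<omega> - W s \<omega>)\<^sup>2) \<and>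
    (\<integral>\<omega>. W t \<omega> - W s \<omega> \<partial>M) = 0 \<and> (\<integral>\<omega>. (W t \<omega> - W s \<omega>)\<^sup>2 \<partial>M) = t - s"
  \<comment> \<open>The normal law of an increment is only given for s < t; for s = t the increment
    is zero.\<close>
  proof (cases "s = t")
    case False
    then have st: "s < t" using assms by simp
    define \<sigma> where "\<sigma> = sqrt (t - s)"
    have s0: "0 < \<sigma>" using st by (simp add: \<sigma>_def)
    have D: "distributed M lborel (\<lambda>\<omega>. W t \<omega> - W s \<omega>) (normal_density 0 \<sigma>)"
      using bm st assms by (auto simp: brownian_motion_def \<sigma>_def)
    have i: "integrable M (\<lambda>\<omega>. (W t \<omega> - W s \<omega>) ^ k)" for k
      using distributed_integrable[OF D, of "\<lambda>x. x ^ k"] integrable_normal_moment[OF s0, of 0 k]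
      by (simp add: normal_density_nonneg)
    have m: "(\<integral>\<omega>. W t \<omega> - W s \<omega> \<partial>M) = 0"
      by (rule normal_distributed_expectation[OF s0 D])
    have v: "(\<integral>\<omega>. (W t \<omega> - W s \<omega>)\<^sup>2 \<partial>M) = t - s"
      using normal_distributed_variance[OF s0 D] m st by (simp add: \<sigma>_def)
    show ?thesis using i[of 1] i[of 2] m v by simp
  qed simp
  then show "integrable M (\<lambda>\<omega>. W t \<omega> - W s \<omega>)" "integrable M (\<lambda>\<omega>. (W t \<omega> - W s \<omega>)\<^sup>2)"
    "(\<integral>\<omega>. W t \<omega> - W s \<omega> \<partial>M) = 0" "(\<integral>\<omega>. (W t \<omega> - W s \<omega>)\<^sup>2 \<partial>M) = t - s" by auto
qed

text \<open>Written verbatim as the summand of \<open>wiener_int\<close>, so that unfolding both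
  makes them coincide.\<close>

definition incr :: "real \<Rightarrow> nat \<Rightarrow> nat \<Rightarrow> 'a \<Rightarrow> real" where
  "incr t N i \<omega> = W (t * real (Suc i) / real N) \<omega> - W (t * real i / real N) \<omega>"

lemma incr_measurable[measurable]: "incr t N i \<in> borel_measurable M"
  unfolding incr_def[abs_def] by measurable

lemma incr_moments:
  assumes "0 \<le> t" "0 < N"
  shows "integrable M (incr t N i)" "integrable M (\<lambda>\<omega>. (incr t N i \<omega>)\<^sup>2)"
    "(\<integral>\<omega>. incr t N i \<omega> \<partial>M) = 0" "(\<integral>\<omega>. (incr t N i \<omega>)\<^sup>2 \<partial>M) = t / real N"
proof -
  have "t * real i / real N \<le> t * real (Suc i) / real N"
    using assms by (intro divide_right_mono mult_left_mono) auto
  moreover have "0 \<le> t * real i / real N" using assms by simp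
  moreover have "t * real (Suc i) / real N - t * real i / real N = t / real N"
    by (simp add: diff_divide_distrib[symmetric] algebra_simps)
  ultimately show "integrable M (incr t N i)" "integrable M (\<lambda>\<omega>. (incr t N i \<omega>)\<^sup>2)"
    "(\<integral>\<omega>. incr t N i \<omega> \<partial>M) = 0" "(\<integral>\<omega>. (incr t N i \<omega>)\<^sup>2 \<partial>M) = t / real N"
    using increment_moments unfolding incr_def[abs_def] by (metis)+
qed

text \<open>Independence is assumed along sorted lists of times; the N + 1 grid points supply the N
  increments.\<close>

lemma incr_indep:
  assumes "0 \<le> t" "0 < N"
  shows "indep_vars (\<lambda>_. borel) (incr t N) {..<N}"
proof -
  let ?ts = "map (\<lambda>i. t * real i / real N) [0..<Suc N]"
  have "sorted ?ts"
    unfolding sorted_iff_nth_mono using assms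
    by (auto simp del: upt_Suc intro!: divide_right_mono mult_left_mono)
  moreover have "?ts \<noteq> []" "0 \<le> hd ?ts" by (simp_all del: upt_Suc add: hd_map)
  ultimately have "indep_vars (\<lambda>_. borel) (\<lambda>i \<omega>. W (?ts ! Suc i) \<omega> - W (?ts ! i) \<omega>) {..<length ?ts - 1}"
    using bm unfolding brownian_motion_def by blast
  then show ?thesis
    by (subst indep_vars_cong[OF refl _ refl, of _ _ "\<lambda>i \<omega>. W (?ts ! Suc i) \<omega> - W (?ts ! i) \<omega>"])
       (auto simp: incr_def fun_eq_iff simp del: upt_Suc)
qed

lemma incr_product:
  assumes "0 \<le> t" "0 < N" "i < N" "j < N"
  shows "integrable M (\<lambda>\<omega>. incr t N i \<omega> * incr t N j \<omega>)"
    "(\<integral>\<omega>. incr t N i \<omega> * incr t N j \<omega> \<partial>M) = (if i = j then t / real N else 0)"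
proof -
  have "integrable M (\<lambda>\<omega>. incr t N i \<omega> * incr t N j \<omega>) \<and>
    (\<integral>\<omega>. incr t N i \<omega> * incr t N j \<omega> \<partial>M) = (if i = j then t / real N else 0)"
  proof (cases "i = j")
    case True
    then show ?thesis using incr_moments(2,4)[OF assms(1,2), of j] by (simp add: power2_eq_square)
  next
    case False
    have I: "indep_vars (\<lambda>_. borel) (incr t N) {i, j}"
      by (rule indep_vars_subset[OF incr_indep[OF assms(1,2)]]) (use assms in auto)
    from indep_vars_integrable[OF _ I] indep_vars_lebesgue_integral[OF _ I] incr_moments(1,3)[OF assms(1,2)]
    show ?thesis using False by simp
  qed
  then show "integrable M (\<lambda>\<omega>. incr t N i \<omega> * incr t N j \<omega>)"
    "(\<integral>\<omega>. incr t N i \<omega> * incr t N j \<omega> \<partial>M) = (if i = j then t / real N else 0)" by auto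
qed

text \<open>The Ito isometry for step integrands: independence and zero means kill the mixed
  products, and each square contributes the length of its cell.\<close>

lemma incr_isometry:
  assumes "0 \<le> t" "0 < N"
  shows "(\<integral>\<^sup>+\<omega>. ennreal ((\<Sum>i<N. a i * incr t N i \<omega>)\<^sup>2) \<partial>M) = ennreal (\<Sum>i<N. (a i)\<^sup>2 * (t / real N))"
proof -
  have eq: "(\<lambda>\<omega>. (\<Sum>i<N. a i * incr t N i \<omega>)\<^sup>2) = (\<lambda>\<omega>. \<Sum>i<N. \<Sum>j<N. a i * a j * (incr t N i \<omega> * incr t N j \<omega>))"
    by (simp add: power2_eq_square sum_product mult_ac fun_eq_iff)
  have i: "integrable M (\<lambda>\<omega>. (\<Sum>i<N. a i * incr t N i \<omega>)\<^sup>2)"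
    unfolding eq by (intro Bochner_Integration.integrable_sum integrable_mult_right incr_product(1)[OF assms]) auto
  have "(\<integral>\<omega>. (\<Sum>i<N. a i * incr t N i \<omega>)\<^sup>2 \<partial>M) = (\<Sum>i<N. \<Sum>j<N. a i * a j * (if i = j then t / real N else 0))"
    unfolding eq
  proof (subst Bochner_Integration.integral_sum)
    show "integrable M (\<lambda>\<omega>. \<Sum>j<N. a i * a j * (incr t N i \<omega> * incr t N j \<omega>))" if "i \<in> {..<N}" for i
      using that by (intro Bochner_Integration.integrable_sum integrable_mult_right incr_product(1)[OF assms]) auto
    show "(\<Sum>i<N. \<integral>\<omega>. (\<Sum>j<N. a i * a j * (incr t N i \<omega> * incr t N j \<omega>)) \<partial>M) = (\<Sum>i<N. \<Sum>j<N. a i * a j * (if i = j then t / real N else 0))"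
    proof (rule sum.cong[OF refl])
      fix i assume i: "i \<in> {..<N}"
      show "(\<integral>\<omega>. (\<Sum>j<N. a i * a j * (incr t N i \<omega> * incr t N j \<omega>)) \<partial>M) = (\<Sum>j<N. a i * a j * (if i = j then t / real N else 0))"
        using i by (subst Bochner_Integration.integral_sum)
          (auto intro!: integrable_mult_right incr_product(1)[OF assms] sum.cong simp: incr_product(2)[OF assms])
    qed
  qed
  also have "\<dots> = (\<Sum>i<N. (a i)\<^sup>2 * (t / real N))"
    by (intro sum.cong refl) (simp add: sum.delta' power2_eq_square if_distrib[of "\<lambda>x. _ * x"] cong: if_cong)
  finally show ?thesis using nn_integral_eq_integral[OF i] by simp
qed

definition rsum :: "(real \<Rightarrow> real) \<Rightarrow> real \<Rightarrow> nat \<Rightarrow> 'a \<Rightarrow> real" where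
  "rsum f t N \<omega> = (\<Sum>i<N. f (t * real i / real N) * incr t N i \<omega>)"

lemma rsum_measurable[measurable]: "rsum f t N \<in> borel_measurable M"
  unfolding rsum_def[abs_def] by measurable

lemma rsum_mean:
  assumes "0 \<le> t"
  shows "integrable M (rsum f t N)" "(\<integral>\<omega>. rsum f t N \<omega> \<partial>M) = 0"
proof -
  have "integrable M (rsum f t N) \<and> (\<integral>\<omega>. rsum f t N \<omega> \<partial>M) = 0"
  proof (cases "N = 0")
    case False
    then show ?thesis unfolding rsum_def[abs_def]
      using incr_moments(1,3)[OF assms] by (subst Bochner_Integration.integral_sum) auto
  qed (simp add: rsum_def[abs_def])
  then show "integrable M (rsum f t N)" "(\<integral>\<omega>. rsum f t N \<omega> \<partial>M) = 0" by auto
qed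

lemma rsum_bound:
  assumes "0 \<le> t" and f: "\<And>x. x \<in> {0..t} \<Longrightarrow> \<bar>f x\<bar> \<le> B"
  shows "(\<integral>\<^sup>+\<omega>. ennreal ((rsum f t N \<omega>)\<^sup>2) \<partial>M) \<le> ennreal (B\<^sup>2 * t)"
proof (cases "N = 0")
  case False
  have "(\<Sum>i<N. (f (t * real i / real N))\<^sup>2 * (t / real N)) \<le> (\<Sum>i<N. B\<^sup>2 * (t / real N))"
  proof (intro sum_mono mult_right_mono)
    fix i assume "i \<in> {..<N}"
    then have "real i / real N \<le> 1" by simp
    then have "t * (real i / real N) \<le> t" using assms(1) by (intro mult_left_le)
    then have "\<bar>f (t * real i / real N)\<bar> \<le> B" using assms(1) by (intro f) auto
    then show "(f (t * real i / real N))\<^sup>2 \<le> B\<^sup>2"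
      using abs_le_square_iff[of "f (t * real i / real N)" B] by simp
  qed (use assms in auto)
  also have "\<dots> = B\<^sup>2 * t" using False by simp
  finally show ?thesis
    unfolding rsum_def incr_isometry[OF assms(1) False[unfolded neq0_conv]] by (rule ennreal_leI)
qed (simp add: rsum_def)

text \<open>The isometry compares sums over one partition only. A coarse sum is therefore rewritten
  on the refined grid with the integrand frozen at the coarse left endpoint
  (\<open>j div k\<close>); the fine increments telescope within each coarse cell.\<close>

lemma rsum_refine:
  assumes "0 < N" "0 < k"
  shows "rsum f t N \<omega> = (\<Sum>j<N * k. f (t * real (j div k) / real N) * incr t (N * k) j \<omega>)"
proof -
  have "(\<Sum>j<N * k. f (t * real (j div k) / real N) * incr t (N * k) j \<omega>) =
    (\<Sum>i<N. \<Sum>j\<in>{i * k..<i * k + k}. f (t * real (j div k) / real N) * incr t (N * k) j \<omega>)"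
    by (rule sum.nat_group[symmetric])
  also have "\<dots> = (\<Sum>i<N. f (t * real i / real N) * incr t N i \<omega>)"
  proof (rule sum.cong[OF refl])
    fix i
    have "(\<Sum>j\<in>{i * k..<i * k + k}. f (t * real (j div k) / real N) * incr t (N * k) j \<omega>)
      = (\<Sum>j\<in>{i * k..<i * k + k}. f (t * real i / real N) * incr t (N * k) j \<omega>)"
    proof (rule sum.cong[OF refl])
      fix j assume "j \<in> {i * k..<i * k + k}"
      then have "j div k = i" using assms by (intro div_nat_eqI) (auto simp: mult.commute)
      then show "f (t * real (j div k) / real N) * incr t (N * k) j \<omega> = f (t * real i / real N) * incr t (N * k) j \<omega>" by simp
    qed
    also have "\<dots> = f (t * real i / real N) * (\<Sum>j\<in>{i * k..<i * k + k}. incr t (N * k) j \<omega>)"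
      by (simp add: sum_distrib_left)
    also have "(\<Sum>j\<in>{i * k..<i * k + k}. incr t (N * k) j \<omega>) = W (t * real (i * k + k) / real (N * k)) \<omega> - W (t * real (i * k) / real (N * k)) \<omega>"
      unfolding incr_def by (rule sum_Suc_diff'[where f="\<lambda>j. W (t * real j / real (N * k)) \<omega>"]) simp
    also have "\<dots> = incr t N i \<omega>"
    proof -
      have "t * real (i * k + k) / real (N * k) = t * real (Suc i) / real N"
        "t * real (i * k) / real (N * k) = t * real i / real N"
        using assms by (auto simp: field_simps)
      then show ?thesis by (simp add: incr_def)
    qed
    finally show "(\<Sum>j\<in>{i * k..<i * k + k}. f (t * real (j div k) / real N) * incr t (N * k) j \<omega>) = f (t * real i / real N) * incr t N i \<omega>" .
  qed
  finally show ?thesis by (simp add: rsum_def)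
qed

text \<open>On the refined grid the difference has coefficients f(coarse endpoint) - f(fine
  endpoint), with points at most t / N apart, so the isometry bounds it by the modulus of
  continuity.\<close>

lemma rsum_refine_dist:
  assumes t: "0 \<le> t" and N: "0 < N" "0 < k"
    and f: "\<And>x y. x \<in> {0..t} \<Longrightarrow> y \<in> {0..t} \<Longrightarrow> \<bar>x - y\<bar> \<le> t / real N \<Longrightarrow> \<bar>f x - f y\<bar> \<le> e"
  shows "(\<integral>\<^sup>+\<omega>. ennreal ((rsum f t N \<omega> - rsum f t (N * k) \<omega>)\<^sup>2) \<partial>M) \<le> ennreal (e\<^sup>2 * t)"
proof -
  let ?a = "\<lambda>j. f (t * real (j div k) / real N) - f (t * real j / real (N * k))"
  have Nk: "0 < N * k" using N by simp
  have "rsum f t N \<omega> - rsum f t (N * k) \<omega> = (\<Sum>j<N * k. ?a j * incr t (N * k) j \<omega>)" for \<omega>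
    unfolding rsum_refine[OF N] by (simp add: rsum_def sum_subtractf left_diff_distrib)
  then have "(\<integral>\<^sup>+\<omega>. ennreal ((rsum f t N \<omega> - rsum f t (N * k) \<omega>)\<^sup>2) \<partial>M) = ennreal (\<Sum>j<N * k. (?a j)\<^sup>2 * (t / real (N * k)))"
    using incr_isometry[OF t Nk, of ?a] by simp
  also have "\<dots> \<le> ennreal (\<Sum>j<N * k. e\<^sup>2 * (t / real (N * k)))"
  proof (intro ennreal_leI sum_mono mult_right_mono)
    fix j assume j: "j \<in> {..<N * k}"
    have d: "real (j div k) \<le> real j / real k" "real j / real k \<le> real (j div k) + 1"
    proof -
      have "real j = real k * real (j div k) + real (j mod k)"
        by (metis mult_div_mod_eq of_nat_add of_nat_mult)
      moreover have "real (j mod k) < real k" using N by simp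
      ultimately show "real (j div k) \<le> real j / real k" "real j / real k \<le> real (j div k) + 1"
        using N by (auto simp: field_simps)
    qed
    have jk: "t * real j / real (N * k) = t / real N * (real j / real k)" by simp
    have jd: "t * real (j div k) / real N = t / real N * real (j div k)" by simp
    have tN: "0 \<le> t / real N" using t by simp
    have dist: "\<bar>t * real (j div k) / real N - t * real j / real (N * k)\<bar> \<le> t / real N"
    proof -
      have "\<bar>t * real (j div k) / real N - t * real j / real (N * k)\<bar> = t / real N * \<bar>real (j div k) - real j / real k\<bar>"
        unfolding jk jd right_diff_distrib[symmetric] using tN by (simp only: abs_mult abs_of_nonneg)
      also have "\<dots> \<le> t / real N * 1" using d tN by (intro mult_left_mono) auto
      finally show ?thesis by simp
    qed
    have j1: "real j / real (N * k) \<le> 1" using j N by (auto simp add: divide_le_eq_1 simp del: of_nat_mult)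
    have "t * (real j / real (N * k)) \<le> t" using t j1 by (intro mult_left_le)
    then have m1: "t * real j / real (N * k) \<in> {0..t}" using t by simp
    have "t * real (j div k) / real N \<le> t * real j / real (N * k)"
      unfolding jk jd using d tN by (intro mult_left_mono)
    then have m2: "t * real (j div k) / real N \<in> {0..t}" using m1 t by auto
    show "(?a j)\<^sup>2 \<le> e\<^sup>2"
      using f[OF m2 m1 dist] abs_le_square_iff[of "?a j" e] by simp
  qed (use t in auto)
  also have "(\<Sum>j<N * k. e\<^sup>2 * (t / real (N * k))) = e\<^sup>2 * t" using Nk by simp
  finally show ?thesis .
qed

text \<open>Both sums are compared with the one on the common refinement into N * N' cells; the
  factor 4 is 2 + 2 from splitting the square.\<close>

lemma rsum_dist:
  assumes t: "0 \<le> t" and N: "0 < N" "0 < N'"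
    and f: "\<And>x y. x \<in> {0..t} \<Longrightarrow> y \<in> {0..t} \<Longrightarrow> \<bar>x - y\<bar> \<le> t / real (min N N') \<Longrightarrow> \<bar>f x - f y\<bar> \<le> e"
  shows "(\<integral>\<^sup>+\<omega>. ennreal ((rsum f t N \<omega> - rsum f t N' \<omega>)\<^sup>2) \<partial>M) \<le> ennreal (4 * (e\<^sup>2 * t))"
proof -
  have "t / real N \<le> t / real (min N N')" "t / real N' \<le> t / real (min N N')"
    using t N by (auto intro!: divide_left_mono)
  then have 1: "(\<integral>\<^sup>+\<omega>. ennreal ((rsum f t N \<omega> - rsum f t (N * N') \<omega>)\<^sup>2) \<partial>M) \<le> ennreal (e\<^sup>2 * t)"
    and 2: "(\<integral>\<^sup>+\<omega>. ennreal ((rsum f t N' \<omega> - rsum f t (N' * N) \<omega>)\<^sup>2) \<partial>M) \<le> ennreal (e\<^sup>2 * t)"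
    by (auto intro!: rsum_refine_dist t N f)
  have "(\<integral>\<^sup>+\<omega>. ennreal ((rsum f t N \<omega> - rsum f t N' \<omega>)\<^sup>2) \<partial>M) \<le>
     2 * (\<integral>\<^sup>+\<omega>. ennreal ((rsum f t N \<omega> - rsum f t (N * N') \<omega>)\<^sup>2) \<partial>M)
     + 2 * (\<integral>\<^sup>+\<omega>. ennreal ((rsum f t (N * N') \<omega> - rsum f t N' \<omega>)\<^sup>2) \<partial>M)"
    by (rule nn_integral_square_add_le) auto
  also have "\<dots> \<le> 2 * ennreal (e\<^sup>2 * t) + 2 * ennreal (e\<^sup>2 * t)"
    using 1 2 by (intro add_mono mult_left_mono) (auto simp: power2_commute mult.commute)
  also have "\<dots> = ennreal (4 * (e\<^sup>2 * t))"
    using t by (simp flip: ennreal_numeral ennreal_mult ennreal_plus)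
  finally show ?thesis .
qed

end

lemma finite_measure_Icc: "finite_measure (restrict_space lborel {0..T::real})"
  by (rule finite_measureI)
     (auto simp: emeasure_lborel_Icc_eq emeasure_restrict_space space_restrict_space)

lemma ennreal_tendsto_0I:
  fixes a b :: "nat \<Rightarrow> ennreal"
  assumes "b \<longlonglongrightarrow> 0" "\<And>k. \<forall>\<^sub>F N in sequentially. a N \<le> b k"
  shows "a \<longlonglongrightarrow> 0"
proof (rule order_tendstoI)
  fix x :: ennreal assume "0 < x"
  with assms(1) have "\<forall>\<^sub>F k in sequentially. b k < x" by (rule order_tendstoD(2))
  then obtain k where "b k < x" by (auto simp: eventually_sequentially)
  with assms(2)[of k] show "\<forall>\<^sub>F N in sequentially. a N < x"
    by (auto elim: eventually_mono intro: le_less_trans)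
qed simp

section \<open>A jointly measurable version of the Wiener integral\<close>

context brownian
begin

text \<open>By path continuity W at a variable time is the limit of W at times rounded down to
  multiples of 1 / (n + 1), of which there are countably many. Paths are continuous on the
  nonnegative half-line only, hence the \<open>max 0\<close>.\<close>

lemma W_joint_measurable:
  assumes [measurable]: "p \<in> borel_measurable N" "q \<in> measurable N M"
  shows "(\<lambda>x. W (max 0 (p x)) (q x)) \<in> borel_measurable N"
proof (rule borel_measurable_LIMSEQ_metric)
  let ?a = "\<lambda>n x. real_of_int \<lfloor>p x * real (Suc n)\<rfloor> / real (Suc n)"
  fix n
  have "(\<lambda>x. (\<lambda>i::int. \<lambda>x. W (max 0 (real_of_int i / real (Suc n))) (q x)) \<lfloor>p x * real (Suc n)\<rfloor> x) \<in> borel_measurable N"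
    by (rule measurable_compose_countable) measurable
  then show "(\<lambda>x. W (max 0 (?a n x)) (q x)) \<in> borel_measurable N" .
next
  let ?a = "\<lambda>n x. real_of_int \<lfloor>p x * real (Suc n)\<rfloor> / real (Suc n)"
  fix x assume x: "x \<in> space N"
  have lim: "(\<lambda>n. ?a n x) \<longlonglongrightarrow> p x"
  proof (rule real_tendsto_sandwich)
    have "(\<lambda>n. p x - 1 / real (Suc n)) \<longlonglongrightarrow> p x - 0"
      by (intro tendsto_diff tendsto_const LIMSEQ_Suc lim_1_over_n)
    then show "(\<lambda>n. p x - 1 / real (Suc n)) \<longlonglongrightarrow> p x" by simp
    show "\<forall>\<^sub>F n in sequentially. p x - 1 / real (Suc n) \<le> ?a n x"
    proof (rule always_eventually, rule allI)
      fix n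
      have "p x * real (Suc n) - 1 \<le> real_of_int \<lfloor>p x * real (Suc n)\<rfloor>" by linarith
      then have "(p x * real (Suc n) - 1) / real (Suc n) \<le> ?a n x" by (rule divide_right_mono) simp
      then show "p x - 1 / real (Suc n) \<le> ?a n x" by (simp add: diff_divide_distrib del: of_nat_Suc)
    qed
    show "\<forall>\<^sub>F n in sequentially. ?a n x \<le> p x"
      by (rule always_eventually) (auto simp: pos_divide_le_eq simp del: of_nat_Suc)
  qed (rule tendsto_const)
  have "q x \<in> space M" using x by (rule measurable_space[OF assms(2)])
  from continuous_on_tendsto_compose[OF W_continuous[OF this] tendsto_max[OF tendsto_const lim], of 0]
  show "(\<lambda>n. W (max 0 (?a n x)) (q x)) \<longlonglongrightarrow> W (max 0 (p x)) (q x)" by simp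
qed

lemma rsum_joint_measurable:
  assumes [measurable]: "K \<in> borel_measurable borel"
  shows "(\<lambda>(t, \<omega>). rsum (\<lambda>s. K (t - s)) t N \<omega>) \<in> borel_measurable (PM T M)"
proof -
  have fm[measurable]: "fst \<in> borel_measurable (PM T M)"
  proof -
    have "fst \<in> measurable (PM T M) (restrict_space lborel {0..T})" unfolding PM_def by simp
    moreover have "(\<lambda>x. x) \<in> borel_measurable (restrict_space lborel {0..T::real})"
      by (intro measurable_restrict_space1) simp
    ultimately show ?thesis by (rule measurable_compose)
  qed
  have sm[measurable]: "snd \<in> measurable (PM T M) M" unfolding PM_def by simp
  have [measurable]: "(\<lambda>x. W (max 0 (fst x * real i / real N)) (snd x)) \<in> borel_measurable (PM T M)" for i
    by (rule W_joint_measurable) measurable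
  have "(\<lambda>x. \<Sum>i<N. K (fst x - fst x * real i / real N) *
      (W (max 0 (fst x * real (Suc i) / real N)) (snd x) - W (max 0 (fst x * real i / real N)) (snd x))) \<in> borel_measurable (PM T M)"
    by measurable
  also have "?this \<longleftrightarrow> ?thesis"
  proof (rule measurable_cong)
    fix x assume "x \<in> space (PM T M)"
    then have "0 \<le> fst x" by (auto simp: PM_def space_pair_measure space_restrict_space)
    then have "max 0 (fst x * real i / real N) = fst x * real i / real N" for i
      by (intro max_absorb2) simp
    then show "(\<Sum>i<N. K (fst x - fst x * real i / real N) *
      (W (max 0 (fst x * real (Suc i) / real N)) (snd x) - W (max 0 (fst x * real i / real N)) (snd x))) =
      (case x of (t, \<omega>) \<Rightarrow> rsum (\<lambda>s. K (t - s)) t N \<omega>)"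
      by (simp only: rsum_def incr_def case_prod_beta)
  qed
  finally show ?thesis .
qed

text \<open>The threshold N0 does not depend on t: K is uniformly continuous and the mesh t / N is
  at most T / N. Hence one subsequence of partitions works for all t.\<close>

lemma rsum_uniformly_Cauchy:
  assumes T: "0 \<le> T" and K: "continuous_on {0..T} K" and e: "0 < e"
  obtains N0 where "0 < N0" "\<And>N N' t. N0 \<le> N \<Longrightarrow> N0 \<le> N' \<Longrightarrow> t \<in> {0..T} \<Longrightarrow>
    (\<integral>\<^sup>+\<omega>. ennreal ((rsum (\<lambda>s. K (t - s)) t N \<omega> - rsum (\<lambda>s. K (t - s)) t N' \<omega>)\<^sup>2) \<partial>M) \<le> ennreal e"
proof -
  \<comment> \<open>Chosen so that 4 times its square times t stays below e for all t up to T; the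
    \<open>T + 1\<close> avoids division by zero.\<close>
  define \<eta> where "\<eta> = sqrt (e / (4 * (T + 1)))"
  have \<eta>: "0 < \<eta>" "\<eta>\<^sup>2 = e / (4 * (T + 1))" using T e by (auto simp: \<eta>_def)
  have "uniformly_continuous_on {0..T} K" using K by (intro compact_uniformly_continuous) auto
  then obtain d where d: "0 < d" "\<And>x y. x \<in> {0..T} \<Longrightarrow> y \<in> {0..T} \<Longrightarrow> dist y x < d \<Longrightarrow> dist (K y) (K x) < \<eta>"
    unfolding uniformly_continuous_on_def using \<eta>(1) by blast
  obtain N0 where N0: "T / d < real N0" using reals_Archimedean2 by blast
  show thesis
  proof (rule that[of "Suc N0"])
    fix N N' t assume N: "Suc N0 \<le> N" "Suc N0 \<le> N'" and t: "t \<in> {0..T}"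
    have "(\<integral>\<^sup>+\<omega>. ennreal ((rsum (\<lambda>s. K (t - s)) t N \<omega> - rsum (\<lambda>s. K (t - s)) t N' \<omega>)\<^sup>2) \<partial>M) \<le> ennreal (4 * (\<eta>\<^sup>2 * t))"
    proof (rule rsum_dist)
      fix x y assume xy: "x \<in> {0..t}" "y \<in> {0..t}" "\<bar>x - y\<bar> \<le> t / real (min N N')"
      have m: "real N0 < real (min N N')" using N by simp
      have "T < d * real N0" using N0 d by (simp add: pos_divide_less_eq mult.commute)
      also have "\<dots> \<le> d * real (min N N')" using m d by (intro mult_left_mono) auto
      finally have "T / real (min N N') < d" using m by (simp add: pos_divide_less_eq del: of_nat_min)
      moreover have "t / real (min N N') \<le> T / real (min N N')" using t by (intro divide_right_mono) auto
      ultimately have "dist (t - x) (t - y) < d" using xy by (simp add: dist_real_def)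
      then show "\<bar>K (t - x) - K (t - y)\<bar> \<le> \<eta>"
        using d(2)[of "t - y" "t - x"] xy t by (simp add: dist_real_def)
    qed (use t N in auto)
    also have "4 * (\<eta>\<^sup>2 * t) \<le> e"
    proof -
      have "e * t \<le> e * (T + 1)" using t e by (intro mult_left_mono) auto
      then show ?thesis unfolding \<eta> using T by (simp add: field_simps)
    qed
    finally show "(\<integral>\<^sup>+\<omega>. ennreal ((rsum (\<lambda>s. K (t - s)) t N \<omega> - rsum (\<lambda>s. K (t - s)) t N' \<omega>)\<^sup>2) \<partial>M) \<le> ennreal e"
      by (simp add: ennreal_leI)
  qed simp
qed

lemma expectation_square_le:
  assumes [measurable]: "X \<in> borel_measurable M" and X: "integrable M (\<lambda>\<omega>. (X \<omega>)\<^sup>2)"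
  shows "ennreal ((expectation X)\<^sup>2) \<le> (\<integral>\<^sup>+\<omega>. ennreal ((X \<omega>)\<^sup>2) \<partial>M)"
proof -
  have "integrable M X" by (rule square_integrable_imp_integrable[OF assms])
  from variance_eq[OF this X] variance_positive[of X]
  have "(expectation X)\<^sup>2 \<le> expectation (\<lambda>\<omega>. (X \<omega>)\<^sup>2)" by linarith
  then show ?thesis by (subst nn_integral_eq_integral[OF X]) (auto intro: ennreal_leI)
qed

text \<open>One L^2 limit Y guarantees that the choice in \<open>wiener_int\<close> satisfies its
  defining property, and two L^2 limits of the same sums agree almost everywhere.\<close>

lemma wiener_int_eq_version:
  assumes Ym[measurable]: "Y \<in> borel_measurable M"
    and Y: "(\<lambda>N. \<integral>\<^sup>+\<omega>. ennreal ((Y \<omega> - rsum f t N \<omega>)\<^sup>2) \<partial>M) \<longlonglongrightarrow> 0"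
  shows "AE \<omega> in M. wiener_int M W f t \<omega> = Y \<omega>"
proof -
  define Z where "Z = wiener_int M W f t"
  have "\<exists>Z. Z \<in> borel_measurable M \<and> (\<lambda>N. \<integral>\<^sup>+\<omega>. ennreal ((Z \<omega> - rsum f t N \<omega>)\<^sup>2) \<partial>M) \<longlonglongrightarrow> 0"
    using Ym Y by blast
  from someI_ex[OF this]
  have "Z \<in> borel_measurable M \<and> (\<lambda>N. \<integral>\<^sup>+\<omega>. ennreal ((Z \<omega> - rsum f t N \<omega>)\<^sup>2) \<partial>M) \<longlonglongrightarrow> 0"
    unfolding Z_def wiener_int_def rsum_def incr_def .
  then have Zm[measurable]: "Z \<in> borel_measurable M" and Z: "(\<lambda>N. \<integral>\<^sup>+\<omega>. ennreal ((Z \<omega> - rsum f t N \<omega>)\<^sup>2) \<partial>M) \<longlonglongrightarrow> 0"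
    by auto
  have "(\<integral>\<^sup>+\<omega>. ennreal ((Z \<omega> - Y \<omega>)\<^sup>2) \<partial>M) \<le> 2 * 0 + 2 * 0"
  proof (rule LIMSEQ_le_const)
    show "(\<lambda>N. 2 * (\<integral>\<^sup>+\<omega>. ennreal ((Z \<omega> - rsum f t N \<omega>)\<^sup>2) \<partial>M) + 2 * (\<integral>\<^sup>+\<omega>. ennreal ((Y \<omega> - rsum f t N \<omega>)\<^sup>2) \<partial>M))
       \<longlonglongrightarrow> 2 * 0 + 2 * 0"
      by (intro tendsto_add ennreal_tendsto_cmult Y Z) auto
    have "(\<integral>\<^sup>+\<omega>. ennreal ((Z \<omega> - Y \<omega>)\<^sup>2) \<partial>M) \<le> 2 * (\<integral>\<^sup>+\<omega>. ennreal ((Z \<omega> - rsum f t N \<omega>)\<^sup>2) \<partial>M)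
       + 2 * (\<integral>\<^sup>+\<omega>. ennreal ((Y \<omega> - rsum f t N \<omega>)\<^sup>2) \<partial>M)" for N
      unfolding power2_commute[of "Y _" "rsum _ _ _ _"] by (rule nn_integral_square_add_le) auto
    then show "\<exists>N. \<forall>n\<ge>N. (\<integral>\<^sup>+\<omega>. ennreal ((Z \<omega> - Y \<omega>)\<^sup>2) \<partial>M) \<le>
        2 * (\<integral>\<^sup>+\<omega>. ennreal ((Z \<omega> - rsum f t n \<omega>)\<^sup>2) \<partial>M) + 2 * (\<integral>\<^sup>+\<omega>. ennreal ((Y \<omega> - rsum f t n \<omega>)\<^sup>2) \<partial>M)"
      by blast
  qed
  then have "(\<integral>\<^sup>+\<omega>. ennreal ((Z \<omega> - Y \<omega>)\<^sup>2) \<partial>M) = 0" by simp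
  then have "AE \<omega> in M. ennreal ((Z \<omega> - Y \<omega>)\<^sup>2) = 0" by (subst (asm) nn_integral_0_iff_AE) auto
  then show ?thesis unfolding Z_def[symmetric] by eventually_elim simp
qed

text \<open>Choosing \<open>wiener_int\<close> for each t separately says nothing about
  measurability in t. Y is instead the pointwise limit of jointly measurable Riemann sums along a
  subsequence common to all t, and it equals the chosen integral almost surely at every t.\<close>

lemma wiener_int_version:
  assumes T: "0 \<le> T" and K: "continuous_on UNIV K"
  obtains Y where "(\<lambda>(t, \<omega>). Y t \<omega>) \<in> borel_measurable (PM T M)"
    "integrable (PM T M) (\<lambda>(t, \<omega>). (Y t \<omega>)\<^sup>2)"
    "\<forall>t\<in>{0..T}. integrable M (Y t) \<and> expectation (Y t) = 0 \<and>
      (AE \<omega> in M. wiener_int M W (\<lambda>s. K (t - s)) t \<omega> = Y t \<omega>)"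
proof -
  have Km[measurable]: "K \<in> borel_measurable borel" using K by (rule borel_measurable_continuous_onI)
  have KT: "continuous_on {0..T} K" using K by (rule continuous_on_subset) simp
  let ?S = "\<lambda>t N. rsum (\<lambda>s. K (t - s)) t N"
  let ?c = "\<lambda>k. (1/2::real) ^ k"
  define P where "P k n \<longleftrightarrow> (\<forall>N N' t. n \<le> N \<longrightarrow> n \<le> N' \<longrightarrow> t \<in> {0..T} \<longrightarrow>
    (\<integral>\<^sup>+\<omega>. ennreal ((?S t N \<omega> - ?S t N' \<omega>)\<^sup>2) \<partial>M) \<le> ennreal ((?c k)\<^sup>2))" for k n
  have "\<exists>n. P k n" for k
  proof -
    obtain n where "\<And>N N' t. n \<le> N \<Longrightarrow> n \<le> N' \<Longrightarrow> t \<in> {0..T} \<Longrightarrow>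
      (\<integral>\<^sup>+\<omega>. ennreal ((?S t N \<omega> - ?S t N' \<omega>)\<^sup>2) \<partial>M) \<le> ennreal ((?c k)\<^sup>2)"
      using rsum_uniformly_Cauchy[OF T KT, of "(?c k)\<^sup>2" thesis] by fastforce
    then show ?thesis unfolding P_def by blast
  qed
  then obtain n0 where "\<And>k. P k (n0 k)" by metis
  then have n0: "\<And>k N N' t. n0 k \<le> N \<Longrightarrow> n0 k \<le> N' \<Longrightarrow> t \<in> {0..T} \<Longrightarrow>
    (\<integral>\<^sup>+\<omega>. ennreal ((?S t N \<omega> - ?S t N' \<omega>)\<^sup>2) \<partial>M) \<le> ennreal ((?c k)\<^sup>2)"
    unfolding P_def by blast
  \<comment> \<open>Summing the thresholds puts both \<open>nk k\<close> and
    \<open>nk (Suc k)\<close> above \<open>n0 k\<close>, so consecutive sums are within (1/2)^k in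
    L^2.\<close>
  define nk where "nk k = (\<Sum>j\<le>k. n0 j)" for k
  have nk: "n0 k \<le> nk k" "n0 k \<le> nk (Suc k)" for k
    unfolding nk_def by (intro member_le_sum; simp)+
  have sc: "summable ?c" by (rule summable_geometric) simp
  define Y where "Y t \<omega> = lim (\<lambda>k. ?S t (nk k) \<omega>)" for t \<omega>
  have Ymeas[measurable]: "Y t \<in> borel_measurable M" for t unfolding Y_def[abs_def] by measurable
  let ?tail = "\<lambda>k. ennreal ((\<Sum>j. ?c (j + k))\<^sup>2)"
  have Yk: "(\<integral>\<^sup>+\<omega>. ennreal ((Y t \<omega> - ?S t (nk k) \<omega>)\<^sup>2) \<partial>M) \<le> ?tail k" if t: "t \<in> {0..T}" for t k
    unfolding Y_def
  proof (rule L2_telescope_convergence[OF _ _ sc])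
    show "(\<integral>\<^sup>+\<omega>. ennreal ((?S t (nk (Suc k)) \<omega> - ?S t (nk k) \<omega>)\<^sup>2) \<partial>M) \<le> ennreal ((?c k)\<^sup>2)" for k
      by (rule n0[OF nk(2) nk(1) t])
  qed auto
  \<comment> \<open>\<open>wiener_int\<close> demands convergence along all N; the Cauchy property
    transfers it from the subsequence to the whole sequence.\<close>
  have YN: "(\<lambda>N. \<integral>\<^sup>+\<omega>. ennreal ((Y t \<omega> - ?S t N \<omega>)\<^sup>2) \<partial>M) \<longlonglongrightarrow> 0" if t: "t \<in> {0..T}" for t
  proof (rule ennreal_tendsto_0I)
    have "(\<lambda>k. (?c k)\<^sup>2) \<longlonglongrightarrow> 0\<^sup>2" by (intro tendsto_power summable_LIMSEQ_zero sc)
    then have "(\<lambda>k. ennreal ((?c k)\<^sup>2)) \<longlonglongrightarrow> 0" using tendsto_ennrealI by fastforce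
    then have "(\<lambda>k. 2 * ?tail k + 2 * ennreal ((?c k)\<^sup>2)) \<longlonglongrightarrow> 2 * 0 + 2 * 0"
      by (intro tendsto_add ennreal_tendsto_cmult suminf_tail_square_tendsto_0 sc) auto
    then show "(\<lambda>k. 2 * ?tail k + 2 * ennreal ((?c k)\<^sup>2)) \<longlonglongrightarrow> 0" by simp
    fix k
    show "\<forall>\<^sub>F N in sequentially. (\<integral>\<^sup>+\<omega>. ennreal ((Y t \<omega> - ?S t N \<omega>)\<^sup>2) \<partial>M) \<le> 2 * ?tail k + 2 * ennreal ((?c k)\<^sup>2)"
      unfolding eventually_sequentially
    proof (intro exI[of _ "n0 k"] allI impI)
      fix N assume N: "n0 k \<le> N"
      have "(\<integral>\<^sup>+\<omega>. ennreal ((Y t \<omega> - ?S t N \<omega>)\<^sup>2) \<partial>M) \<le> 2 * (\<integral>\<^sup>+\<omega>. ennreal ((Y t \<omega> - ?S t (nk k) \<omega>)\<^sup>2) \<partial>M)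
         + 2 * (\<integral>\<^sup>+\<omega>. ennreal ((?S t (nk k) \<omega> - ?S t N \<omega>)\<^sup>2) \<partial>M)"
        by (rule nn_integral_square_add_le) auto
      also have "\<dots> \<le> 2 * ?tail k + 2 * ennreal ((?c k)\<^sup>2)"
        by (intro add_mono mult_left_mono Yk n0 nk N t) auto
      finally show "(\<integral>\<^sup>+\<omega>. ennreal ((Y t \<omega> - ?S t N \<omega>)\<^sup>2) \<partial>M) \<le> 2 * ?tail k + 2 * ennreal ((?c k)\<^sup>2)" .
    qed
  qed
  obtain B where B: "\<And>x. x \<in> {0..T} \<Longrightarrow> \<bar>K x\<bar> \<le> B"
    using continuous_on_Icc_bounded[OF KT] by blast
  have S2: "(\<integral>\<^sup>+\<omega>. ennreal ((?S t N \<omega>)\<^sup>2) \<partial>M) \<le> ennreal (B\<^sup>2 * T)" if t: "t \<in> {0..T}" for t N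
  proof -
    have "(\<integral>\<^sup>+\<omega>. ennreal ((?S t N \<omega>)\<^sup>2) \<partial>M) \<le> ennreal (B\<^sup>2 * t)"
      by (rule rsum_bound) (use t B in auto)
    also have "\<dots> \<le> ennreal (B\<^sup>2 * T)" using t by (intro ennreal_leI mult_left_mono) auto
    finally show ?thesis .
  qed
  define C where "C = 2 * ?tail 0 + 2 * ennreal (B\<^sup>2 * T)"
  have C: "C < \<infinity>" unfolding C_def by (simp add: ennreal_mult_less_top)
  have YC: "(\<integral>\<^sup>+\<omega>. ennreal ((Y t \<omega>)\<^sup>2) \<partial>M) \<le> C" if t: "t \<in> {0..T}" for t
  proof -
    have "(\<integral>\<^sup>+\<omega>. ennreal ((Y t \<omega>)\<^sup>2) \<partial>M) \<le> 2 * (\<integral>\<^sup>+\<omega>. ennreal ((Y t \<omega> - ?S t (nk 0) \<omega>)\<^sup>2) \<partial>M)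
         + 2 * (\<integral>\<^sup>+\<omega>. ennreal ((?S t (nk 0) \<omega>)\<^sup>2) \<partial>M)"
      by (rule nn_integral_square_add_le) auto
    also have "\<dots> \<le> C" unfolding C_def by (intro add_mono mult_left_mono Yk S2 t) auto
    finally show ?thesis .
  qed
  have Y2: "integrable M (\<lambda>\<omega>. (Y t \<omega>)\<^sup>2)" if t: "t \<in> {0..T}" for t
    using le_less_trans[OF YC[OF t] C] by (intro integrableI_bounded) auto
  have Yi: "integrable M (Y t)" if t: "t \<in> {0..T}" for t
    by (rule square_integrable_imp_integrable[OF Ymeas Y2[OF t]])
  \<comment> \<open>Riemann sums have mean zero, so the squared mean of Y is at most the squared L^2
    distance of Y to any of them.\<close>
  have E0: "expectation (Y t) = 0" if t: "t \<in> {0..T}" for t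
  proof -
    have "ennreal ((expectation (Y t))\<^sup>2) \<le> (\<integral>\<^sup>+\<omega>. ennreal ((Y t \<omega> - ?S t N \<omega>)\<^sup>2) \<partial>M)" for N
    proof -
      have a: "(\<integral>\<^sup>+\<omega>. ennreal ((Y t \<omega>)\<^sup>2) \<partial>M) < \<infinity>"
        by (rule le_less_trans[OF YC[OF t] C])
      have b: "(\<integral>\<^sup>+\<omega>. ennreal ((- ?S t N \<omega>)\<^sup>2) \<partial>M) < \<infinity>"
        using le_less_trans[OF S2[OF t, of N]] by simp
      have fin: "(\<integral>\<^sup>+\<omega>. ennreal ((Y t \<omega> - ?S t N \<omega>)\<^sup>2) \<partial>M) < \<infinity>"
        by (rule nn_integral_square_add_less_top[OF _ _ _ a b]) auto
      have "expectation (\<lambda>\<omega>. Y t \<omega> - ?S t N \<omega>) = expectation (Y t)"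
        using Yi[OF t] rsum_mean[of t "\<lambda>s. K (t - s)" N] t by (subst Bochner_Integration.integral_diff) simp_all
      moreover have "integrable M (\<lambda>\<omega>. (Y t \<omega> - ?S t N \<omega>)\<^sup>2)"
        using fin by (intro integrableI_bounded) simp_all
      ultimately show ?thesis
        using expectation_square_le[of "\<lambda>\<omega>. Y t \<omega> - ?S t N \<omega>"] by simp
    qed
    then have "ennreal ((expectation (Y t))\<^sup>2) \<le> 0"
      by (intro LIMSEQ_le_const[OF YN[OF t]]) auto
    then show ?thesis by (simp add: ennreal_eq_0_iff)
  qed
  have Yj[measurable]: "(\<lambda>(t, \<omega>). Y t \<omega>) \<in> borel_measurable (PM T M)"
  proof -
    have [measurable]: "(\<lambda>x. ?S (fst x) N (snd x)) \<in> borel_measurable (PM T M)" for N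
      using rsum_joint_measurable[OF Km, of N T] by (simp add: case_prod_beta')
    show ?thesis unfolding Y_def case_prod_beta' by measurable
  qed
  have Y2j: "integrable (PM T M) (\<lambda>(t, \<omega>). (Y t \<omega>)\<^sup>2)"
  proof (rule integrableI_bounded)
    have e: "(\<lambda>(t, \<omega>). (Y t \<omega>)\<^sup>2) = (\<lambda>x. ((\<lambda>(t, \<omega>). Y t \<omega>) x)\<^sup>2)" by auto
    show m: "(\<lambda>(t, \<omega>). (Y t \<omega>)\<^sup>2) \<in> borel_measurable (PM T M)" unfolding e by measurable
    have "(\<integral>\<^sup>+x. ennreal (norm (case x of (t, \<omega>) \<Rightarrow> (Y t \<omega>)\<^sup>2)) \<partial>PM T M)
       = (\<integral>\<^sup>+t. \<integral>\<^sup>+\<omega>. ennreal ((Y t \<omega>)\<^sup>2) \<partial>M \<partial>restrict_space lborel {0..T})"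
      using m unfolding PM_def by (subst nn_integral_fst[symmetric]) auto
    also have "\<dots> \<le> (\<integral>\<^sup>+t. C \<partial>restrict_space lborel {0..T})"
      by (intro nn_integral_mono YC) (auto simp: space_restrict_space)
    also have "\<dots> = C * emeasure lborel {0..T}"
      by (simp add: emeasure_restrict_space space_restrict_space)
    also have "\<dots> < \<infinity>" using C by (simp add: emeasure_lborel_Icc_eq ennreal_mult_less_top)
    finally show "(\<integral>\<^sup>+x. ennreal (norm (case x of (t, \<omega>) \<Rightarrow> (Y t \<omega>)\<^sup>2)) \<partial>PM T M) < \<infinity>" .
  qed
  show thesis
    by (rule that[of Y, OF Yj Y2j]) (intro ballI conjI Yi E0 wiener_int_eq_version[OF Ymeas YN])
qed

end

section \<open>The operator exponential\<close>

text \<open>The j-th power of the shift applied to \<open>nu\<close>.\<close>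

definition cell :: "nat \<Rightarrow> real \<Rightarrow> real" where
  "cell j = indicator {- real j .. - real j + 1}"

lemma cell_measurable[measurable]: "cell j \<in> borel_measurable borel"
  unfolding cell_def by measurable

lemma nu_eq_cell: "nu = cell 0" by (simp add: nu_def cell_def)

text \<open>Orthonormality of the cells: neighbouring closed intervals share only an endpoint, a
  null set.\<close>

lemma cell_product: "has_bochner_integral lborel (\<lambda>x. cell k x * cell j x) (if k = j then 1 else 0)"
proof -
  have "(\<lambda>x. cell k x * cell j x) = indicator {max (- real k) (- real j) .. min (- real k + 1) (- real j + 1)}"
    by (auto simp: cell_def indicator_def fun_eq_iff)
  moreover have "measure lborel {max (- real k) (- real j) .. min (- real k + 1) (- real j + 1)} = (if k = j then 1 else 0)"
  proof (cases "k = j")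
    case False
    then have "real k + 1 \<le> real j \<or> real j + 1 \<le> real k" by linarith
    then have "measure lborel {max (- real k) (- real j) .. min (- real k + 1) (- real j + 1)} = 0"
      by (auto simp: measure_def emeasure_lborel_Icc_eq)
    then show ?thesis using False by simp
  qed simp
  ultimately show ?thesis
    by (auto simp: has_bochner_integral_iff emeasure_lborel_Icc_eq)
qed

lemma g_fun_eq: "g_fun T K n x = (\<Sum>k\<le>n. taylor_coeff T K n k * cell k x)"
  by (simp add: g_fun_def taylor_coeff_def cell_def)

text \<open>By orthonormality the inner product reads off Taylor coefficients. The index map j
  allows the reversed indices that appear in the powers of the operator.\<close>

lemma l2_inner_g_fun_sum:
  assumes A: "finite A"
  shows "integrable lborel (\<lambda>x. g_fun T K n x * (\<Sum>i\<in>A. c i * cell (j i) x))"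
    "l2_inner (g_fun T K n) (\<lambda>x. \<Sum>i\<in>A. c i * cell (j i) x) = (\<Sum>i\<in>A. c i * taylor_coeff T K n (j i))"
proof -
  have "has_bochner_integral lborel (\<lambda>x. \<Sum>i\<in>A. \<Sum>k\<le>n. c i * taylor_coeff T K n k * (cell k x * cell (j i) x))
     (\<Sum>i\<in>A. \<Sum>k\<le>n. c i * taylor_coeff T K n k * (if k = j i then 1 else 0))"
    by (intro has_bochner_integral_sum has_bochner_integral_mult_right cell_product)
  also have "(\<lambda>x. \<Sum>i\<in>A. \<Sum>k\<le>n. c i * taylor_coeff T K n k * (cell k x * cell (j i) x))
     = (\<lambda>x. g_fun T K n x * (\<Sum>i\<in>A. c i * cell (j i) x))"
    by (rule ext, subst sum.swap) (simp add: g_fun_eq sum_distrib_left sum_distrib_right mult_ac)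
  also have "(\<Sum>i\<in>A. \<Sum>k\<le>n. c i * taylor_coeff T K n k * (if k = j i then 1 else 0)) = (\<Sum>i\<in>A. c i * taylor_coeff T K n (j i))"
  proof (rule sum.cong[OF refl])
    fix i
    have "(\<Sum>k\<le>n. c i * taylor_coeff T K n k * (if k = j i then 1 else 0)) = (\<Sum>k\<le>n. if k = j i then c i * taylor_coeff T K n k else 0)"
      by (rule sum.cong) auto
    then show "(\<Sum>k\<le>n. c i * taylor_coeff T K n k * (if k = j i then 1 else 0)) = c i * taylor_coeff T K n (j i)"
      by (simp add: taylor_coeff_def)
  qed
  finally show "integrable lborel (\<lambda>x. g_fun T K n x * (\<Sum>i\<in>A. c i * cell (j i) x))"
    "l2_inner (g_fun T K n) (\<lambda>x. \<Sum>i\<in>A. c i * cell (j i) x) = (\<Sum>i\<in>A. c i * taylor_coeff T K n (j i))"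
    by (auto simp: has_bochner_integral_iff l2_inner_def)
qed

text \<open>Duhamel's formula; the coefficients turn out to be the Taylor coefficients of the resolvent.\<close>
definition Abar_pow :: "real \<Rightarrow> (nat \<Rightarrow> real) \<Rightarrow> nat \<Rightarrow> real \<Rightarrow> real" where
  "Abar_pow \<beta> \<gamma> m x = (\<Sum>i<Suc m. (if i = m then 1 else - \<beta> * res_coeff \<beta> \<gamma> i) * cell (if i = m then m else m - 1 - i) x)"

text \<open>Splits off the index i = m, which the definition keeps inside a single sum so that
  \<open>l2_inner_g_fun_sum\<close> applies as it stands.\<close>

lemma Abar_pow_eq: "Abar_pow \<beta> \<gamma> m x = cell m x - \<beta> * (\<Sum>i<m. res_coeff \<beta> \<gamma> i * cell (m - 1 - i) x)"
proof -
  have "(\<Sum>i<m. (if i = m then 1 else - \<beta> * res_coeff \<beta> \<gamma> i) * cell (if i = m then m else m - 1 - i) x)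
    = (\<Sum>i<m. - (\<beta> * (res_coeff \<beta> \<gamma> i * cell (m - 1 - i) x)))"
    by (rule sum.cong) auto
  then show ?thesis unfolding Abar_pow_def by (simp add: sum_negf sum_distrib_left)
qed

lemma Abar_pow_measurable[measurable]: "Abar_pow \<beta> \<gamma> m \<in> borel_measurable borel"
  unfolding Abar_pow_eq[abs_def] by measurable

text \<open>Reading off the coefficients reproduces the right-hand side of the recursion of
  \<open>res_coeff\<close>, which is why resolvent coefficients appear in the operator
  powers.\<close>

lemma l2_inner_Abar_pow:
  fixes T :: real and K :: "real \<Rightarrow> real" and n :: nat
  defines "\<gamma> \<equiv> taylor_coeff T K n"
  shows "integrable lborel (\<lambda>x. g_fun T K n x * Abar_pow \<beta> \<gamma> m x)"
    "l2_inner (g_fun T K n) (Abar_pow \<beta> \<gamma> m) = res_coeff \<beta> \<gamma> m"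
proof -
  note * = l2_inner_g_fun_sum[of "{..<Suc m}" T K n "\<lambda>i. if i = m then 1 else - \<beta> * res_coeff \<beta> \<gamma> i" "\<lambda>i. if i = m then m else m - 1 - i"]
  show "integrable lborel (\<lambda>x. g_fun T K n x * Abar_pow \<beta> \<gamma> m x)"
    using *(1) unfolding Abar_pow_def by simp
  have "l2_inner (g_fun T K n) (Abar_pow \<beta> \<gamma> m) =
    (\<Sum>i<Suc m. (if i = m then 1 else - \<beta> * res_coeff \<beta> \<gamma> i) * \<gamma> (if i = m then m else m - 1 - i))"
    using *(2) unfolding Abar_pow_def[abs_def] \<gamma>_def by blast
  also have "(\<Sum>i<m. (if i = m then 1 else - \<beta> * res_coeff \<beta> \<gamma> i) * \<gamma> (if i = m then m else m - 1 - i))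
     = (\<Sum>i<m. - (\<beta> * (res_coeff \<beta> \<gamma> i * \<gamma> (m - 1 - i))))"
    by (rule sum.cong) auto
  then have "(\<Sum>i<Suc m. (if i = m then 1 else - \<beta> * res_coeff \<beta> \<gamma> i) * \<gamma> (if i = m then m else m - 1 - i))
     = res_coeff \<beta> \<gamma> m"
    unfolding res_coeff.simps[of \<beta> \<gamma> m] by (simp add: sum_negf sum_distrib_left)
  finally show "l2_inner (g_fun T K n) (Abar_pow \<beta> \<gamma> m) = res_coeff \<beta> \<gamma> m" .
qed

lemma Abar_pow_Suc:
  "Abar_pow \<beta> \<gamma> (Suc m) x = Abar_pow \<beta> \<gamma> m (x + 1) - \<beta> * res_coeff \<beta> \<gamma> m * nu x"
proof -
  have sh: "cell j (x + 1) = cell (Suc j) x" for j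
    by (auto simp: cell_def indicator_def)
  have "(\<Sum>i<m. res_coeff \<beta> \<gamma> i * cell (m - i) x) = (\<Sum>i<m. res_coeff \<beta> \<gamma> i * cell (Suc (m - 1 - i)) x)"
    by (rule sum.cong) (auto simp: Suc_diff_Suc)
  then show ?thesis
    by (simp add: Abar_pow_eq sh nu_eq_cell distrib_left)
qed

lemma Abar_funpow_nu:
  "(Abar \<beta> T K n ^^ m) nu = Abar_pow \<beta> (taylor_coeff T K n) m"
proof (induction m)
  case 0
  then show ?case by (simp add: Abar_pow_eq nu_eq_cell fun_eq_iff)
next
  case (Suc m)
  show ?case
    unfolding funpow.simps comp_def Suc.IH
    by (rule ext) (simp only: Abar_def shiftA_def l2_inner_Abar_pow(2) Abar_pow_Suc)
qed

text \<open>The shift preserves the L^2 norm, and the rank-one term has size \<beta> |b_m| <=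
  Q^(m+1) with Q = 1 + \<beta> G. The base R = 2 + 2 Q^2 makes the induction close exactly: 2 R^m +
  2 Q^2 R^m = R^(m+1).\<close>

lemma Abar_pow_L2_bound:
  assumes g: "\<And>k. \<bar>\<gamma> k\<bar> \<le> G" and b: "0 < \<beta>"
  shows "(\<integral>\<^sup>+x. ennreal ((Abar_pow \<beta> \<gamma> m x)\<^sup>2) \<partial>lborel) \<le> ennreal ((2 + 2 * (1 + \<beta> * G)\<^sup>2) ^ m)"
proof (induction m)
  case 0
  have "(\<integral>\<^sup>+x. ennreal ((cell 0 x)\<^sup>2) \<partial>lborel) = (\<integral>\<^sup>+x. indicator {0..1::real} x \<partial>lborel)"
    by (intro nn_integral_cong) (auto simp: cell_def indicator_def)
  then show ?case by (simp add: Abar_pow_eq)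
next
  case (Suc m)
  have G: "0 \<le> G" using g[of 0] by linarith
  define Q where "Q = 1 + \<beta> * G"
  define R where "R = 2 + 2 * Q\<^sup>2"
  have Q: "1 \<le> Q" using G b by (simp add: Q_def)
  have QR: "Q\<^sup>2 \<le> R" unfolding R_def using zero_le_power2[of Q] by linarith
  have R0: "0 \<le> R" using zero_le_power2[of Q] by (simp add: R_def)
  have "\<bar>\<beta> * res_coeff \<beta> \<gamma> m\<bar> = \<beta> * \<bar>res_coeff \<beta> \<gamma> m\<bar>" using b by (simp add: abs_mult)
  also have "\<dots> \<le> \<beta> * (G * Q ^ m)"
    unfolding Q_def using b by (intro mult_left_mono res_coeff_bound g) auto
  also have "\<dots> \<le> Q * Q ^ m"
    unfolding mult.assoc[symmetric] using Q by (intro mult_right_mono) (auto simp: Q_def)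
  finally have "\<bar>\<beta> * res_coeff \<beta> \<gamma> m\<bar> \<le> \<bar>Q * Q ^ m\<bar>" by simp
  then have "(\<beta> * res_coeff \<beta> \<gamma> m)\<^sup>2 \<le> (Q * Q ^ m)\<^sup>2" by (simp only: abs_le_square_iff)
  also have "\<dots> = Q\<^sup>2 * (Q\<^sup>2) ^ m" by (simp add: power_mult_distrib flip: power_mult) (simp add: mult.commute)
  also have "\<dots> \<le> Q\<^sup>2 * R ^ m" using QR by (intro mult_left_mono power_mono) auto
  finally have bb: "(\<beta> * res_coeff \<beta> \<gamma> m)\<^sup>2 \<le> Q\<^sup>2 * R ^ m" .
  have "(\<integral>\<^sup>+x. ennreal ((Abar_pow \<beta> \<gamma> (Suc m) x)\<^sup>2) \<partial>lborel)
    \<le> 2 * (\<integral>\<^sup>+x. ennreal ((Abar_pow \<beta> \<gamma> m (x + 1))\<^sup>2) \<partial>lborel)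
     + 2 * (\<integral>\<^sup>+x. ennreal ((- (\<beta> * res_coeff \<beta> \<gamma> m * nu x))\<^sup>2) \<partial>lborel)"
    by (rule nn_integral_square_add_le) (auto simp: Abar_pow_Suc nu_eq_cell)
  also have "(\<integral>\<^sup>+x. ennreal ((Abar_pow \<beta> \<gamma> m (x + 1))\<^sup>2) \<partial>lborel) = (\<integral>\<^sup>+x. ennreal ((Abar_pow \<beta> \<gamma> m x)\<^sup>2) \<partial>lborel)"
    using nn_integral_real_affine[of "\<lambda>x. ennreal ((Abar_pow \<beta> \<gamma> m x)\<^sup>2)" 1 1] by (simp add: add.commute)
  also have "(\<integral>\<^sup>+x. ennreal ((- (\<beta> * res_coeff \<beta> \<gamma> m * nu x))\<^sup>2) \<partial>lborel) = ennreal ((\<beta> * res_coeff \<beta> \<gamma> m)\<^sup>2)"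
  proof -
    have "(\<integral>\<^sup>+x. ennreal ((- (\<beta> * res_coeff \<beta> \<gamma> m * nu x))\<^sup>2) \<partial>lborel) = (\<integral>\<^sup>+x. ennreal ((\<beta> * res_coeff \<beta> \<gamma> m)\<^sup>2) * indicator {0..1::real} x \<partial>lborel)"
      by (intro nn_integral_cong) (auto simp: nu_def indicator_def)
    then show ?thesis by (simp add: nn_integral_cmult)
  qed
  also have "2 * (\<integral>\<^sup>+x. ennreal ((Abar_pow \<beta> \<gamma> m x)\<^sup>2) \<partial>lborel) + 2 * ennreal ((\<beta> * res_coeff \<beta> \<gamma> m)\<^sup>2)
     \<le> 2 * ennreal (R ^ m) + 2 * ennreal (Q\<^sup>2 * R ^ m)"
    using Suc.IH bb unfolding R_def Q_def by (intro add_mono mult_left_mono ennreal_leI) auto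
  also have "\<dots> = ennreal (2 * R ^ m + 2 * (Q\<^sup>2 * R ^ m))"
    using R0 by (simp add: ennreal_mult)
  also have "2 * R ^ m + 2 * (Q\<^sup>2 * R ^ m) = R ^ Suc m" by (simp add: R_def algebra_simps)
  finally show ?case by (simp add: R_def Q_def)
qed

text \<open>Continuity of the inner product, via the weighted inequality |a b| <= (\<eta> a^2 + b^2
  / \<eta>) / 2 in place of Cauchy-Schwarz.\<close>

lemma l2_inner_tendsto:
  fixes g F :: "real \<Rightarrow> real"
  assumes gm[measurable]: "g \<in> borel_measurable borel" and Fm[measurable]: "F \<in> borel_measurable borel"
    and fm[measurable]: "\<And>N. f N \<in> borel_measurable borel"
    and g2: "integrable lborel (\<lambda>x. (g x)\<^sup>2)" and fg: "\<And>N. integrable lborel (\<lambda>x. g x * f N x)"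
    and lim: "(\<lambda>N. \<integral>\<^sup>+x. ennreal ((F x - f N x)\<^sup>2) \<partial>lborel) \<longlonglongrightarrow> 0"
  shows "(\<lambda>N. l2_inner g (f N)) \<longlonglongrightarrow> l2_inner g F"
proof (rule tendstoI)
  fix e :: real assume e: "0 < e"
  define G where "G = (\<integral>x. (g x)\<^sup>2 \<partial>lborel)"
  have G: "0 \<le> G" by (simp add: G_def)
  \<comment> \<open>The first half contributes at most e / 2; with squared distance below \<eta> e /
    2 the second contributes less than e / 4.\<close>
  define \<eta> where "\<eta> = e / (G + 1)"
  have \<eta>: "0 < \<eta>" "\<eta> * G \<le> e" using e G by (auto simp: \<eta>_def field_simps)
  have "0 < ennreal (\<eta> * e / 2)" using e \<eta> by simp
  with lim have "\<forall>\<^sub>F N in sequentially. (\<integral>\<^sup>+x. ennreal ((F x - f N x)\<^sup>2) \<partial>lborel) < ennreal (\<eta> * e / 2)"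
    by (rule order_tendstoD(2))
  then show "\<forall>\<^sub>F N in sequentially. dist (l2_inner g (f N)) (l2_inner g F) < e"
  proof eventually_elim
    fix N assume small: "(\<integral>\<^sup>+x. ennreal ((F x - f N x)\<^sup>2) \<partial>lborel) < ennreal (\<eta> * e / 2)"
    have D2: "integrable lborel (\<lambda>x. (F x - f N x)\<^sup>2)"
      using less_trans[OF small ennreal_less_top] by (intro integrableI_bounded) simp_all
    have Dl: "(\<integral>x. (F x - f N x)\<^sup>2 \<partial>lborel) < \<eta> * e / 2"
      using small unfolding nn_integral_eq_integral[OF D2 AE_I2[OF zero_le_power2]]
      by (subst (asm) ennreal_less_iff) auto
    have pw: "\<bar>g x * (F x - f N x)\<bar> \<le> (\<eta> * (g x)\<^sup>2 + (F x - f N x)\<^sup>2 / \<eta>) / 2" for x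
    proof -
      define p where "p = sqrt \<eta> * \<bar>g x\<bar>"
      define q where "q = \<bar>F x - f N x\<bar> / sqrt \<eta>"
      have "2 * p * q \<le> p\<^sup>2 + q\<^sup>2" by (rule sum_squares_bound)
      moreover have "p * q = \<bar>g x * (F x - f N x)\<bar>" using \<eta>(1) by (simp add: p_def q_def abs_mult)
      moreover have "p\<^sup>2 = \<eta> * (g x)\<^sup>2" "q\<^sup>2 = (F x - f N x)\<^sup>2 / \<eta>"
        using \<eta>(1) by (simp_all add: p_def q_def power_mult_distrib power_divide)
      ultimately show ?thesis by simp
    qed
    have i2: "integrable lborel (\<lambda>x. (\<eta> * (g x)\<^sup>2 + (F x - f N x)\<^sup>2 / \<eta>) / 2)"
      using g2 D2 by simp
    have gD: "integrable lborel (\<lambda>x. g x * (F x - f N x))"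
      by (rule Bochner_Integration.integrable_bound[OF i2]) (use pw in \<open>auto intro: order_trans[OF _ abs_ge_self]\<close>)
    have "l2_inner g F = (\<integral>x. g x * f N x + g x * (F x - f N x) \<partial>lborel)"
      unfolding l2_inner_def by (simp add: algebra_simps)
    also have "\<dots> = l2_inner g (f N) + (\<integral>x. g x * (F x - f N x) \<partial>lborel)"
      unfolding l2_inner_def by (rule Bochner_Integration.integral_add[OF fg gD])
    finally have "dist (l2_inner g (f N)) (l2_inner g F) = \<bar>\<integral>x. g x * (F x - f N x) \<partial>lborel\<bar>"
      by (simp add: dist_real_def)
    also have "\<dots> \<le> (\<integral>x. \<bar>g x * (F x - f N x)\<bar> \<partial>lborel)" by (rule integral_abs_bound)
    also have "\<dots> \<le> (\<integral>x. (\<eta> * (g x)\<^sup>2 + (F x - f N x)\<^sup>2 / \<eta>) / 2 \<partial>lborel)"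
      by (intro integral_mono pw integrable_abs gD i2)
    also have "\<dots> = (\<eta> * G + (\<integral>x. (F x - f N x)\<^sup>2 \<partial>lborel) / \<eta>) / 2"
      using g2 D2 by (simp add: G_def)
    also have "\<dots> < (e + (\<eta> * e / 2) / \<eta>) / 2"
      using \<eta> Dl by (intro divide_strict_right_mono add_le_less_mono divide_strict_right_mono) auto
    also have "\<dots> \<le> e" using \<eta> e by simp
    finally show "dist (l2_inner g (f N)) (l2_inner g F) < e" .
  qed
qed

text \<open>The partial sums converge in L^2, so the choice in \<open>exp_Abar_nu\<close> is some
  L^2 limit; by continuity of the inner product every such limit gives the same series.\<close>

lemma l2_inner_exp_Abar_nu:
  assumes b: "0 < \<beta>" and s: "0 \<le> s"
  shows "l2_inner (g_fun T K n) (exp_Abar_nu \<beta> T K n s) = res_series \<beta> (taylor_coeff T K n) s"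
proof -
  define \<gamma> where "\<gamma> = taylor_coeff T K n"
  define G where "G = (\<Sum>k\<le>n. \<bar>\<gamma> k\<bar>)"
  have g: "\<bar>\<gamma> k\<bar> \<le> G" for k
  proof (cases "k \<le> n")
    case True
    then show ?thesis unfolding G_def by (intro member_le_sum) auto
  next
    case False
    then show ?thesis by (simp add: \<gamma>_def taylor_coeff_def G_def sum_nonneg)
  qed
  define R where "R = 2 + 2 * (1 + \<beta> * G)\<^sup>2"
  have R: "0 < R" unfolding R_def using zero_le_power2[of "1 + \<beta> * G"] by linarith
  define f where "f N x = (\<Sum>m<N. s ^ m / fact m * Abar_pow \<beta> \<gamma> m x)" for N x
  have fm[measurable]: "f N \<in> borel_measurable borel" for N unfolding f_def by measurable
  \<comment> \<open>The factor s + 1 instead of s keeps c positive when s = 0; the square root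
    appears because R^k bounds squared norms.\<close>
  define c where "c k = ((s + 1) * sqrt R) ^ k / fact k" for k
  have c0: "0 < c k" for k using R s by (simp add: c_def)
  have sc: "summable c"
    using summable_exp[of "(s + 1) * sqrt R"] by (simp add: c_def[abs_def] divide_inverse mult.commute)
  have step: "(\<integral>\<^sup>+x. ennreal ((f (Suc k) x - f k x)\<^sup>2) \<partial>lborel) \<le> ennreal ((c k)\<^sup>2)" for k
  proof -
    have "(\<integral>\<^sup>+x. ennreal ((f (Suc k) x - f k x)\<^sup>2) \<partial>lborel)
       = (\<integral>\<^sup>+x. ennreal ((s ^ k / fact k)\<^sup>2) * ennreal ((Abar_pow \<beta> \<gamma> k x)\<^sup>2) \<partial>lborel)"
      by (intro nn_integral_cong) (simp add: f_def power_mult_distrib power_divide flip: ennreal_mult)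
    also have "\<dots> = ennreal ((s ^ k / fact k)\<^sup>2) * (\<integral>\<^sup>+x. ennreal ((Abar_pow \<beta> \<gamma> k x)\<^sup>2) \<partial>lborel)"
      by (rule nn_integral_cmult) measurable
    also have "\<dots> \<le> ennreal ((s ^ k / fact k)\<^sup>2) * ennreal (R ^ k)"
      unfolding R_def by (intro mult_left_mono Abar_pow_L2_bound g b) auto
    also have "\<dots> = ennreal ((s ^ k / fact k)\<^sup>2 * R ^ k)" using R by (simp add: ennreal_mult)
    also have "\<dots> \<le> ennreal (((s + 1) ^ k / fact k)\<^sup>2 * R ^ k)"
      using s R by (intro ennreal_leI mult_right_mono power_mono divide_right_mono) auto
    also have "((s + 1) ^ k / fact k)\<^sup>2 * R ^ k = (c k)\<^sup>2"
    proof -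
      have "R ^ k = (sqrt R ^ k)\<^sup>2" using R by (simp flip: power_mult add: mult.commute[of k])  (simp add: power_mult)
      then show ?thesis by (simp add: c_def power_mult_distrib power_divide)
    qed
    finally show ?thesis .
  qed
  have "(\<lambda>N. \<integral>\<^sup>+x. ennreal ((lim (\<lambda>k. f k x) - f N x)\<^sup>2) \<partial>lborel) \<longlonglongrightarrow> 0"
    by (rule tendsto_sandwich[OF _ _ tendsto_const suminf_tail_square_tendsto_0[OF sc]])
       (auto intro!: always_eventually L2_telescope_convergence c0 sc step)
  then have "\<exists>F. F \<in> borel_measurable lborel \<and> (\<lambda>N. \<integral>\<^sup>+x. ennreal ((F x - f N x)\<^sup>2) \<partial>lborel) \<longlonglongrightarrow> 0"
    by (intro exI[of _ "\<lambda>x. lim (\<lambda>k. f k x)"] conjI) measurable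
  from someI_ex[OF this]
  have F: "exp_Abar_nu \<beta> T K n s \<in> borel_measurable lborel \<and>
    (\<lambda>N. \<integral>\<^sup>+x. ennreal ((exp_Abar_nu \<beta> T K n s x - f N x)\<^sup>2) \<partial>lborel) \<longlonglongrightarrow> 0"
    unfolding exp_Abar_nu_def Abar_funpow_nu f_def \<gamma>_def .
  have gm: "g_fun T K n \<in> borel_measurable borel" unfolding g_fun_eq[abs_def] by measurable
  have g2: "integrable lborel (\<lambda>x. (g_fun T K n x)\<^sup>2)"
    using l2_inner_g_fun_sum(1)[of "{..n}" T K n "taylor_coeff T K n" "\<lambda>i. i"]
    by (simp add: g_fun_eq[symmetric] power2_eq_square)
  have hb: "has_bochner_integral lborel (\<lambda>x. g_fun T K n x * f N x) (\<Sum>m<N. s ^ m / fact m * res_coeff \<beta> \<gamma> m)" for N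
  proof -
    have "has_bochner_integral lborel (\<lambda>x. \<Sum>m<N. s ^ m / fact m * (g_fun T K n x * Abar_pow \<beta> \<gamma> m x))
       (\<Sum>m<N. s ^ m / fact m * res_coeff \<beta> \<gamma> m)"
      using l2_inner_Abar_pow[of T K n \<beta>] unfolding \<gamma>_def l2_inner_def
      by (intro has_bochner_integral_sum has_bochner_integral_mult_right) (simp add: has_bochner_integral_iff)
    then show ?thesis by (simp add: f_def sum_distrib_left mult_ac)
  qed
  have "(\<lambda>N. l2_inner (g_fun T K n) (f N)) \<longlonglongrightarrow> l2_inner (g_fun T K n) (exp_Abar_nu \<beta> T K n s)"
    by (rule l2_inner_tendsto[OF gm _ fm g2]) (use F hb in \<open>auto simp: has_bochner_integral_iff\<close>)
  moreover have "l2_inner (g_fun T K n) (f N) = (\<Sum>m<N. res_coeff \<beta> \<gamma> m * (s ^ m / fact m))" for N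
    using hb[of N] unfolding l2_inner_def has_bochner_integral_iff by (simp add: mult_ac)
  ultimately have "(\<lambda>m. res_coeff \<beta> \<gamma> m * (s ^ m / fact m)) sums l2_inner (g_fun T K n) (exp_Abar_nu \<beta> T K n s)"
    by (simp add: sums_def)
  then show ?thesis unfolding res_series_def \<gamma>_def by (rule sums_unique)
qed

lemma hat_u_eq:
  assumes "0 < \<beta>" "t \<le> T"
  shows "hat_u \<alpha> \<beta> a1 a2 T K n t = \<alpha> * a2 / (2 * a1) * res_series \<beta> (taylor_coeff T K n) (T - t)"
  using assms by (simp add: hat_u_def l2_inner_exp_Abar_nu)

section \<open>Bounded kernels and integrable functions\<close>

text \<open>Paths of processes are only integrable, so the convolution algebra is redone with
  bounded measurable kernels and integrable f.\<close>

lemma vconv_kernel_integrable: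
  fixes k f :: "real \<Rightarrow> real"
  assumes [measurable]: "k \<in> borel_measurable borel" and k: "\<And>x. \<bar>k x\<bar> \<le> B"
    and f: "set_integrable lborel {0..T} f" and t: "t \<in> {0..T}"
  shows "set_integrable lborel {0..t} (\<lambda>s. k (t - s) * f s)"
proof -
  have "set_integrable lborel {0..t} f" by (rule set_integrable_subset[OF f]) (use t in auto)
  then have i: "integrable lborel (\<lambda>s. B * (indicator {0..t} s *\<^sub>R f s))"
    unfolding set_integrable_def by (rule integrable_mult_right)
  have [measurable]: "(\<lambda>s. indicator {0..t} s *\<^sub>R f s) \<in> borel_measurable borel"
    using \<open>set_integrable lborel {0..t} f\<close> unfolding set_integrable_def by auto
  have "integrable lborel (\<lambda>s. k (t - s) * (indicator {0..t} s *\<^sub>R f s))"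
  proof (rule Bochner_Integration.integrable_bound[OF i])
    have "\<bar>k (t - s)\<bar> * \<bar>indicator {0..t} s *\<^sub>R f s\<bar> \<le> \<bar>B\<bar> * \<bar>indicator {0..t} s *\<^sub>R f s\<bar>" for s
      by (intro mult_right_mono order_trans[OF k abs_ge_self]) auto
    then show "AE s in lborel. norm (k (t - s) * (indicator {0..t} s *\<^sub>R f s)) \<le> norm (B * (indicator {0..t} s *\<^sub>R f s))"
      by (simp add: abs_mult)
  qed measurable
  then show ?thesis by (simp add: set_integrable_def mult_ac)
qed

lemma vconv_linear_right:
  fixes k f :: "real \<Rightarrow> real"
  assumes k: "k \<in> borel_measurable borel" "\<And>x. \<bar>k x\<bar> \<le> B"
    and f: "set_integrable lborel {0..T} f" and g: "set_integrable lborel {0..T} g" and t: "t \<in> {0..T}"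
  shows "vconv k (\<lambda>s. a * f s + b * g s) t = a * vconv k f t + b * vconv k g t"
proof -
  have "vconv k (\<lambda>s. a * f s + b * g s) t = (LINT s:{0..t}|lborel. a * (k (t - s) * f s) + b * (k (t - s) * g s))"
    by (simp add: vconv_def algebra_simps)
  also have "\<dots> = a * vconv k f t + b * vconv k g t"
    unfolding vconv_def
    by (subst set_integral_add(2)) (auto intro!: vconv_kernel_integrable[OF k _ t] f g)
  finally show ?thesis .
qed

lemma vconv_linear_left:
  fixes k l f :: "real \<Rightarrow> real"
  assumes k: "k \<in> borel_measurable borel" "\<And>x. \<bar>k x\<bar> \<le> B"
    and l: "l \<in> borel_measurable borel" "\<And>x. \<bar>l x\<bar> \<le> C"
    and f: "set_integrable lborel {0..T} f" and t: "t \<in> {0..T}"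
  shows "vconv (\<lambda>x. a * k x + b * l x) f t = a * vconv k f t + b * vconv l f t"
proof -
  have "vconv (\<lambda>x. a * k x + b * l x) f t = (LINT s:{0..t}|lborel. a * (k (t - s) * f s) + b * (l (t - s) * f s))"
    by (simp add: vconv_def algebra_simps)
  also have "\<dots> = a * vconv k f t + b * vconv l f t"
    unfolding vconv_def
    by (subst set_integral_add(2)) (auto intro!: vconv_kernel_integrable[OF k _ t] vconv_kernel_integrable[OF l _ t] f)
  finally show ?thesis .
qed

text \<open>Fubini on the triangle 0 <= v <= s <= t, followed by the translation s = v + w. The
  integrand is dominated by B C |f(v)|, which is integrable over the bounded region.\<close>

lemma vconv_assoc:
  fixes k l f :: "real \<Rightarrow> real"
  assumes km[measurable]: "k \<in> borel_measurable borel" and k: "\<And>x. \<bar>k x\<bar> \<le> B"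
    and lm[measurable]: "l \<in> borel_measurable borel" and l: "\<And>x. \<bar>l x\<bar> \<le> C"
    and f: "set_integrable lborel {0..T} f" and t: "t \<in> {0..T}"
  shows "vconv k (vconv l f) t = vconv (vconv k l) f t"
proof -
  define f' where "f' v = indicator {0..T} v * f v" for v
  have fi: "integrable lborel f'" using f by (simp add: set_integrable_def f'_def[abs_def])
  then have [measurable]: "f' \<in> borel_measurable borel" by auto
  define F where "F s v = (if 0 \<le> v \<and> v \<le> s \<and> s \<le> t then k (t - s) * l (s - v) * f' v else 0)" for s v
  have Fm: "(\<lambda>(s, v). F s v) \<in> borel_measurable (lborel \<Otimes>\<^sub>M lborel)"
    unfolding F_def by measurable
  have B0: "0 \<le> B" "0 \<le> C" using order_trans[OF abs_ge_zero k[of 0]] order_trans[OF abs_ge_zero l[of 0]] by auto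
  have "integrable (lborel \<Otimes>\<^sub>M lborel) (\<lambda>(s, v). B * C * (indicator {0..t} s * \<bar>f' v\<bar>))"
  proof (rule lborel_pair.Fubini_integrable)
    show "(\<lambda>(s, v). B * C * (indicator {0..t} s * \<bar>f' v\<bar>)) \<in> borel_measurable (lborel \<Otimes>\<^sub>M lborel)"
      by measurable
    have "(\<lambda>s. \<integral>v. norm (case (s, v) of (s, v) \<Rightarrow> B * C * (indicator {0..t} s * \<bar>f' v\<bar>)) \<partial>lborel)
       = (\<lambda>s. indicator {0..t} s * (B * C * (\<integral>v. \<bar>f' v\<bar> \<partial>lborel)))"
      using B0 by (auto simp: abs_mult fun_eq_iff)
    then show "integrable lborel (\<lambda>s. \<integral>v. norm (case (s, v) of (s, v) \<Rightarrow> B * C * (indicator {0..t} s * \<bar>f' v\<bar>)) \<partial>lborel)"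
      by (auto intro!: integrable_mult_left integrable_real_indicator simp: emeasure_lborel_Icc_eq)
    show "AE s in lborel. integrable lborel (\<lambda>v. case (s, v) of (s, v) \<Rightarrow> B * C * (indicator {0..t} s * \<bar>f' v\<bar>))"
      using fi by (auto intro!: integrable_mult_right)
  qed
  then have Fi: "integrable (lborel \<Otimes>\<^sub>M lborel) (case_prod F)"
  proof (rule Bochner_Integration.integrable_bound)
    have "\<bar>F s v\<bar> \<le> \<bar>B * C * (indicator {0..t} s * \<bar>f' v\<bar>)\<bar>" for s v
    proof (cases "0 \<le> v \<and> v \<le> s \<and> s \<le> t")
      case True
      have "\<bar>k (t - s)\<bar> * \<bar>l (s - v)\<bar> * \<bar>f' v\<bar> \<le> B * C * \<bar>f' v\<bar>"
        by (intro mult_right_mono mult_mono k l B0) auto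
      then show ?thesis using True B0 by (simp add: F_def abs_mult)
    qed (auto simp: F_def)
    then show "AE x in lborel \<Otimes>\<^sub>M lborel. norm (case x of (s, v) \<Rightarrow> F s v) \<le> norm (case x of (s, v) \<Rightarrow> B * C * (indicator {0..t} s * \<bar>f' v\<bar>))"
      by auto
  qed (use Fm in simp)
  have "vconv k (vconv l f) t = (\<integral>s. (\<integral>v. F s v \<partial>lborel) \<partial>lborel)"
    unfolding vconv_def set_lebesgue_integral_def
  proof (rule Bochner_Integration.integral_cong[OF refl])
    fix s
    show "indicator {0..t} s *\<^sub>R (k (t - s) * (\<integral>v. indicator {0..s} v *\<^sub>R (l (s - v) * f v) \<partial>lborel)) = (\<integral>v. F s v \<partial>lborel)"
    proof (cases "s \<in> {0..t}")
      case True
      have "(\<integral>v. F s v \<partial>lborel) = (\<integral>v. k (t - s) * (indicator {0..s} v *\<^sub>R (l (s - v) * f v)) \<partial>lborel)"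
        by (rule Bochner_Integration.integral_cong) (use True t in \<open>auto simp: F_def f'_def indicator_def\<close>)
      then show ?thesis using True by simp
    next
      case False
      then have "F s v = 0" for v by (auto simp: F_def)
      then show ?thesis using False by simp
    qed
  qed
  also have "\<dots> = (\<integral>v. (\<integral>s. F s v \<partial>lborel) \<partial>lborel)"
    by (rule lborel_pair.Fubini_integral[OF Fi, symmetric])
  also have "\<dots> = vconv (vconv k l) f t"
    unfolding vconv_def set_lebesgue_integral_def
  proof (rule Bochner_Integration.integral_cong[OF refl])
    fix v
    show "(\<integral>s. F s v \<partial>lborel) = indicator {0..t} v *\<^sub>R ((\<integral>w. indicator {0..t - v} w *\<^sub>R (k (t - v - w) * l w) \<partial>lborel) * f v)"
    proof (cases "v \<in> {0..t}")
      case True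
      have "(\<integral>s. F s v \<partial>lborel) = (\<integral>w. F (v + 1 * w) v \<partial>lborel)"
        using lborel_integral_real_affine[of 1 "\<lambda>s. F s v" v] by simp
      also have "\<dots> = (\<integral>w. indicator {0..t - v} w *\<^sub>R (k (t - v - w) * l w) * f v \<partial>lborel)"
        by (rule Bochner_Integration.integral_cong)
           (use True t in \<open>auto simp: F_def f'_def indicator_def diff_diff_eq\<close>)
      finally show ?thesis using True by simp
    next
      case False
      then have "F s v = 0" for s by (auto simp: F_def)
      then show ?thesis using False by simp
    qed
  qed
  finally show ?thesis .
qed

section \<open>Square-integrable processes\<close>

locale brownian_horizon = brownian +
  fixes T :: real
  assumes T_pos: "0 < T"
begin

abbreviation L :: "real measure" where "L \<equiv> restrict_space lborel {0..T}"

sublocale L: finite_measure L by (rule finite_measure_Icc)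
sublocale LM: pair_sigma_finite L M ..

lemma space_L: "space L = {0..T}" by (simp add: space_restrict_space)

lemma finite_measure_PM: "finite_measure (PM T M)"
  unfolding PM_def by (intro finite_measure_pair_measure L.finite_measure_axioms finite_measure_axioms)

lemma integrable_L_iff: "integrable L f \<longleftrightarrow> set_integrable lborel {0..T} f" for f :: "real \<Rightarrow> real"
  by (simp add: integrable_restrict_space set_integrable_def)

lemma vconv_L:
  assumes "t \<in> {0..T}"
  shows "vconv k f t = (\<integral>s. indicator {0..t} s * (k (t - s) * f s) \<partial>L)"
  unfolding vconv_def set_lebesgue_integral_def
  by (subst integral_restrict_space)
     (use assms in \<open>auto simp: indicator_def intro!: Bochner_Integration.integral_cong\<close>)

text \<open>The clauses that \<open>L2a\<close> and \<open>sve_sol\<close> have in common, so that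
  controls and states are treated alike.\<close>

definition proc2 :: "(real \<Rightarrow> 'a \<Rightarrow> real) \<Rightarrow> bool" where
  "proc2 f \<longleftrightarrow> (\<lambda>(t, \<omega>). f t \<omega>) \<in> borel_measurable (PM T M) \<and> integrable (PM T M) (\<lambda>(t, \<omega>). (f t \<omega>)\<^sup>2)"

lemma proc2_measurable: "proc2 f \<Longrightarrow> (\<lambda>(t, \<omega>). f t \<omega>) \<in> borel_measurable (L \<Otimes>\<^sub>M M)"
  by (simp add: proc2_def PM_def)

lemma proc2_iff_nn_integral:
  "proc2 f \<longleftrightarrow> (\<lambda>(t, \<omega>). f t \<omega>) \<in> borel_measurable (PM T M) \<and> (\<integral>\<^sup>+(t, \<omega>). ennreal ((f t \<omega>)\<^sup>2) \<partial>PM T M) < \<infinity>"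
proof (cases "(\<lambda>(t, \<omega>). f t \<omega>) \<in> borel_measurable (PM T M)")
  case True
  have "(\<lambda>x. (case x of (t, \<omega>) \<Rightarrow> f t \<omega>)\<^sup>2) \<in> borel_measurable (PM T M)" using True by measurable
  then have "(\<lambda>(t, \<omega>). (f t \<omega>)\<^sup>2) \<in> borel_measurable (PM T M)" by (simp add: case_prod_beta')
  then show ?thesis
    unfolding proc2_def integrable_iff_bounded by (simp add: case_prod_beta')
qed (simp add: proc2_def)

lemma proc2_integrable:
  assumes "proc2 f"
  shows "integrable (L \<Otimes>\<^sub>M M) (\<lambda>(t, \<omega>). f t \<omega>)"
proof -
  have "integrable (PM T M) (\<lambda>x. (case x of (t, \<omega>) \<Rightarrow> f t \<omega>)\<^sup>2)"
    using assms unfolding proc2_def by (simp add: case_prod_beta')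
  then have "integrable (PM T M) (\<lambda>(t, \<omega>). f t \<omega>)"
    by (rule finite_measure.square_integrable_imp_integrable[OF finite_measure_PM, rotated])
       (use assms in \<open>simp add: proc2_def\<close>)
  then show ?thesis unfolding PM_def .
qed

lemma proc2_AE:
  assumes "proc2 f"
  shows "AE \<omega> in M. set_integrable lborel {0..T} (\<lambda>s. f s \<omega>)"
  using LM.AE_integrable_snd[OF proc2_integrable[OF assms]] unfolding integrable_L_iff .

lemma proc2_linear:
  assumes f: "proc2 f" and g: "proc2 g"
  shows "proc2 (\<lambda>t \<omega>. a * f t \<omega> + b * g t \<omega>)"
  unfolding proc2_iff_nn_integral
proof
  let ?f = "\<lambda>(t, \<omega>). f t \<omega>" and ?g = "\<lambda>(t, \<omega>). g t \<omega>"
  have [measurable]: "?f \<in> borel_measurable (PM T M)" "?g \<in> borel_measurable (PM T M)"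
    using f g by (auto simp: proc2_def)
  have "(\<lambda>x. a * ?f x + b * ?g x) \<in> borel_measurable (PM T M)" by measurable
  then show "(\<lambda>(t, \<omega>). a * f t \<omega> + b * g t \<omega>) \<in> borel_measurable (PM T M)" by (simp add: case_prod_beta')
  have sc: "(\<integral>\<^sup>+x. ennreal ((c * h x)\<^sup>2) \<partial>PM T M) < \<infinity>"
    if "(\<integral>\<^sup>+x. ennreal ((h x)\<^sup>2) \<partial>PM T M) < \<infinity>" and [measurable]: "h \<in> borel_measurable (PM T M)"
    for c :: real and h
    using that by (simp add: power_mult_distrib ennreal_mult nn_integral_cmult ennreal_mult_less_top)
  have "(\<integral>\<^sup>+x. ennreal ((case x of (t, \<omega>) \<Rightarrow> a * f t \<omega> + b * g t \<omega>)\<^sup>2) \<partial>PM T M) < \<infinity>"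
  proof (rule nn_integral_square_add_less_top)
    show "(\<integral>\<^sup>+x. ennreal ((a * ?f x)\<^sup>2) \<partial>PM T M) < \<infinity>" "(\<integral>\<^sup>+x. ennreal ((b * ?g x)\<^sup>2) \<partial>PM T M) < \<infinity>"
      using f g by (auto intro!: sc simp: proc2_iff_nn_integral case_prod_beta' simp del: infinity_ennreal_def)
    show "(\<lambda>x. a * ?f x) \<in> borel_measurable (PM T M)" "(\<lambda>x. b * ?g x) \<in> borel_measurable (PM T M)"
      by measurable
  qed (simp add: case_prod_beta')
  then show "(\<integral>\<^sup>+(t, \<omega>). ennreal ((a * f t \<omega> + b * g t \<omega>)\<^sup>2) \<partial>PM T M) < \<infinity>"
    by (simp add: case_prod_beta')
qed

lemma proc2_deterministic:
  assumes c: "continuous_on {0..T} c"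
  shows "proc2 (\<lambda>t \<omega>. c t)"
proof -
  obtain B where B: "\<And>x. x \<in> {0..T} \<Longrightarrow> \<bar>c x\<bar> \<le> B" using continuous_on_Icc_bounded[OF c] by blast
  have [measurable]: "c \<in> borel_measurable L"
  proof -
    have "sets L = sets (restrict_space borel {0..T})" by (rule sets_restrict_space_cong) simp
    then show ?thesis
      using borel_measurable_continuous_on_restrict[OF c] measurable_cong_sets[OF _ refl] by blast
  qed
  have m: "(\<lambda>(t, \<omega>). c t) \<in> borel_measurable (PM T M)" unfolding PM_def by measurable
  have "integrable (PM T M) (\<lambda>(t, \<omega>). (c t)\<^sup>2)"
  proof (rule finite_measure.integrable_const_bound[OF finite_measure_PM])
    show "(\<lambda>(t, \<omega>). (c t)\<^sup>2) \<in> borel_measurable (PM T M)" unfolding PM_def by measurable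
    show "AE x in PM T M. norm (case x of (t, \<omega>) \<Rightarrow> (c t)\<^sup>2) \<le> B\<^sup>2"
    proof (rule AE_I2)
      fix x assume "x \<in> space (PM T M)"
      then have "\<bar>c (fst x)\<bar> \<le> B" by (intro B) (auto simp: PM_def space_pair_measure space_L)
      then show "norm (case x of (t, \<omega>) \<Rightarrow> (c t)\<^sup>2) \<le> B\<^sup>2"
        using power_mono[of "\<bar>c (fst x)\<bar>" B 2] by (simp add: case_prod_beta')
    qed
  qed
  with m show ?thesis by (simp add: proc2_def)
qed

lemma proc2_mean:
  assumes "proc2 f"
  shows "set_integrable lborel {0..T} (\<lambda>s. \<integral>\<omega>. f s \<omega> \<partial>M)"
  using LM.integrable_fst[OF proc2_integrable[OF assms]] by (simp add: integrable_L_iff)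

text \<open>Fubini on [0, T] times the probability space: with a bounded kernel the integrand is
  dominated by a multiple of |f|.\<close>

lemma proc2_vconv_mean:
  assumes f: "proc2 f" and km[measurable]: "k \<in> borel_measurable borel" and k: "\<And>x. \<bar>k x\<bar> \<le> B" and t: "t \<in> {0..T}"
  shows "integrable M (\<lambda>\<omega>. vconv k (\<lambda>s. f s \<omega>) t)"
    "(\<integral>\<omega>. vconv k (\<lambda>s. f s \<omega>) t \<partial>M) = vconv k (\<lambda>s. \<integral>\<omega>. f s \<omega> \<partial>M) t"
proof -
  have [measurable]: "(\<lambda>x. x) \<in> measurable L borel" by (intro measurable_restrict_space1) simp
  have fm[measurable]: "(\<lambda>x. f (fst x) (snd x)) \<in> borel_measurable (L \<Otimes>\<^sub>M M)"
    using proc2_measurable[OF f] by (simp add: case_prod_beta')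
  have gm: "(\<lambda>s. indicator {0..t} s * k (t - s)) \<in> borel_measurable L"
    by measurable
  have i: "integrable (L \<Otimes>\<^sub>M M) (\<lambda>(s, \<omega>). indicator {0..t} s * (k (t - s) * f s \<omega>))"
  proof (rule Bochner_Integration.integrable_bound[OF integrable_mult_right[OF proc2_integrable[OF f], of B]])
    have "(\<lambda>x. (indicator {0..t} (fst x) * k (t - fst x)) * f (fst x) (snd x)) \<in> borel_measurable (L \<Otimes>\<^sub>M M)"
      by (intro borel_measurable_times measurable_compose[OF measurable_fst gm] fm)
    then show "(\<lambda>(s, \<omega>). indicator {0..t} s * (k (t - s) * f s \<omega>)) \<in> borel_measurable (L \<Otimes>\<^sub>M M)"
      by (simp add: case_prod_beta' mult.assoc)
    have "\<bar>indicator {0..t} s * (k (t - s) * f s \<omega>)\<bar> \<le> \<bar>B * f s \<omega>\<bar>" for s \<omega>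
    proof -
      have "\<bar>k (t - s)\<bar> * \<bar>f s \<omega>\<bar> \<le> \<bar>B\<bar> * \<bar>f s \<omega>\<bar>"
        by (intro mult_right_mono order_trans[OF k abs_ge_self]) auto
      then show ?thesis by (auto simp: abs_mult indicator_def)
    qed
    then show "AE x in L \<Otimes>\<^sub>M M. norm (case x of (s, \<omega>) \<Rightarrow> indicator {0..t} s * (k (t - s) * f s \<omega>))
        \<le> norm (B * (case x of (s, \<omega>) \<Rightarrow> f s \<omega>))"
      by (auto simp: case_prod_beta')
  qed
  show "integrable M (\<lambda>\<omega>. vconv k (\<lambda>s. f s \<omega>) t)"
    using LM.integrable_snd[OF i] by (simp add: vconv_L[OF t])
  show "(\<integral>\<omega>. vconv k (\<lambda>s. f s \<omega>) t \<partial>M) = vconv k (\<lambda>s. \<integral>\<omega>. f s \<omega> \<partial>M) t"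
    using LM.Fubini_integral[OF i] by (simp add: vconv_L[OF t])
qed

text \<open>Pathwise Cauchy-Schwarz bounds the squared convolution at each t by B^2 T times the
  integral of the squared path, a bound free of t that can be integrated again.\<close>

lemma proc2_vconv:
  assumes f: "proc2 f" and km[measurable]: "k \<in> borel_measurable borel" and k: "\<And>x. \<bar>k x\<bar> \<le> B"
  shows "proc2 (\<lambda>t \<omega>. vconv k (\<lambda>s. f s \<omega>) t)"
proof -
  have fm[measurable]: "(\<lambda>x. f (fst x) (snd x)) \<in> borel_measurable (L \<Otimes>\<^sub>M M)"
    using proc2_measurable[OF f] by (simp add: case_prod_beta')
  have im[measurable]: "(\<lambda>x. x) \<in> measurable L borel" by (intro measurable_restrict_space1) simp
  have fsm[measurable]: "(\<lambda>s. f s \<omega>) \<in> borel_measurable L" if "\<omega> \<in> space M" for \<omega>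
    using measurable_compose[OF measurable_Pair2'[OF that] fm] by simp
  have B0: "0 \<le> B" using order_trans[OF abs_ge_zero k[of 0]] .
  let ?V = "\<lambda>(t, \<omega>). vconv k (\<lambda>s. f s \<omega>) t"
  have Vm: "?V \<in> borel_measurable (L \<Otimes>\<^sub>M M)"
  proof -
    have t1[measurable]: "(\<lambda>x. fst (fst x)) \<in> borel_measurable ((L \<Otimes>\<^sub>M M) \<Otimes>\<^sub>M L)"
      by (rule measurable_compose[OF _ im]) measurable
    have t2[measurable]: "(\<lambda>x. snd x) \<in> borel_measurable ((L \<Otimes>\<^sub>M M) \<Otimes>\<^sub>M L)"
      by (rule measurable_compose[OF _ im]) measurable
    have "(\<lambda>x. (snd x, snd (fst x))) \<in> measurable ((L \<Otimes>\<^sub>M M) \<Otimes>\<^sub>M L) (L \<Otimes>\<^sub>M M)" by measurable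
    from measurable_compose[OF this fm]
    have t3[measurable]: "(\<lambda>x. f (snd x) (snd (fst x))) \<in> borel_measurable ((L \<Otimes>\<^sub>M M) \<Otimes>\<^sub>M L)" by simp
    have "(\<lambda>x. if 0 \<le> snd x \<and> snd x \<le> fst (fst x) then k (fst (fst x) - snd x) * f (snd x) (snd (fst x)) else 0)
       \<in> borel_measurable ((L \<Otimes>\<^sub>M M) \<Otimes>\<^sub>M L)" by measurable
    then have "(\<lambda>(y, s). if 0 \<le> s \<and> s \<le> fst y then k (fst y - s) * f s (snd y) else 0)
       \<in> borel_measurable ((L \<Otimes>\<^sub>M M) \<Otimes>\<^sub>M L)" by (simp add: case_prod_beta')
    from L.borel_measurable_lebesgue_integral[OF this]
    have "(\<lambda>y. \<integral>s. (if 0 \<le> s \<and> s \<le> fst y then k (fst y - s) * f s (snd y) else 0) \<partial>L) \<in> borel_measurable (L \<Otimes>\<^sub>M M)" .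
    also have "?this \<longleftrightarrow> ?thesis"
      by (rule measurable_cong)
         (auto simp: space_pair_measure space_L vconv_L indicator_def intro!: Bochner_Integration.integral_cong)
    finally show ?thesis .
  qed
  have pt: "ennreal ((vconv k (\<lambda>s. f s \<omega>) t)\<^sup>2) \<le> ennreal (B\<^sup>2 * T) * (\<integral>\<^sup>+s. ennreal ((f s \<omega>)\<^sup>2) \<partial>L)"
    if t: "t \<in> {0..T}" and \<omega>: "\<omega> \<in> space M" for t \<omega>
  proof -
    let ?h = "\<lambda>s. indicator {0..t} s * (k (t - s) * f s \<omega>)"
    have [measurable]: "(\<lambda>s. f s \<omega>) \<in> borel_measurable L" by (rule fsm[OF \<omega>])
    have "ennreal \<bar>vconv k (\<lambda>s. f s \<omega>) t\<bar> \<le> (\<integral>\<^sup>+s. ennreal (norm (?h s)) \<partial>L)"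
      unfolding vconv_L[OF t]
    \<comment> \<open>If the path is not integrable, the Bochner integral is zero and the bound is
      trivial; so it holds for every outcome.\<close>
    proof (cases "integrable L ?h")
      case True
      from integral_norm_bound_ennreal[OF this]
      show "ennreal \<bar>\<integral>s. ?h s \<partial>L\<bar> \<le> (\<integral>\<^sup>+s. ennreal (norm (?h s)) \<partial>L)" by simp
    qed (simp add: not_integrable_integral_eq)
    also have "\<dots> \<le> (\<integral>\<^sup>+s. ennreal (B * \<bar>f s \<omega>\<bar>) * 1 \<partial>L)"
    proof (intro nn_integral_mono)
      fix s
      have "\<bar>k (t - s)\<bar> * \<bar>f s \<omega>\<bar> \<le> B * \<bar>f s \<omega>\<bar>" by (intro mult_right_mono k) auto
      then have "norm (?h s) \<le> B * \<bar>f s \<omega>\<bar>" using B0 by (auto simp: abs_mult indicator_def)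
      then show "ennreal (norm (?h s)) \<le> ennreal (B * \<bar>f s \<omega>\<bar>) * 1" by (simp add: ennreal_leI)
    qed
    finally have "(ennreal \<bar>vconv k (\<lambda>s. f s \<omega>) t\<bar>)\<^sup>2 \<le> (\<integral>\<^sup>+s. ennreal (B * \<bar>f s \<omega>\<bar>) * 1 \<partial>L)\<^sup>2"
      by (rule power_mono) simp
    also have "\<dots> \<le> (\<integral>\<^sup>+s. (ennreal (B * \<bar>f s \<omega>\<bar>))\<^sup>2 \<partial>L) * (\<integral>\<^sup>+s. 1\<^sup>2 \<partial>L)"
      by (rule Cauchy_Schwarz_nn_integral) measurable
    also have "(\<integral>\<^sup>+s. 1\<^sup>2 \<partial>L) = ennreal T"
      using T_pos by (simp add: emeasure_restrict_space space_L)
    also have "(\<integral>\<^sup>+s. (ennreal (B * \<bar>f s \<omega>\<bar>))\<^sup>2 \<partial>L) = (\<integral>\<^sup>+s. ennreal (B\<^sup>2) * ennreal ((f s \<omega>)\<^sup>2) \<partial>L)"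
      using B0 by (intro nn_integral_cong) (simp add: ennreal_power power_mult_distrib flip: ennreal_mult)
    also have "\<dots> = ennreal (B\<^sup>2) * (\<integral>\<^sup>+s. ennreal ((f s \<omega>)\<^sup>2) \<partial>L)"
      by (rule nn_integral_cmult) measurable
    finally show ?thesis
      using T_pos by (simp add: ennreal_power ennreal_mult mult_ac)
  qed
  have f2: "(\<integral>\<^sup>+\<omega>. \<integral>\<^sup>+s. ennreal ((f s \<omega>)\<^sup>2) \<partial>L \<partial>M) < \<infinity>"
  proof -
    have "(\<integral>\<^sup>+\<omega>. \<integral>\<^sup>+s. (\<lambda>x. ennreal ((f (fst x) (snd x))\<^sup>2)) (s, \<omega>) \<partial>L \<partial>M) = (\<integral>\<^sup>+x. ennreal ((f (fst x) (snd x))\<^sup>2) \<partial>(L \<Otimes>\<^sub>M M))"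
      by (rule LM.nn_integral_snd) measurable
    also have "\<dots> < \<infinity>" using f by (simp add: proc2_iff_nn_integral PM_def case_prod_beta')
    finally show ?thesis by simp
  qed
  have "(\<integral>\<^sup>+x. ennreal ((?V x)\<^sup>2) \<partial>(L \<Otimes>\<^sub>M M)) = (\<integral>\<^sup>+t. \<integral>\<^sup>+\<omega>. ennreal ((vconv k (\<lambda>s. f s \<omega>) t)\<^sup>2) \<partial>M \<partial>L)"
    using Vm by (subst nn_integral_fst[symmetric]) simp_all
  also have "\<dots> \<le> (\<integral>\<^sup>+t. \<integral>\<^sup>+\<omega>. ennreal (B\<^sup>2 * T) * (\<integral>\<^sup>+s. ennreal ((f s \<omega>)\<^sup>2) \<partial>L) \<partial>M \<partial>L)"
    by (intro nn_integral_mono pt) (simp_all add: space_L)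
  also have "\<dots> = (\<integral>\<^sup>+\<omega>. ennreal (B\<^sup>2 * T) * (\<integral>\<^sup>+s. ennreal ((f s \<omega>)\<^sup>2) \<partial>L) \<partial>M) * emeasure L (space L)"
    by simp
  also have "(\<integral>\<^sup>+\<omega>. ennreal (B\<^sup>2 * T) * (\<integral>\<^sup>+s. ennreal ((f s \<omega>)\<^sup>2) \<partial>L) \<partial>M) = ennreal (B\<^sup>2 * T) * (\<integral>\<^sup>+\<omega>. \<integral>\<^sup>+s. ennreal ((f s \<omega>)\<^sup>2) \<partial>L \<partial>M)"
  proof (rule nn_integral_cmult)
    have "(\<lambda>x. ennreal ((f (snd x) (fst x))\<^sup>2)) \<in> borel_measurable (M \<Otimes>\<^sub>M L)"
    proof -
      have "(\<lambda>x. (snd x, fst x)) \<in> measurable (M \<Otimes>\<^sub>M L) (L \<Otimes>\<^sub>M M)" by measurable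
      from measurable_compose[OF this fm] show ?thesis by simp
    qed
    from L.borel_measurable_nn_integral_fst[OF this]
    show "(\<lambda>\<omega>. \<integral>\<^sup>+s. ennreal ((f s \<omega>)\<^sup>2) \<partial>L) \<in> borel_measurable M" by simp
  qed
  also have "\<dots> * emeasure L (space L) < \<infinity>"
  proof -
    have "emeasure L (space L) < \<top>" using L.emeasure_finite[of "space L"] by (simp only: less_top)
    moreover have "ennreal (B\<^sup>2 * T) * (\<integral>\<^sup>+\<omega>. \<integral>\<^sup>+s. ennreal ((f s \<omega>)\<^sup>2) \<partial>L \<partial>M) < \<top>"
      using f2 by (simp add: ennreal_mult_less_top)
    ultimately show ?thesis
      unfolding infinity_ennreal_def ennreal_mult_less_top[of _ "emeasure L (space L)"] by blast
  qed
  finally show ?thesis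
    using Vm by (simp add: proc2_iff_nn_integral PM_def case_prod_beta')
qed

end

section \<open>The controlled Volterra equation\<close>

text \<open>Only the values of the kernel on \<open>[0, T]\<close> matter; clamping the argument makes it continuous and
  bounded on the whole line.\<close>
definition clamp_fun :: "real \<Rightarrow> (real \<Rightarrow> real) \<Rightarrow> real \<Rightarrow> real" where
  "clamp_fun T f x = f (max 0 (min T x))"

lemma clamp_fun_eq: "x \<in> {0..T} \<Longrightarrow> clamp_fun T f x = f x"
  by (simp add: clamp_fun_def)

lemma continuous_on_clamp_fun:
  assumes "0 \<le> T" "continuous_on {0..T} f"
  shows "continuous_on UNIV (clamp_fun T f)"
  unfolding clamp_fun_def
  by (rule continuous_on_compose2[OF assms(2)]) (use assms(1) in \<open>auto intro!: continuous_intros\<close>)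

lemma clamp_fun_bounded:
  assumes "0 \<le> T" "continuous_on {0..T} f"
  obtains B where "\<And>x. \<bar>clamp_fun T f x\<bar> \<le> B"
proof -
  obtain B where "\<And>x. x \<in> {0..T} \<Longrightarrow> \<bar>f x\<bar> \<le> B" using continuous_on_Icc_bounded[OF assms(2)] by blast
  then have "\<bar>clamp_fun T f x\<bar> \<le> B" for x using assms(1) by (auto simp: clamp_fun_def)
  then show thesis by (rule that)
qed

text \<open>The kernel is evaluated only at points t - s of [0, T]. The Riemann sums behind
  \<open>wiener_int\<close> coincide for both kernels, so the two choices are equal and not just
  a.e. equal.\<close>

lemma sve_sol_clamp_fun:
  assumes T: "0 \<le> T"
  shows "sve_sol M W (clamp_fun T K) T \<alpha> \<beta> \<sigma> X0 u X \<longleftrightarrow> sve_sol M W K T \<alpha> \<beta> \<sigma> X0 u X"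
proof -
  have *: "wiener_int M W (\<lambda>s. clamp_fun T K (t - s)) t = wiener_int M W (\<lambda>s. K (t - s)) t" if t: "t \<in> {0..T}" for t
  proof -
    have "(\<Sum>i<N. clamp_fun T K (t - t * real i / real N) * D i) = (\<Sum>i<N. K (t - t * real i / real N) * D i)" for N D
    proof (rule sum.cong[OF refl])
      fix i assume "i \<in> {..<N}"
      then have "t * real i / real N \<in> {0..t}" using t by (intro grid_point_mem) auto
      then show "clamp_fun T K (t - t * real i / real N) * D i = K (t - t * real i / real N) * D i"
        using t by (subst clamp_fun_eq) auto
    qed
    then show ?thesis unfolding wiener_int_def by simp
  qed
  have **: "(LINT s:{0..t}|lborel. clamp_fun T K (t - s) * f s) = (LINT s:{0..t}|lborel. K (t - s) * f s)"
    if "t \<in> {0..T}" for t f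
    by (rule set_lebesgue_integral_cong) (use that in \<open>auto simp: clamp_fun_eq\<close>)
  show ?thesis
    unfolding sve_sol_def by (intro conj_cong refl ball_cong) (simp_all only: * **)
qed

context brownian_horizon
begin

context
  fixes K r :: "real \<Rightarrow> real" and \<alpha> \<beta> \<sigma> X0 BK Br :: real and u :: "real \<Rightarrow> 'a \<Rightarrow> real"
  assumes b: "0 < \<beta>"
    and Kc: "continuous_on UNIV K" and KB: "\<And>x. \<bar>K x\<bar> \<le> BK"
    and rc: "continuous_on UNIV r" and rB: "\<And>x. \<bar>r x\<bar> \<le> Br"
    and res: "resolvent_on T \<beta> K r"
    and u: "proc2 u"
begin

lemma Km: "K \<in> borel_measurable borel" and rm: "r \<in> borel_measurable borel"
  using Kc rc by (auto intro: borel_measurable_continuous_onI)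

lemma vconv_K_r: "x \<in> {0..T} \<Longrightarrow> vconv K r x = 1 / \<beta> * K x + - 1 / \<beta> * r x"
  using res b by (auto simp: resolvent_on_def field_simps)

text \<open>The resolvent equation gives the convolution of K and r as (K - r) / \<beta>;
  associativity moves it onto f, and commutativity gives the second order of factors. Existence of
  the state uses the first identity, its mean the second.\<close>

lemma vconv_vconv_resolvent:
  assumes f: "set_integrable lborel {0..T} f" and t: "t \<in> {0..T}"
  shows "\<beta> * vconv K (vconv r f) t = vconv K f t - vconv r f t"
    "\<beta> * vconv r (vconv K f) t = vconv K f t - vconv r f t"
proof -
  have *: "vconv (vconv K r) f t = 1 / \<beta> * vconv K f t + - 1 / \<beta> * vconv r f t"
  proof -
    have "vconv (vconv K r) f t = vconv (\<lambda>x. 1 / \<beta> * K x + - 1 / \<beta> * r x) f t"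
      by (rule vconv_cong) (use t vconv_K_r in auto)
    also have "\<dots> = 1 / \<beta> * vconv K f t + - 1 / \<beta> * vconv r f t"
      by (rule vconv_linear_left[OF Km KB rm rB f t])
    finally show ?thesis .
  qed
  show "\<beta> * vconv K (vconv r f) t = vconv K f t - vconv r f t"
    unfolding vconv_assoc[OF Km KB rm rB f t] * using b by (simp add: field_simps)
  have "vconv r K = vconv K r" by (rule ext) (rule vconv_commute)
  then show "\<beta> * vconv r (vconv K f) t = vconv K f t - vconv r f t"
    unfolding vconv_assoc[OF rm rB Km KB f t] using * b by (simp add: field_simps)
qed

text \<open>Variation of constants: with forcing term f = X0 + \<alpha> (K conv u) + \<sigma> Y, the
  solution is f - \<beta> (r conv f). Without existence the state selected in \<open>Jfun\<close>
  would be unspecified.\<close>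

lemma sve_sol_exists: "\<exists>X. sve_sol M W K T \<alpha> \<beta> \<sigma> X0 u X"
proof -
  obtain Y where Ym: "(\<lambda>(t, \<omega>). Y t \<omega>) \<in> borel_measurable (PM T M)"
    and Y2: "integrable (PM T M) (\<lambda>(t, \<omega>). (Y t \<omega>)\<^sup>2)"
    and Y: "\<forall>t\<in>{0..T}. integrable M (Y t) \<and> expectation (Y t) = 0 \<and>
      (AE \<omega> in M. wiener_int M W (\<lambda>s. K (t - s)) t \<omega> = Y t \<omega>)"
    by (rule wiener_int_version[OF less_imp_le[OF T_pos] Kc])
  have YW: "AE \<omega> in M. wiener_int M W (\<lambda>s. K (t - s)) t \<omega> = Y t \<omega>" if "t \<in> {0..T}" for t
    using Y that by blast
  have pY: "proc2 Y" using Ym Y2 by (simp add: proc2_def)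
  \<comment> \<open>The factors 1 fit the pattern a f + b g of \<open>proc2_linear\<close>.\<close>
  define f where "f t \<omega> = 1 * (X0 * 1 + \<alpha> * vconv K (\<lambda>s. u s \<omega>) t) + \<sigma> * Y t \<omega>" for t \<omega>
  have f: "proc2 f" unfolding f_def
    by (intro proc2_linear proc2_vconv[OF u Km KB] pY proc2_deterministic continuous_intros)
  have Vf: "proc2 (\<lambda>t \<omega>. vconv r (\<lambda>s. f s \<omega>) t)" by (rule proc2_vconv[OF f rm rB])
  define X where "X t \<omega> = 1 * f t \<omega> + (- \<beta>) * vconv r (\<lambda>s. f s \<omega>) t" for t \<omega>
  have X: "proc2 X" unfolding X_def by (intro proc2_linear f Vf)
  have "AE \<omega> in M. X t \<omega> = X0 + (LINT s:{0..t}|lborel. K (t - s) * (\<alpha> * u s \<omega> - \<beta> * X s \<omega>)) +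
        \<sigma> * wiener_int M W (\<lambda>s. K (t - s)) t \<omega>" if t: "t \<in> {0..T}" for t
    using proc2_AE[OF u] proc2_AE[OF f] proc2_AE[OF Vf] proc2_AE[OF X] YW[OF t]
  proof eventually_elim
    fix \<omega>
    assume ui: "set_integrable lborel {0..T} (\<lambda>s. u s \<omega>)"
      and fi: "set_integrable lborel {0..T} (\<lambda>s. f s \<omega>)"
      and vi: "set_integrable lborel {0..T} (\<lambda>s. vconv r (\<lambda>s. f s \<omega>) s)"
      and xi: "set_integrable lborel {0..T} (\<lambda>s. X s \<omega>)"
      and yw: "wiener_int M W (\<lambda>s. K (t - s)) t \<omega> = Y t \<omega>"
    have "(LINT s:{0..t}|lborel. K (t - s) * (\<alpha> * u s \<omega> - \<beta> * X s \<omega>)) = vconv K (\<lambda>s. \<alpha> * u s \<omega> + (- \<beta>) * X s \<omega>) t"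
      by (simp add: vconv_def)
    also have "\<dots> = \<alpha> * vconv K (\<lambda>s. u s \<omega>) t + (- \<beta>) * vconv K (\<lambda>s. X s \<omega>) t"
      by (rule vconv_linear_right[OF Km KB ui xi t])
    also have "vconv K (\<lambda>s. X s \<omega>) t = 1 * vconv K (\<lambda>s. f s \<omega>) t + (- \<beta>) * vconv K (vconv r (\<lambda>s. f s \<omega>)) t"
      unfolding X_def by (rule vconv_linear_right[OF Km KB fi vi t])
    also have "\<dots> = vconv r (\<lambda>s. f s \<omega>) t"
      using vconv_vconv_resolvent(1)[OF fi t] by simp
    finally have "(LINT s:{0..t}|lborel. K (t - s) * (\<alpha> * u s \<omega> - \<beta> * X s \<omega>))
       = \<alpha> * vconv K (\<lambda>s. u s \<omega>) t + (- \<beta>) * vconv r (\<lambda>s. f s \<omega>) t" .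
    then show "X t \<omega> = X0 + (LINT s:{0..t}|lborel. K (t - s) * (\<alpha> * u s \<omega> - \<beta> * X s \<omega>)) +
        \<sigma> * wiener_int M W (\<lambda>s. K (t - s)) t \<omega>"
      unfolding yw by (simp add: X_def[of t \<omega>] f_def[of t \<omega>])
  qed
  then have "sve_sol M W K T \<alpha> \<beta> \<sigma> X0 u X"
    using X unfolding sve_sol_def proc2_def by simp
  then show ?thesis by blast
qed

text \<open>Every solution has this mean at T, so the choice in \<open>Jfun\<close> does not matter
  and uniqueness need not be discussed. The means solve a deterministic Volterra equation, which the
  resolvent inverts.\<close>

lemma sve_sol_mean:
  assumes X: "sve_sol M W K T \<alpha> \<beta> \<sigma> X0 u X"
  shows "integrable M (X T)"
    "(\<integral>\<omega>. X T \<omega> \<partial>M) = X0 * (1 - \<beta> * vconv r (\<lambda>_. 1) T) + \<alpha> * vconv r (\<lambda>s. \<integral>\<omega>. u s \<omega> \<partial>M) T"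
proof -
  obtain Y where Ym: "(\<lambda>(t, \<omega>). Y t \<omega>) \<in> borel_measurable (PM T M)"
    and Y2: "integrable (PM T M) (\<lambda>(t, \<omega>). (Y t \<omega>)\<^sup>2)"
    and Y: "\<forall>t\<in>{0..T}. integrable M (Y t) \<and> expectation (Y t) = 0 \<and>
      (AE \<omega> in M. wiener_int M W (\<lambda>s. K (t - s)) t \<omega> = Y t \<omega>)"
    by (rule wiener_int_version[OF less_imp_le[OF T_pos] Kc])
  have YW: "AE \<omega> in M. wiener_int M W (\<lambda>s. K (t - s)) t \<omega> = Y t \<omega>" if "t \<in> {0..T}" for t
    using Y that by blast
  have Yi: "integrable M (Y t)" and Y0: "expectation (Y t) = 0" if "t \<in> {0..T}" for t
    using Y that by blast+
  have X2: "proc2 X" using X by (simp add: sve_sol_def proc2_def)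
  define m where "m s = (\<integral>\<omega>. X s \<omega> \<partial>M)" for s
  define v where "v s = (\<integral>\<omega>. u s \<omega> \<partial>M)" for s
  have mi: "set_integrable lborel {0..T} m" unfolding m_def by (rule proc2_mean[OF X2])
  have vi: "set_integrable lborel {0..T} v" unfolding v_def by (rule proc2_mean[OF u])
  have TT: "T \<in> {0..T}" using T_pos by simp
  have eq: "integrable M (X t) \<and> m t = X0 + \<alpha> * vconv K v t - \<beta> * vconv K m t" if t: "t \<in> {0..T}" for t
  proof -
    let ?R = "\<lambda>\<omega>. X0 + \<alpha> * vconv K (\<lambda>s. u s \<omega>) t - \<beta> * vconv K (\<lambda>s. X s \<omega>) t + \<sigma> * Y t \<omega>"
    have sv: "AE \<omega> in M. X t \<omega> = X0 + (LINT s:{0..t}|lborel. K (t - s) * (\<alpha> * u s \<omega> - \<beta> * X s \<omega>)) +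
        \<sigma> * wiener_int M W (\<lambda>s. K (t - s)) t \<omega>" using X t by (simp add: sve_sol_def)
    have ae: "AE \<omega> in M. X t \<omega> = ?R \<omega>"
      using sv YW[OF t] proc2_AE[OF u] proc2_AE[OF X2]
    proof eventually_elim
      fix \<omega>
      assume 1: "X t \<omega> = X0 + (LINT s:{0..t}|lborel. K (t - s) * (\<alpha> * u s \<omega> - \<beta> * X s \<omega>)) +
          \<sigma> * wiener_int M W (\<lambda>s. K (t - s)) t \<omega>"
        and 2: "wiener_int M W (\<lambda>s. K (t - s)) t \<omega> = Y t \<omega>"
        and ui: "set_integrable lborel {0..T} (\<lambda>s. u s \<omega>)" and xi: "set_integrable lborel {0..T} (\<lambda>s. X s \<omega>)"
      have "(LINT s:{0..t}|lborel. K (t - s) * (\<alpha> * u s \<omega> - \<beta> * X s \<omega>)) = vconv K (\<lambda>s. \<alpha> * u s \<omega> + (- \<beta>) * X s \<omega>) t"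
        by (simp add: vconv_def)
      also have "\<dots> = \<alpha> * vconv K (\<lambda>s. u s \<omega>) t + (- \<beta>) * vconv K (\<lambda>s. X s \<omega>) t"
        by (rule vconv_linear_right[OF Km KB ui xi t])
      finally show "X t \<omega> = ?R \<omega>" using 1 2 by simp
    qed
    note iu = proc2_vconv_mean[OF u Km KB t] and ix = proc2_vconv_mean[OF X2 Km KB t]
    have Ri: "integrable M ?R" using iu(1) ix(1) Yi[OF t] by simp
    have Xm: "X t \<in> borel_measurable M"
    proof -
      have "(\<lambda>x. X (fst x) (snd x)) \<in> borel_measurable (L \<Otimes>\<^sub>M M)"
        using proc2_measurable[OF X2] by (simp add: case_prod_beta')
      from measurable_compose[OF measurable_Pair1' this, of t] show ?thesis using t by (simp add: space_L)
    qed
    have "m t = (\<integral>\<omega>. ?R \<omega> \<partial>M)" unfolding m_def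
      by (rule integral_cong_AE[OF Xm _ ae]) (use Ri in auto)
    also have "\<dots> = X0 + \<alpha> * vconv K v t - \<beta> * vconv K m t"
      using iu ix Yi[OF t] Y0[OF t] unfolding m_def[abs_def] v_def[abs_def] by (simp add: prob_space)
    finally have "m t = X0 + \<alpha> * vconv K v t - \<beta> * vconv K m t" .
    moreover have "integrable M (X t)"
      using integrable_cong_AE[OF Xm _ ae] Ri by auto
    ultimately show ?thesis by blast
  qed
  show "integrable M (X T)" using eq[OF TT] by (rule conjunct1)
  have m_eq: "m t = X0 + \<alpha> * vconv K v t - \<beta> * vconv K m t" if "t \<in> {0..T}" for t
    using eq[OF that] by (rule conjunct2)
  have Vi: "set_integrable lborel {0..T} (vconv K (\<lambda>s. \<integral>\<omega>. f s \<omega> \<partial>M))" if f: "proc2 f" for f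
  proof -
    have "set_integrable lborel {0..T} (\<lambda>t. \<integral>\<omega>. vconv K (\<lambda>s. f s \<omega>) t \<partial>M)"
      by (rule proc2_mean[OF proc2_vconv[OF f Km KB]])
    also have "?this \<longleftrightarrow> ?thesis"
      by (rule set_integrable_cong) (auto simp: proc2_vconv_mean(2)[OF f Km KB])
    finally show ?thesis .
  qed
  have Vm: "set_integrable lborel {0..T} (vconv K m)" and Vv: "set_integrable lborel {0..T} (vconv K v)"
    using Vi[OF X2] Vi[OF u] by (simp_all add: m_def[abs_def] v_def[abs_def])
  have c1: "set_integrable lborel {0..T} (\<lambda>_. 1 :: real)"
    by (intro borel_integrable_atLeastAtMost' continuous_intros)
  have Vv': "set_integrable lborel {0..T} (\<lambda>s. X0 * 1 + \<alpha> * vconv K v s)"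
    using c1 Vv by (intro set_integral_add set_integrable_mult_right)
  \<comment> \<open>Convolving the mean equation with r and replacing \<beta> (r conv (K conv m)) by
    (K conv m) - (r conv m) cancels r conv m and leaves an explicit value for K conv m at T.\<close>
  have "vconv r m T = vconv r (\<lambda>s. 1 * (X0 * 1 + \<alpha> * vconv K v s) + (- \<beta>) * vconv K m s) T"
    by (rule vconv_cong) (simp_all add: m_eq)
  also have "\<dots> = X0 * vconv r (\<lambda>_. 1) T + \<alpha> * vconv r (vconv K v) T - \<beta> * vconv r (vconv K m) T"
    by (simp only: vconv_linear_right[OF rm rB Vv' Vm TT] vconv_linear_right[OF rm rB c1 Vv TT])
       simp
  finally have "vconv K m T = X0 * vconv r (\<lambda>_. 1) T + \<alpha> * vconv r (vconv K v) T"
    using vconv_vconv_resolvent(2)[OF mi TT] by linarith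
  moreover note m_eq[OF TT]
  ultimately have "m T = X0 * (1 - \<beta> * vconv r (\<lambda>_. 1) T) + \<alpha> * (vconv K v T - \<beta> * vconv r (vconv K v) T)"
    by (simp add: algebra_simps)
  then show "(\<integral>\<omega>. X T \<omega> \<partial>M) = X0 * (1 - \<beta> * vconv r (\<lambda>_. 1) T) + \<alpha> * vconv r (\<lambda>s. \<integral>\<omega>. u s \<omega> \<partial>M) T"
    using vconv_vconv_resolvent(2)[OF vi TT] by (simp add: m_def v_def[abs_def])
qed

end

end

section \<open>The performance functional\<close>

context brownian_horizon
begin

lemma continuous_on_integrable_L: "continuous_on {0..T} g \<Longrightarrow> integrable L g" for g :: "real \<Rightarrow> real"
  unfolding integrable_L_iff by (rule borel_integrable_atLeastAtMost')

lemma integral_L_bound: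
  fixes g :: "real \<Rightarrow> real"
  assumes g: "continuous_on {0..T} g" and e: "\<And>s. s \<in> {0..T} \<Longrightarrow> \<bar>g s\<bar> \<le> e"
  shows "\<bar>\<integral>s. g s \<partial>L\<bar> \<le> T * e"
proof -
  have "\<bar>\<integral>s. g s \<partial>L\<bar> \<le> (\<integral>s. \<bar>g s\<bar> \<partial>L)" by (rule integral_abs_bound)
  also have "\<dots> \<le> (\<integral>s. e \<partial>L)"
    by (intro integral_mono continuous_on_integrable_L continuous_intros g) (auto simp: space_L e)
  also have "\<dots> = T * e"
    using T_pos by (simp add: space_L measure_restrict_space)
  finally show ?thesis .
qed

lemma integral_PM_deterministic:
  fixes g :: "real \<Rightarrow> real"
  assumes "continuous_on {0..T} g"
  shows "integrable (L \<Otimes>\<^sub>M M) (\<lambda>(s, \<omega>). g s)" "(\<integral>(s, \<omega>). g s \<partial>(L \<Otimes>\<^sub>M M)) = (\<integral>s. g s \<partial>L)"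
proof -
  show i: "integrable (L \<Otimes>\<^sub>M M) (\<lambda>(s, \<omega>). g s)"
    by (rule proc2_integrable[OF proc2_deterministic[OF assms]])
  show "(\<integral>(s, \<omega>). g s \<partial>(L \<Otimes>\<^sub>M M)) = (\<integral>s. g s \<partial>L)"
    using LM.integral_fst[OF i] by (simp add: prob_space)
qed

lemma continuous_on_reflect:
  assumes "continuous_on {0..T} (r :: real \<Rightarrow> real)"
  shows "continuous_on {0..T} (\<lambda>s. r (T - s))"
  by (rule continuous_on_compose2[OF assms]) (auto intro!: continuous_intros)

lemma proc2_mult_integrable:
  assumes f: "proc2 f" and g: "proc2 g"
  shows "integrable (L \<Otimes>\<^sub>M M) (\<lambda>(s, \<omega>). f s \<omega> * g s \<omega>)"
proof -
  have i: "integrable (L \<Otimes>\<^sub>M M) (\<lambda>x. (f (fst x) (snd x))\<^sup>2 + (g (fst x) (snd x))\<^sup>2)"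
    using f g by (intro Bochner_Integration.integrable_add) (auto simp: proc2_def PM_def case_prod_beta')
  have [measurable]: "(\<lambda>x. f (fst x) (snd x)) \<in> borel_measurable (L \<Otimes>\<^sub>M M)"
    "(\<lambda>x. g (fst x) (snd x)) \<in> borel_measurable (L \<Otimes>\<^sub>M M)"
    using proc2_measurable[OF f] proc2_measurable[OF g] by (simp_all add: case_prod_beta')
  have "integrable (L \<Otimes>\<^sub>M M) (\<lambda>x. f (fst x) (snd x) * g (fst x) (snd x))"
  proof (rule Bochner_Integration.integrable_bound[OF i])
    have "\<bar>x * y\<bar> \<le> x\<^sup>2 + y\<^sup>2" for x y :: real
    proof -
      have "2 * (\<bar>x\<bar> * \<bar>y\<bar>) \<le> x\<^sup>2 + y\<^sup>2"
        using sum_squares_bound[of "\<bar>x\<bar>" "\<bar>y\<bar>"] by (simp add: mult.assoc)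
      moreover have "0 \<le> \<bar>x\<bar> * \<bar>y\<bar>" by simp
      ultimately show ?thesis unfolding abs_mult by linarith
    qed
    then show "AE x in L \<Otimes>\<^sub>M M. norm (f (fst x) (snd x) * g (fst x) (snd x)) \<le> norm ((f (fst x) (snd x))\<^sup>2 + (g (fst x) (snd x))\<^sup>2)"
      by (auto intro: order_trans[OF _ abs_ge_self])
  qed measurable
  then show ?thesis by (simp add: case_prod_beta')
qed

text \<open>The control enters X(T) linearly through its mean, weighted by r(T - s). The constant c
  satisfies \<alpha> a2 = 2 a1 c, which makes this linear term the mixed term of the square.\<close>

lemma Jfun_complete_square:
  fixes \<alpha> \<beta> \<sigma> X0 a1 a2 c :: real
  assumes b: "0 < \<beta>" and a1: "0 < a1" and c: "c = \<alpha> * a2 / (2 * a1)"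
    and res: "resolvent_on T \<beta> K r" and u: "proc2 u"
  shows "Jfun M W K T \<alpha> \<beta> \<sigma> X0 a1 a2 u =
    a2 * X0 * (1 - \<beta> * (\<integral>s. r (T - s) \<partial>L)) + a1 * c\<^sup>2 * (\<integral>s. (r (T - s))\<^sup>2 \<partial>L)
      - a1 * (\<integral>(s, \<omega>). (u s \<omega> - c * r (T - s))\<^sup>2 \<partial>PM T M)"
proof -
  have T0: "0 \<le> T" and TT: "T \<in> {0..T}" using T_pos by auto
  have cK: "continuous_on {0..T} K" and cr: "continuous_on {0..T} r" using res by (auto simp: resolvent_on_def)
  \<comment> \<open>The state lemmas ask for kernel and resolvent on the whole line; clamping
    changes neither the equation nor the values used.\<close>
  define K' where "K' = clamp_fun T K"
  define r' where "r' = clamp_fun T r"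
  obtain BK where KB: "\<And>x. \<bar>K' x\<bar> \<le> BK" unfolding K'_def by (rule clamp_fun_bounded[OF T0 cK]) blast
  obtain Br where rB: "\<And>x. \<bar>r' x\<bar> \<le> Br" unfolding r'_def by (rule clamp_fun_bounded[OF T0 cr]) blast
  have Kc: "continuous_on UNIV K'" unfolding K'_def by (rule continuous_on_clamp_fun[OF T0 cK])
  have rc: "continuous_on UNIV r'" unfolding r'_def by (rule continuous_on_clamp_fun[OF T0 cr])
  have r'r: "r' (T - s) = r (T - s)" if "s \<in> {0..T}" for s using that by (simp add: r'_def clamp_fun_eq)
  have res': "resolvent_on T \<beta> K' r'"
    unfolding resolvent_on_def
  proof (intro conjI ballI)
    fix t assume t: "t \<in> {0..T}"
    have "vconv K' r' t = vconv K r t"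
      by (rule vconv_cong) (use t in \<open>auto simp: K'_def r'_def clamp_fun_eq\<close>)
    then show "r' t = K' t - \<beta> * vconv K' r' t"
      using res t by (simp add: resolvent_on_def K'_def r'_def clamp_fun_eq)
  qed (use Kc rc in \<open>auto intro: continuous_on_subset\<close>)
  define X where "X = (SOME X. sve_sol M W K T \<alpha> \<beta> \<sigma> X0 u X)"
  have "sve_sol M W K' T \<alpha> \<beta> \<sigma> X0 u X"
    using someI_ex[OF sve_sol_exists[OF b Kc KB rc rB res' u, of \<alpha> \<sigma> X0]]
    unfolding K'_def sve_sol_clamp_fun[OF T0] X_def .
  note Xm = sve_sol_mean[OF b Kc KB rc rB res' u this]
  define Q where "Q = (\<integral>(s, \<omega>). (u s \<omega>)\<^sup>2 \<partial>(L \<Otimes>\<^sub>M M))"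
  define P where "P = (\<integral>(s, \<omega>). r (T - s) * u s \<omega> \<partial>(L \<Otimes>\<^sub>M M))"
  define I where "I = (\<integral>s. r (T - s) \<partial>L)"
  define S where "S = (\<integral>s. (r (T - s))\<^sup>2 \<partial>L)"
  have w: "proc2 (\<lambda>s \<omega>. r (T - s))" by (intro proc2_deterministic continuous_on_reflect cr)
  have i1: "integrable (L \<Otimes>\<^sub>M M) (\<lambda>(s, \<omega>). (u s \<omega>)\<^sup>2)" using u by (simp add: proc2_def PM_def)
  have i2: "integrable (L \<Otimes>\<^sub>M M) (\<lambda>(s, \<omega>). r (T - s) * u s \<omega>)" by (rule proc2_mult_integrable[OF w u])
  have c2: "continuous_on {0..T} (\<lambda>s. (r (T - s))\<^sup>2)" by (intro continuous_intros continuous_on_reflect cr)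
  have i3: "integrable (L \<Otimes>\<^sub>M M) (\<lambda>(s, \<omega>). (r (T - s))\<^sup>2)" by (rule integral_PM_deterministic(1)[OF c2])
  have e1: "(LINT s:{0..T}|lborel. a1 * (u s \<omega>)\<^sup>2) = a1 * (\<integral>s. (u s \<omega>)\<^sup>2 \<partial>L)" for \<omega>
    by (simp add: set_lebesgue_integral_def integral_restrict_space)
  have J: "Jfun M W K T \<alpha> \<beta> \<sigma> X0 a1 a2 u = - (a1 * Q) + a2 * (\<integral>\<omega>. X T \<omega> \<partial>M)"
  proof -
    have "Jfun M W K T \<alpha> \<beta> \<sigma> X0 a1 a2 u = (\<integral>\<omega>. - (a1 * (\<integral>s. (u s \<omega>)\<^sup>2 \<partial>L)) + a2 * X T \<omega> \<partial>M)"
      unfolding Jfun_def X_def[symmetric] Let_def e1 ..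
    also have "\<dots> = - (a1 * (\<integral>\<omega>. (\<integral>s. (u s \<omega>)\<^sup>2 \<partial>L) \<partial>M)) + a2 * (\<integral>\<omega>. X T \<omega> \<partial>M)"
      using LM.integrable_snd[OF i1] Xm(1) by simp
    also have "(\<integral>\<omega>. (\<integral>s. (u s \<omega>)\<^sup>2 \<partial>L) \<partial>M) = Q" unfolding Q_def by (rule LM.integral_snd[OF i1])
    finally show ?thesis .
  qed
  have v1: "vconv r' (\<lambda>_. 1) T = I"
    unfolding vconv_L[OF TT] I_def
    by (rule Bochner_Integration.integral_cong) (auto simp: space_L r'r)
  have v2: "vconv r' (\<lambda>s. \<integral>\<omega>. u s \<omega> \<partial>M) T = P"
  proof -
    have "vconv r' (\<lambda>s. \<integral>\<omega>. u s \<omega> \<partial>M) T = (\<integral>s. (\<integral>\<omega>. r (T - s) * u s \<omega> \<partial>M) \<partial>L)"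
      unfolding vconv_L[OF TT]
      by (rule Bochner_Integration.integral_cong) (auto simp: space_L r'r)
    also have "\<dots> = P" unfolding P_def by (rule LM.integral_fst[OF i2])
    finally show ?thesis .
  qed
  have "(\<integral>(s, \<omega>). (u s \<omega> - c * r (T - s))\<^sup>2 \<partial>PM T M)
     = (\<integral>x. (\<lambda>(s, \<omega>). (u s \<omega>)\<^sup>2) x - 2 * c * (\<lambda>(s, \<omega>). r (T - s) * u s \<omega>) x + c\<^sup>2 * (\<lambda>(s, \<omega>). (r (T - s))\<^sup>2) x \<partial>(L \<Otimes>\<^sub>M M))"
    unfolding PM_def
    by (rule Bochner_Integration.integral_cong) (auto simp: power2_eq_square algebra_simps)
  also have "\<dots> = Q - 2 * c * P + c\<^sup>2 * (\<integral>(s, \<omega>). (r (T - s))\<^sup>2 \<partial>(L \<Otimes>\<^sub>M M))"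
    unfolding Q_def P_def
    by (subst Bochner_Integration.integral_add Bochner_Integration.integral_diff; (intro Bochner_Integration.integrable_diff integrable_mult_right i1 i2 i3)?)+ simp
  also have "(\<integral>(s, \<omega>). (r (T - s))\<^sup>2 \<partial>(L \<Otimes>\<^sub>M M)) = S"
    unfolding S_def by (rule integral_PM_deterministic(2)[OF c2])
  finally have sq: "(\<integral>(s, \<omega>). (u s \<omega> - c * r (T - s))\<^sup>2 \<partial>PM T M) = Q - 2 * c * P + c\<^sup>2 * S" .
  have ac: "\<alpha> * a2 = 2 * a1 * c" using a1 by (simp add: c)
  have "a2 * (\<alpha> * P) = 2 * a1 * c * P" using ac by (simp add: mult_ac)
  then show ?thesis
    unfolding J Xm(2) v1 v2 sq I_def[symmetric] S_def[symmetric] by (simp add: algebra_simps)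
qed

lemma L2a_deterministic:
  assumes "continuous_on {0..T} c"
  shows "L2a M W T (\<lambda>t \<omega>. c t)"
  using proc2_deterministic[OF assms] by (simp add: L2a_def proc2_def)

end

text \<open>Boundedness is part of the conclusion because \<open>SUP\<close> on the reals has its
  intended meaning only for sets bounded above.\<close>

theorem theorem3p2:
  fixes M :: "'a measure" and W :: "real \<Rightarrow> 'a \<Rightarrow> real" and K :: "real \<Rightarrow> real"
    and T \<alpha> \<beta> \<sigma> a1 a2 X0 h :: real
  assumes "T > 0" and "\<alpha> > 0" and "\<beta> > 0" and "\<sigma> > 0" and "a1 > 0" and "a2 > 0"
    and "0 < h" and "h < 1"
    and "holder_on h {0..T} K"
    and "brownian_motion M W"
  shows "bdd_above (Jfun M W K T \<alpha> \<beta> \<sigma> X0 a1 a2 ` {u. L2a M W T u}) \<and>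
    (\<exists>C>0. \<forall>n\<ge>1. \<bar>Jfun M W (bernstein T K n) T \<alpha> \<beta> \<sigma> X0 a1 a2 (\<lambda>t \<omega>. hat_u \<alpha> \<beta> a1 a2 T K n t)
        - (SUP u\<in>{u. L2a M W T u}. Jfun M W K T \<alpha> \<beta> \<sigma> X0 a1 a2 u)\<bar> \<le> C * real n powr (- h / 2)) \<and>
    (\<exists>C>0. \<forall>n\<ge>1. \<bar>Jfun M W K T \<alpha> \<beta> \<sigma> X0 a1 a2 (\<lambda>t \<omega>. hat_u \<alpha> \<beta> a1 a2 T K n t)
        - (SUP u\<in>{u. L2a M W T u}. Jfun M W K T \<alpha> \<beta> \<sigma> X0 a1 a2 u)\<bar> \<le> C * real n powr (- h / 2))"
proof -
  interpret brownian_horizon M W T using assms by unfold_locales auto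
  note T = assms(1) and b = assms(3) and a1 = assms(5) and h = assms(7,8)
  obtain r C where res: "resolvent_on T \<beta> K r" and C: "0 < C"
    and rate: "\<And>n t. 1 \<le> n \<Longrightarrow> t \<in> {0..T} \<Longrightarrow> \<bar>res_series \<beta> (taylor_coeff T K n) t - r t\<bar> \<le> C * real n powr (- h / 2)"
    by (rule resolvent_bernstein_rate[OF T b h assms(9)]) blast
  define rn where "rn n = res_series \<beta> (taylor_coeff T K n)" for n
  define c where "c = \<alpha> * a2 / (2 * a1)"
  have cr: "continuous_on {0..T} r" using res by (simp add: resolvent_on_def)
  have resn: "resolvent_on T \<beta> (bernstein T K n) (rn n)" for n
    unfolding rn_def by (rule resolvent_on_bernstein[OF T b])
  then have crn: "continuous_on {0..T} (rn n)" for n by (auto simp: resolvent_on_def)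
  note cr' = continuous_on_reflect[OF cr] continuous_on_reflect[OF crn]
  \<comment> \<open>The optimal value as a functional of the resolvent: \<open>J r\<close> belongs
    to K, \<open>J (rn n)\<close> to its Bernstein polynomial.\<close>
  define J where "J q = a2 * X0 * (1 - \<beta> * (\<integral>s. q (T - s) \<partial>L)) + a1 * c\<^sup>2 * (\<integral>s. (q (T - s))\<^sup>2 \<partial>L)" for q
  have JK: "Jfun M W K T \<alpha> \<beta> \<sigma> X0 a1 a2 u = J r - a1 * (\<integral>(s, \<omega>). (u s \<omega> - c * r (T - s))\<^sup>2 \<partial>PM T M)"
    if "proc2 u" for u
    unfolding J_def by (rule Jfun_complete_square[OF b a1 c_def res that])
  have le: "Jfun M W K T \<alpha> \<beta> \<sigma> X0 a1 a2 u \<le> J r" if "L2a M W T u" for u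
  proof -
    have "proc2 u" using that by (simp add: L2a_def proc2_def)
    moreover have "0 \<le> (\<integral>(s, \<omega>). (u s \<omega> - c * r (T - s))\<^sup>2 \<partial>PM T M)"
      by (rule Bochner_Integration.integral_nonneg) auto
    ultimately show ?thesis using a1 by (simp add: JK)
  qed
  have opt: "L2a M W T (\<lambda>t \<omega>. c * r (T - t))" "proc2 (\<lambda>t \<omega>. c * r (T - t))"
    by (intro L2a_deterministic proc2_deterministic continuous_intros cr')+
  have Jopt: "Jfun M W K T \<alpha> \<beta> \<sigma> X0 a1 a2 (\<lambda>t \<omega>. c * r (T - t)) = J r"
    unfolding JK[OF opt(2)] by (simp add: case_prod_beta')
  have bdd: "bdd_above (Jfun M W K T \<alpha> \<beta> \<sigma> X0 a1 a2 ` {u. L2a M W T u})"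
    using le by (intro bdd_aboveI[of _ "J r"]) auto
  \<comment> \<open>The supremum is attained, since the maximiser is deterministic and continuous,
    hence admissible.\<close>
  have sup: "(SUP u\<in>{u. L2a M W T u}. Jfun M W K T \<alpha> \<beta> \<sigma> X0 a1 a2 u) = J r"
    by (rule cSup_eq_maximum) (use le opt(1) Jopt in \<open>auto intro!: image_eqI[of _ _ "\<lambda>t \<omega>. c * r (T - t)"]\<close>)
  have hu: "hat_u \<alpha> \<beta> a1 a2 T K n t = c * rn n (T - t)" if "t \<in> {0..T}" for n t
    unfolding c_def rn_def by (rule hat_u_eq[OF b]) (use that in simp)
  have chu: "continuous_on {0..T} (hat_u \<alpha> \<beta> a1 a2 T K n)" for n
    by (subst continuous_on_cong[OF refl hu]) (auto intro!: continuous_intros cr')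
  have phu: "proc2 (\<lambda>t \<omega>. hat_u \<alpha> \<beta> a1 a2 T K n t)" for n by (rule proc2_deterministic[OF chu])
  obtain B where B: "0 < B" "\<And>x. x \<in> {0..T} \<Longrightarrow> \<bar>r x\<bar> \<le> B"
    using continuous_on_Icc_bounded[OF cr] by blast
  define p where "p n = real n powr (- h / 2)" for n :: nat
  have p: "0 < p n" "p n \<le> 1" if "1 \<le> n" for n
    using that h powr_mono[of "- h / 2" 0 "real n"] by (auto simp: p_def)
  have d: "\<bar>rn n (T - s) - r (T - s)\<bar> \<le> C * p n" if "1 \<le> n" "s \<in> {0..T}" for n s
    unfolding p_def rn_def by (rule rate) (use that in auto)
  \<comment> \<open>C1 bounds the change of the optimal value: a linear part, and a difference of
    squares factored with |r_n + r| <= 2 B + C. C2 bounds the squared deviation of the two controls.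
    Both use p n <= 1.\<close>
  define C1 where "C1 = \<bar>a2 * X0\<bar> * \<beta> * (T * C) + a1 * c\<^sup>2 * (T * (C * (2 * B + C)))"
  define C2 where "C2 = a1 * (T * (c * C)\<^sup>2)"
  have 1: "\<bar>Jfun M W (bernstein T K n) T \<alpha> \<beta> \<sigma> X0 a1 a2 (\<lambda>t \<omega>. hat_u \<alpha> \<beta> a1 a2 T K n t) - J r\<bar> \<le> C1 * p n"
    if n: "1 \<le> n" for n
  proof -
    \<comment> \<open>For its own kernel \<open>hat_u\<close> annihilates the square, so the value
      attained is exactly \<open>J (rn n)\<close>.\<close>
    have "(\<integral>(s, \<omega>). (hat_u \<alpha> \<beta> a1 a2 T K n s - c * rn n (T - s))\<^sup>2 \<partial>PM T M) = (\<integral>x. 0 \<partial>PM T M)"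
      by (rule Bochner_Integration.integral_cong) (auto simp: PM_def space_pair_measure space_L hu)
    then have "Jfun M W (bernstein T K n) T \<alpha> \<beta> \<sigma> X0 a1 a2 (\<lambda>t \<omega>. hat_u \<alpha> \<beta> a1 a2 T K n t) = J (rn n)"
      using Jfun_complete_square[OF b a1 c_def resn[of n] phu[of n], of \<sigma> X0] by (simp add: J_def)
    moreover have "J (rn n) - J r = - (a2 * X0) * \<beta> * (\<integral>s. rn n (T - s) - r (T - s) \<partial>L)
       + a1 * c\<^sup>2 * (\<integral>s. (rn n (T - s))\<^sup>2 - (r (T - s))\<^sup>2 \<partial>L)"
    proof -
      have d1: "(\<integral>s. rn n (T - s) - r (T - s) \<partial>L) = (\<integral>s. rn n (T - s) \<partial>L) - (\<integral>s. r (T - s) \<partial>L)"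
        by (intro Bochner_Integration.integral_diff continuous_on_integrable_L cr')
      have d2: "(\<integral>s. (rn n (T - s))\<^sup>2 - (r (T - s))\<^sup>2 \<partial>L) = (\<integral>s. (rn n (T - s))\<^sup>2 \<partial>L) - (\<integral>s. (r (T - s))\<^sup>2 \<partial>L)"
        by (intro Bochner_Integration.integral_diff continuous_on_integrable_L continuous_intros cr')
      show ?thesis unfolding J_def d1 d2 by (simp add: algebra_simps)
    qed
    moreover have "\<bar>\<integral>s. rn n (T - s) - r (T - s) \<partial>L\<bar> \<le> T * (C * p n)"
      by (intro integral_L_bound continuous_intros cr' d n)
    then have "\<bar>- (a2 * X0) * \<beta> * (\<integral>s. rn n (T - s) - r (T - s) \<partial>L)\<bar> \<le> \<bar>a2 * X0\<bar> * \<beta> * (T * (C * p n))"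
      unfolding abs_mult[of "- (a2 * X0) * \<beta>"] using b by (intro mult_mono) (auto simp: abs_mult)
    moreover have "\<bar>\<integral>s. (rn n (T - s))\<^sup>2 - (r (T - s))\<^sup>2 \<partial>L\<bar> \<le> T * (C * p n * (2 * B + C))"
    proof (intro integral_L_bound continuous_intros cr')
      fix s assume s: "s \<in> {0..T}"
      define x where "x = rn n (T - s)"
      define y where "y = r (T - s)"
      have xy: "\<bar>x - y\<bar> \<le> C * p n" unfolding x_def y_def by (rule d[OF n s])
      have "C * p n \<le> C * 1" using C p[OF n] by (intro mult_left_mono) auto
      moreover have "\<bar>y\<bar> \<le> B" unfolding y_def by (rule B) (use s in auto)
      ultimately have "\<bar>x + y\<bar> \<le> 2 * B + C" using xy by linarith
      then have "\<bar>x - y\<bar> * \<bar>x + y\<bar> \<le> C * p n * (2 * B + C)"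
        using xy C p[OF n] by (intro mult_mono) auto
      then show "\<bar>(rn n (T - s))\<^sup>2 - (r (T - s))\<^sup>2\<bar> \<le> C * p n * (2 * B + C)"
        unfolding x_def[symmetric] y_def[symmetric] square_diff_square_factored[of x y, folded power2_eq_square]
        by (simp add: abs_mult mult.commute)
    qed
    then have "\<bar>a1 * c\<^sup>2 * (\<integral>s. (rn n (T - s))\<^sup>2 - (r (T - s))\<^sup>2 \<partial>L)\<bar> \<le> a1 * c\<^sup>2 * (T * (C * p n * (2 * B + C)))"
      unfolding abs_mult[of "a1 * c\<^sup>2"] using a1 by (intro mult_mono) auto
    ultimately have "\<bar>Jfun M W (bernstein T K n) T \<alpha> \<beta> \<sigma> X0 a1 a2 (\<lambda>t \<omega>. hat_u \<alpha> \<beta> a1 a2 T K n t) - J r\<bar>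
       \<le> \<bar>a2 * X0\<bar> * \<beta> * (T * (C * p n)) + a1 * c\<^sup>2 * (T * (C * p n * (2 * B + C)))"
      by linarith
    also have "\<dots> = C1 * p n" by (simp add: C1_def algebra_simps)
    finally show ?thesis .
  qed
  have 2: "\<bar>Jfun M W K T \<alpha> \<beta> \<sigma> X0 a1 a2 (\<lambda>t \<omega>. hat_u \<alpha> \<beta> a1 a2 T K n t) - J r\<bar> \<le> C2 * p n"
    if n: "1 \<le> n" for n
  proof -
    let ?g = "\<lambda>s. (hat_u \<alpha> \<beta> a1 a2 T K n s - c * r (T - s))\<^sup>2"
    have cg: "continuous_on {0..T} ?g" by (intro continuous_intros chu cr')
    have "\<bar>\<integral>s. ?g s \<partial>L\<bar> \<le> T * ((c * C)\<^sup>2 * p n)"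
    proof (rule integral_L_bound[OF cg])
      fix s assume s: "s \<in> {0..T}"
      have "\<bar>rn n (T - s) - r (T - s)\<bar>\<^sup>2 \<le> (C * p n)\<^sup>2"
        using d[OF n s] by (intro power_mono) auto
      also have "\<dots> = C\<^sup>2 * (p n * p n)" by (simp add: power2_eq_square)
      \<comment> \<open>Here the order n^(-h) actually obtained is weakened to the stated
        n^(-h/2).\<close>
      also have "\<dots> \<le> C\<^sup>2 * (p n * 1)" using p[OF n] by (intro mult_left_mono) auto
      finally have "c\<^sup>2 * (rn n (T - s) - r (T - s))\<^sup>2 \<le> c\<^sup>2 * (C\<^sup>2 * p n)"
        by (intro mult_left_mono) auto
      moreover have "?g s = c\<^sup>2 * (rn n (T - s) - r (T - s))\<^sup>2"
        unfolding hu[OF s] by (simp add: power_mult_distrib flip: right_diff_distrib)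
      ultimately show "\<bar>?g s\<bar> \<le> (c * C)\<^sup>2 * p n"
        by (simp add: power_mult_distrib mult.assoc)
    qed
    then have "a1 * \<bar>\<integral>s. ?g s \<partial>L\<bar> \<le> a1 * (T * ((c * C)\<^sup>2 * p n))"
      using a1 by (intro mult_left_mono) auto
    moreover have "(\<integral>(s, \<omega>). ?g s \<partial>PM T M) = (\<integral>s. ?g s \<partial>L)"
      unfolding PM_def by (rule integral_PM_deterministic(2)[OF cg])
    ultimately show ?thesis
      unfolding JK[OF phu] using a1 by (simp add: C2_def abs_mult mult.assoc)
  qed
  have C12: "0 \<le> C1" "0 \<le> C2" using C B a1 b T by (auto simp: C1_def C2_def)
  have "\<exists>C>0. \<forall>n\<ge>1. \<bar>F n - J r\<bar> \<le> C * real n powr (- h / 2)"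
    if "0 \<le> C'" "\<And>n. 1 \<le> n \<Longrightarrow> \<bar>F n - J r\<bar> \<le> C' * p n" for F :: "nat \<Rightarrow> real" and C'
  \<comment> \<open>C1 and C2 have only been shown nonnegative; adding one gives the required
    positive constant.\<close>
  proof (intro exI[of _ "C' + 1"] conjI allI impI)
    fix n :: nat assume n: "1 \<le> n"
    have "\<bar>F n - J r\<bar> \<le> C' * p n" by (rule that(2)[OF n])
    also have "\<dots> \<le> (C' + 1) * p n" using p[OF n] by (intro mult_right_mono) auto
    finally show "\<bar>F n - J r\<bar> \<le> (C' + 1) * real n powr (- h / 2)" by (simp add: p_def)
  qed (use that(1) in simp)
  from this[OF C12(1) 1] this[OF C12(2) 2] bdd show ?thesis unfolding sup by blast
qed

end
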